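(* Let $n\ge1$ and $\pi\in S_\mathbb{Z}$. Then the Little bumping operator $\mathfrak b_\pi$, acting on factorizations, is an isomorphism of abstract $\mathfrak{gl}_n$-crystals $\bigsqcup_{\sigma\in S_\mathbb{Z}}\mathcal R_n(\sigma)\to\bigsqcup_{\sigma\in S_\mathbb{Z}}\mathcal R_n(\sigma)$.
   Context: $S_\mathbb{Z}$ is the group of permutations of $\mathbb{Z}$ fixing all but finitely many integers, generated by $s_i=(i,i+1)$. A reduced word for $\sigma\in S_\mathbb{Z}$ is a minimal-length sequence $i_1\cdots i_l$ with $\sigma=s_{i_1}\cdots s_{i_l}$; $\mathcal R(\sigma)$ is the set of these. $\mathcal R_n(\sigma)$ is the set of $n$-tuples $w=(w^1,\dots,w^n)$ of strictly increasing, possibly empty words with $w^1\cdots w^n\in\mathcal R(\sigma)$, with $\mathrm{wt}(w)=(\ell(w^1),\dots,\ell(w^n))$. For increasing words $a,b$, $\mathsf{pair}(a,b)$ is formed by iterating over letters $b_j$ of $b$ from largest to smallest, pairing $b_j$ with the smallest unpaired letter $a_i$ of $a$ with $a_i>b_j$, if one exists. For $i\in[n-1]$: $f_i(w)=0$ if every letter of $w^i$ is paired in $\mathsf{pair}(w^i,w^{i+1})$; otherwise $f_i(w)$ removes the largest unpaired letter $x$ of $w^i$ and adds to $w^{i+1}$ the smallest integer $y\ge x$ not already a letter of $w^{i+1}$. $e_i(w)=0$ if every letter of $w^{i+1}$ is paired; otherwise $e_i(w)$ removes the smallest unpaired letter $y$ of $w^{i+1}$ and adds to $w^i$ the largest integer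 $x\le y$ not already a letter of $w^i$. It is known that these make $\mathcal R_n(\sigma)$ an abstract $\mathfrak{gl}_n$-crystal (a set $\mathcal B$ with $\mathrm{wt}:\mathcal B\to\mathbb{Z}^n_{\ge0}$, $e_i,f_i:\mathcal B\to\mathcal B\sqcup\{0\}$ with $e_i(b)=c\iff f_i(c)=b$, then $\mathrm{wt}(c)=\mathrm{wt}(b)+\mathbf e_i-\mathbf e_{i+1}$, and finite string lengths $\varepsilon_i,\varphi_i$ with $\varphi_i-\varepsilon_i=\mathrm{wt}_i-\mathrm{wt}_{i+1}$); an isomorphism is a bijection of $\mathcal B\sqcup\{0\}$ onto $\mathcal C\sqcup\{0\}$ with $0\mapsto 0$ preserving weights and string lengths and commuting with all $e_i,f_i$. Little bumps: for a word $w$ and index $i$, $\mathrm{del}_i(w)$ omits the $i$th letter; $(w,i)$ is a $\pi$-marked word if $\mathrm{del}_i(w)\in\mathcal R(\pi)$; it is reduced if $w$ is a reduced word. It is known that if $(w,i)$ is an unreduced $\pi$-marked word there is a unique $j\neq i$ with $(w,j)$ a $\pi$-marked word. Define $\mathsf{push}(w,i)=(v,j)$ where $j=i$ if $w$ is reduced and $j$ is this unique index otherwise, and $v$ is $w$ with its $j$th letter increased by $1$. For a reduced word $w$, if there is an index $i$ (necessarily unique) with $(w,i)$ a $\pi$-marked word, let $N>0$ be minimal such that $\mathsf{push}^N(w,i)=(v,j)$ is reduced (such $N$ exists) and set $\mathfrak b_\pi(w)=v$; otherwise $\mathfrak b_\pi(w)=w$. It is known that $\mathfrak b_\pi$ preserves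 the descent set $\{i: w_i>w_{i+1}\}$ of reduced words. For $w=(w^1,\dots,w^n)\in\mathcal R_n(\sigma)$, $\mathfrak b_\pi(w)=(v^1,\dots,v^n)$ where $\ell(v^j)=\ell(w^j)$ and $v^1\cdots v^n=\mathfrak b_\pi(w^1\cdots w^n)$. *)

theory Defs
  imports Main
begin

definition sT :: "int \<Rightarrow> int \<Rightarrow> int" where
  "sT i x = (if x = i then i + 1 else if x = i + 1 then i else x)"

definition SZ :: "(int \<Rightarrow> int) set" where
  "SZ = {p. bij p \<and> finite {x. p x \<noteq> x}}"

definition perm_of_word :: "int list \<Rightarrow> (int \<Rightarrow> int)" where
  "perm_of_word w = foldr (\<lambda>i g. sT i \<circ> g) w id"

definition reduced :: "int list \<Rightarrow> bool" where
  "reduced w \<longleftrightarrow> (\<forall>v. perm_of_word v = perm_of_word w \<longrightarrow> length w \<le> length v)"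

definition Rwords :: "(int \<Rightarrow> int) \<Rightarrow> int list set" where
  "Rwords \<sigma> = {w. reduced w \<and> perm_of_word w = \<sigma>}"

text \<open>R_n(sigma): n-tuples (lists of length n) of strictly increasing words whose
  concatenation is a reduced word for sigma. Component w^k is the list entry at index k-1.\<close>
definition Rn :: "nat \<Rightarrow> (int \<Rightarrow> int) \<Rightarrow> int list list set" where
  "Rn n \<sigma> = {w. length w = n \<and> (\<forall>u\<in>set w. sorted_wrt (<) u) \<and> concat w \<in> Rwords \<sigma>}"

definition wt :: "int list list \<Rightarrow> nat list" where
  "wt w = map length w"

text \<open>pair(a,b): letters of b are processed from largest to smallest (the second
  argument of pair_aux is b in decreasing order); each is paired with the smallest
  still-unpaired letter of a that is larger, if one exists.\<close>
fun pair_aux :: "int list \<Rightarrow> int list \<Rightarrow> (int \<times> int) list" where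
  "pair_aux A [] = []"
| "pair_aux A (y # ys) =
     (if {x \<in> set A. y < x} = {} then pair_aux A ys
      else (let x = Min {x \<in> set A. y < x} in (x, y) # pair_aux (remove1 x A) ys))"

definition pairing :: "int list \<Rightarrow> int list \<Rightarrow> (int \<times> int) list" where
  "pairing a b = pair_aux a (rev b)"

definition unpaired_left :: "int list \<Rightarrow> int list \<Rightarrow> int set" where
  "unpaired_left a b = {x \<in> set a. x \<notin> fst ` set (pairing a b)}"

definition unpaired_right :: "int list \<Rightarrow> int list \<Rightarrow> int set" where
  "unpaired_right a b = {y \<in> set b. y \<notin> snd ` set (pairing a b)}"

text \<open>f_i and e_i for i in [n-1]; None plays the role of 0. They act on the
  components w^i (index i-1) and w^(i+1) (index i).\<close>
definition fop :: "nat \<Rightarrow> int list list \<Rightarrow> int list list option" where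
  "fop i w = (let a = w ! (i - 1); b = w ! i; U = unpaired_left a b in
     if U = {} then None
     else (let x = Max U; y = (LEAST y. x \<le> y \<and> y \<notin> set b) in
           Some (w[i - 1 := remove1 x a, i := insort y b])))"

definition eop :: "nat \<Rightarrow> int list list \<Rightarrow> int list list option" where
  "eop i w = (let a = w ! (i - 1); b = w ! i; U = unpaired_right a b in
     if U = {} then None
     else (let y = Min U; x = (GREATEST x. x \<le> y \<and> x \<notin> set a) in
           Some (w[i - 1 := insort x a, i := remove1 y b])))"

fun opt_iter :: "('a \<Rightarrow> 'a option) \<Rightarrow> nat \<Rightarrow> 'a \<Rightarrow> 'a option" where
  "opt_iter g 0 b = Some b"
| "opt_iter g (Suc k) b = Option.bind (opt_iter g k b) g"

definition str_len :: "('a \<Rightarrow> 'a option) \<Rightarrow> 'a \<Rightarrow> nat" where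
  "str_len g b = (GREATEST k. opt_iter g k b \<noteq> None)"

text \<open>A bijection B -> C (extended by 0 |-> 0, i.e. via map_option) preserving weights
  and string lengths and commuting with all e_i, f_i, i in [n-1].\<close>
definition crystal_iso ::
  "nat \<Rightarrow> 'a set \<Rightarrow> ('a \<Rightarrow> nat list) \<Rightarrow> (nat \<Rightarrow> 'a \<Rightarrow> 'a option) \<Rightarrow> (nat \<Rightarrow> 'a \<Rightarrow> 'a option)
   \<Rightarrow> 'b set \<Rightarrow> ('b \<Rightarrow> nat list) \<Rightarrow> (nat \<Rightarrow> 'b \<Rightarrow> 'b option) \<Rightarrow> (nat \<Rightarrow> 'b \<Rightarrow> 'b option)
   \<Rightarrow> ('a \<Rightarrow> 'b) \<Rightarrow> bool" where
  "crystal_iso n B wtB eB fB C wtC eC fC \<phi> \<longleftrightarrow>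
     bij_betw \<phi> B C \<and>
     (\<forall>b\<in>B. wtC (\<phi> b) = wtB b) \<and>
     (\<forall>i\<in>{1..n-1}. \<forall>b\<in>B.
        eC i (\<phi> b) = map_option \<phi> (eB i b) \<and>
        fC i (\<phi> b) = map_option \<phi> (fB i b) \<and>
        str_len (eC i) (\<phi> b) = str_len (eB i) b \<and>
        str_len (fC i) (\<phi> b) = str_len (fB i) b)"

definition del :: "nat \<Rightarrow> 'a list \<Rightarrow> 'a list" where
  "del i w = take i w @ drop (Suc i) w"

definition marked :: "(int \<Rightarrow> int) \<Rightarrow> int list \<Rightarrow> nat \<Rightarrow> bool" where
  "marked \<pi> w i \<longleftrightarrow> i < length w \<and> del i w \<in> Rwords \<pi>"

definition push :: "(int \<Rightarrow> int) \<Rightarrow> int list \<times> nat \<Rightarrow> int list \<times> nat" where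
  "push \<pi> wi = (let w = fst wi; i = snd wi;
      j = (if reduced w then i else (THE j. j \<noteq> i \<and> marked \<pi> w j))
    in (w[j := w ! j + 1], j))"

definition bump :: "(int \<Rightarrow> int) \<Rightarrow> int list \<Rightarrow> int list" where
  "bump \<pi> w = (if \<exists>i. marked \<pi> w i then
      (let i = (THE i. marked \<pi> w i);
           N = (LEAST N. 0 < N \<and> reduced (fst ((push \<pi> ^^ N) (w, i))))
       in fst ((push \<pi> ^^ N) (w, i)))
    else w)"

fun split_by :: "nat list \<Rightarrow> 'a list \<Rightarrow> 'a list list" where
  "split_by [] xs = []"
| "split_by (k # ks) xs = take k xs # split_by ks (drop k xs)"

definition bump_fact :: "(int \<Rightarrow> int) \<Rightarrow> int list list \<Rightarrow> int list list" where
  "bump_fact \<pi> w = split_by (map length w) (bump \<pi> (concat w))"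

end

theory Submission
  imports Defs "HOL-Combinatorics.Transposition"
begin

text \<open>
  A Little bump is local: while it passes through a window of consecutive letters, it acts on that
  window as a Little bump of the window alone, and what happens outside depends on the window only
  through its permutation. Hence a relation between words with equal permutations that is
  preserved by bumps of the words themselves is preserved by bumps in any context. It therefore
  suffices to treat windows of two letters (for descents) and windows \<open>a b\<close> formed by two adjacent
  increasing factors (for the crystal operators).

  Write \<open>A\<close> and \<open>B\<close> for the letter sets of \<open>a\<close> and \<open>b\<close>. A bump of \<open>a b\<close> shifts a run of consecutive
  letters in one factor and then at most one run in the other. The operator \<open>f\<close> turns the block
  \<open>{x..y}\<close>, \<open>{x..y-1}\<close> of \<open>A\<close> and \<open>B\<close> into \<open>{x+1..y}\<close>, \<open>{x..y}\<close>, where \<open>x\<close> is the first point at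
  which the height \<open>#{a \<in> A. a \<le> t} - #{b \<in> B. b < t}\<close> is maximal. Comparing the two descriptions
  shows that bumps commute with \<open>f\<close> and preserve \<open>f = 0\<close>; since bumps are bijective and \<open>e\<close> inverts
  \<open>f\<close>, they commute with \<open>e\<close> as well.
\<close>

section \<open>Reduced words and the exchange property\<close>

text \<open>Two obstacles shape the argument. Words with equal permutations need not be bumped in
  step: inside a window the two runs may take different numbers of increments, so related windows
  are compared only when both have become reduced again, and repeated visits to the same window have
  to be allowed for. What keeps the runs comparable is that a deletion from a fixed reduced word is
  determined by its effect on the permutation, which is multiplication by a transposition. Marks in
  two words for the same permutation can therefore be identified through this transposition, even
  when they sit at different positions or in different factors. Furthermore, bumping changes the
  permutation of a word and retains only that of the word with the marked letter deleted; for this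
  reason the argument treats all reduced words at once. Bijectivity comes from negating all letters:
  this is conjugation by a reflection of the integers, it preserves reducedness, and it turns
  increments into decrements, so the negated words of a run, read backwards, form a run.\<close>

abbreviation P :: "int list \<Rightarrow> int \<Rightarrow> int" where "P \<equiv> perm_of_word"

lemma sT_transpose: "sT i = transpose i (i + 1)"
  by (auto simp: sT_def transpose_def fun_eq_iff)

lemma sT_sT [simp]: "sT i \<circ> sT i = id" "sT i (sT i x) = x"
  by (auto simp: sT_def fun_eq_iff)

lemma bij_sT: "bij (sT i)"
  by (simp add: sT_transpose)

lemma P_Nil [simp]: "P [] = id"
  by (simp add: perm_of_word_def)

lemma P_Cons [simp]: "P (i # w) = sT i \<circ> P w"
  by (simp add: perm_of_word_def)

lemma P_append [simp]: "P (u @ v) = P u \<circ> P v"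
  by (induction u) (auto simp: comp_assoc)

lemma bij_P: "bij (P w)"
proof (induction w)
  case (Cons i w)
  then show ?case unfolding P_Cons by (intro bij_comp bij_sT)
qed (simp only: P_Nil bij_id)

lemma P_cancel_left: "P u \<circ> f = P u \<circ> g \<longleftrightarrow> f = g"
  using bij_is_inj[OF bij_P[of u]] by (auto simp: fun_eq_iff inj_def)

lemma P_cancel_right: "f \<circ> P u = g \<circ> P u \<longleftrightarrow> f = g"
proof
  assume eq: "f \<circ> P u = g \<circ> P u"
  show "f = g"
  proof
    fix x
    obtain y where "x = P u y" using bij_P[of u] by (metis bij_pointE)
    then show "f x = g x" using fun_cong[OF eq, of y] by simp
  qed
qed simp

lemma sT_move: "sT i \<circ> f = g \<longleftrightarrow> f = sT i \<circ> g"
  by (auto simp: fun_eq_iff) (metis sT_sT(2))+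

lemma P_inj: "P w x = P w y \<longleftrightarrow> x = y"
  using bij_is_inj[OF bij_P[of w]] by (auto simp: inj_def)

lemma P_SZ: "P w \<in> SZ"
proof -
  have "finite {x. P w x \<noteq> x}"
  proof (induction w)
    case (Cons i w)
    have "{x. P (i # w) x \<noteq> x} \<subseteq> {x. P w x \<noteq> x} \<union> {i, i + 1}"
      by (auto simp: sT_def)
    then show ?case using Cons finite_subset by blast
  qed simp
  then show ?thesis using bij_P by (simp add: SZ_def)
qed

lemma del_append_Cons [simp]: "del (length u) (u @ x # v) = u @ v"
  by (simp add: del_def)

lemma del_Cons_0 [simp]: "del 0 (x # v) = v"
  by (simp add: del_def)

lemma length_del: "i < length w \<Longrightarrow> length (del i w) = length w - 1"
  by (simp add: del_def)

lemma split_at: "i < length w \<Longrightarrow> w = take i w @ w ! i # drop (Suc i) w \<and> length (take i w) = i"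
  by (simp add: id_take_nth_drop)

lemma split_at_obtain:
  assumes "i < length w"
  obtains u x v where "w = u @ x # v" "length u = i"
  using split_at[OF assms] by blast

lemma del_append_left: "i < length u \<Longrightarrow> del i (u @ v) = del i u @ v"
  by (simp add: del_def)

lemma del_append_right: "del (length u + i) (u @ v) = u @ del i v"
  by (simp add: del_def)

lemma reduced_cong: "P u = P v \<Longrightarrow> length u = length v \<Longrightarrow> reduced u \<longleftrightarrow> reduced v"
  by (simp add: reduced_def)

lemma reduced_window_cong:
  "P M = P M' \<Longrightarrow> length M = length M' \<Longrightarrow> reduced (L @ M @ R) \<longleftrightarrow> reduced (L @ M' @ R)"
  by (rule reduced_cong) simp_all

lemma reduced_windowD:
  assumes "reduced (L @ M @ R)" shows "reduced M"
  unfolding reduced_def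
proof (intro allI impI)
  fix v assume "P v = P M"
  then have "P (L @ v @ R) = P (L @ M @ R)" by simp
  then have "length (L @ M @ R) \<le> length (L @ v @ R)" using assms unfolding reduced_def by blast
  then show "length M \<le> length v" by simp
qed

text \<open>The letters act from right to left. If the wires starting at \<open>p\<close> and
  \<open>q\<close> end in inverted order, some letter crosses them, and deleting that letter
  interchanges their two ends. The induction strips the leftmost letter: either the remaining word
  has already inverted the wires, or this letter is the crossing.\<close>

lemma strong_exchange:
  assumes "p < q" "P v q < P v p"
  shows "\<exists>j < length v. P (del j v) = P v \<circ> transpose p q"
  using assms
proof (induction v)
  case (Cons i v)
  show ?case
  proof (cases "P v q < P v p")
    case True
    then obtain j where j: "j < length v" "P (del j v) = P v \<circ> transpose p q"
      using Cons by blast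
    then have "P (del (Suc j) (i # v)) = P (i # v) \<circ> transpose p q"
      by (simp add: del_def comp_assoc)
    then show ?thesis using j by (intro exI[of _ "Suc j"]) simp
  next
    case False
    have "P v p \<noteq> P v q" using Cons.prems by (simp add: P_inj)
    then have "P v p = i \<and> P v q = i + 1"
      using False Cons.prems(2) by (auto simp: sT_def split: if_splits)
    then have "sT i \<circ> P v \<circ> transpose p q = P v"
      using P_inj[of v] by (auto simp: fun_eq_iff sT_def transpose_def) metis+
    then have "P (del 0 (i # v)) = P (i # v) \<circ> transpose p q" by (simp only: del_Cons_0 P_Cons)
    moreover have "0 < length (i # v)" by simp
    ultimately show ?thesis by blast
  qed
qed simp

text \<open>Every word for \<open>P w\<close> inverts \<open>p\<close> and \<open>q\<close>, so one
  of its letters can be deleted to obtain a word for \<open>P v\<close>, which is at least as long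
  as \<open>v\<close>.\<close>

lemma reduced_transpose:
  assumes "reduced v" "P w = P v \<circ> transpose p q" "length w = Suc (length v)"
    and "p < q" "P v p < P v q"
  shows "reduced w"
  unfolding reduced_def
proof (intro allI impI)
  fix u assume u: "P u = P w"
  have "P u q < P u p" using assms by (simp add: u)
  from strong_exchange[OF assms(4) this] obtain j where j: "j < length u" "P (del j u) = P u \<circ> transpose p q"
    by blast
  have "P (del j u) = P v" by (simp add: j(2) u assms(2) comp_assoc)
  then have "length v \<le> length (del j u)" using assms(1) unfolding reduced_def by blast
  then show "length w \<le> length u" using j(1) assms(3) by (simp add: length_del)
qed

lemma reduced_snoc: "reduced (w @ [y]) \<longleftrightarrow> reduced w \<and> P w y < P w (y + 1)"
proof
  assume r: "reduced (w @ [y])"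
  have rw: "reduced w" using r reduced_windowD[of "[]" w "[y]"] by simp
  have "\<not> P w (y + 1) < P w y"
  proof
    assume "P w (y + 1) < P w y"
    from strong_exchange[OF _ this] obtain j where j: "j < length w" "P (del j w) = P (w @ [y])"
      by (auto simp flip: sT_transpose)
    then have "length (w @ [y]) \<le> length (del j w)" using r unfolding reduced_def by blast
    then show False using j(1) by (simp add: length_del)
  qed
  moreover have "P w y \<noteq> P w (y + 1)" by (simp add: P_inj)
  ultimately show "reduced w \<and> P w y < P w (y + 1)" using rw by simp
next
  assume "reduced w \<and> P w y < P w (y + 1)"
  then show "reduced (w @ [y])"
    by (auto intro!: reduced_transpose[of w "w @ [y]" y "y + 1"] simp flip: sT_transpose)
qed

lemma reduced_Nil [simp]: "reduced []" by (simp add: reduced_def)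

text \<open>Where the letter \<open>x\<close> acts, it crosses the wires that \<open>R\<close> has
  carried to \<open>x\<close> and \<open>x + 1\<close>. The transposition is expressed by their
  starting points, hence does not depend on \<open>L\<close>.\<close>

lemma P_insert_transpose:
  assumes "P R p = x" "P R q = x + 1"
  shows "P (L @ x # R) = P (L @ R) \<circ> transpose p q"
proof -
  have "sT x \<circ> P R = P R \<circ> transpose p q"
    using assms P_inj[of R] by (auto simp: fun_eq_iff sT_def transpose_def) metis+
  then show ?thesis by (simp add: comp_assoc)
qed

lemma wires_obtain:
  obtains p q where "P R p = x" "P R q = x + 1"
  using bij_P[of R] by (metis bij_pointE)

lemma ordered_wires_obtain:
  obtains p q where "p < q" "\<And>L. P (L @ x # R) = P (L @ R) \<circ> transpose p q"
proof -
  obtain p q where pq: "P R p = x" "P R q = x + 1" by (rule wires_obtain)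
  then have "p \<noteq> q" by auto
  then show ?thesis
    using that[of p q] that[of q p] P_insert_transpose[OF pq] transpose_commute[of p q]
    by (cases p q rule: linorder_cases) auto
qed

text \<open>The existence half of the two-mark property. By \<open>reduced_transpose\<close>, the
  wires crossed by \<open>x\<close> are already inverted by \<open>L @ R\<close>, so deleting a
  suitable letter of \<open>L @ R\<close> has the same effect as inserting \<open>x\<close>; doing
  both cancels.\<close>

lemma other_mark_exists:
  assumes "reduced (L @ R)" "\<not> reduced (L @ x # R)"
  shows "\<exists>k < length (L @ x # R). k \<noteq> length L \<and> P (del k (L @ x # R)) = P (L @ R)"
proof -
  obtain p q where "p < q" and Pw: "P (L @ x # R) = P (L @ R) \<circ> transpose p q"
    using ordered_wires_obtain[of x R] by metis
  have "\<not> P (L @ R) p < P (L @ R) q"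
    using reduced_transpose[OF assms(1) Pw] \<open>p < q\<close> assms(2) by auto
  moreover have "P (L @ R) p \<noteq> P (L @ R) q" using \<open>p < q\<close> by (simp add: P_inj del: P_append)
  ultimately have "P (L @ R) q < P (L @ R) p" by simp
  from strong_exchange[OF \<open>p < q\<close> this] obtain j where
    j: "j < length (L @ R)" "P (del j (L @ R)) = P (L @ x # R)" using Pw by auto
  show ?thesis
  proof (cases "j < length L")
    case True
    then obtain L1 z L2 where L: "L = L1 @ z # L2" "length L1 = j" by (rule split_at_obtain)
    have "P (L1 @ L2) \<circ> P R = (P L \<circ> sT x) \<circ> P R"
      using j(2) L by (simp add: comp_assoc del_append_left flip: comp_assoc)
         (metis L(2) append.assoc append_Cons comp_assoc del_append_Cons P_append)
    then have "P (L1 @ L2) = P L \<circ> sT x" using P_cancel_right by blast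
    then have "P (L1 @ L2) \<circ> sT x = P L" by (simp add: comp_assoc)
    then have "P (L1 @ L2 @ x # R) = P (L @ R)"
      by (metis P_Cons P_append append.assoc comp_assoc)
    moreover have "del j (L @ x # R) = L1 @ L2 @ x # R" using L by (simp flip: L(2))
    ultimately show ?thesis using True by (intro exI[of _ j]) simp
  next
    case False
    then obtain R1 z R2 where R: "R = R1 @ z # R2" "length (L @ R1) = j"
      using j(1) split_at_obtain[of "j - length L" R]
      by (metis add.commute length_append less_diff_conv2 linorder_not_less ordered_cancel_comm_monoid_diff_class.add_diff_inverse)
    have "P L \<circ> P (R1 @ R2) = P L \<circ> (sT x \<circ> P R)"
    proof -
      have "del j (L @ R) = L @ R1 @ R2" using R del_append_Cons[of "L @ R1" z R2] by simp
      then show ?thesis using j(2) by (simp add: comp_assoc)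
    qed
    then have "P (R1 @ R2) = sT x \<circ> P R" using P_cancel_left by blast
    then have "P (L @ x # R1 @ R2) = P (L @ R)" using sT_move by (metis P_Cons P_append)
    moreover have "del (Suc j) (L @ x # R) = L @ x # R1 @ R2"
      using R del_append_Cons[of "L @ x # R1" z R2] by simp
    \<comment> \<open>The deleted letter lies to the right of the inserted \<open>x\<close>, so its
      index grows by one.\<close>
    ultimately show ?thesis using j False by (intro exI[of _ "Suc j"]) auto
  qed
qed

lemma two_marks_window:
  assumes "j < k" "k < length w" "P (del j w) = P (del k w)"
  obtains L x M y R where "w = L @ x # M @ y # R" "length L = j" "length L + length M + 1 = k"
    "P (x # M) = P (M @ [y])"
proof -
  obtain V y R where 1: "w = V @ y # R" "length V = k" using assms split_at_obtain by blast
  obtain L x M where 2: "V = L @ x # M" "length L = j" using assms 1 split_at_obtain by metis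
  have w: "w = L @ x # M @ y # R" using 1 2 by simp
  have "del j w = L @ M @ y # R" using w 2 by (simp flip: 2(2))
  moreover have "del k w = L @ x # M @ R" using del_append_Cons[of V y R] 1 2 by simp
  ultimately have "P L \<circ> (P (M @ [y]) \<circ> P R) = P L \<circ> (P (x # M) \<circ> P R)"
    using assms(3) by (simp add: comp_assoc)
  then have "P (x # M) = P (M @ [y])" unfolding P_cancel_left P_cancel_right by simp
  then show ?thesis using that w 1 2 by simp
qed

text \<open>The relation turns \<open>x # M @ [y]\<close> into \<open>M\<close> followed by
  \<open>y\<close> twice, so its permutation is that of the shorter word \<open>M\<close>.\<close>

lemma two_marks_unreduced:
  assumes "P (x # M) = P (M @ [y])" shows "\<not> reduced (x # M @ [y])"
proof -
  have "P (x # M @ [y]) = P (x # M) \<circ> sT y" by (simp add: comp_assoc)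
  also have "\<dots> = P M" by (simp only: assms) (simp add: comp_assoc)
  finally have "P M = P (x # M @ [y])" by simp
  then show ?thesis unfolding reduced_def by (metis Suc_n_not_le_n append_Cons length_append_singleton length_Cons le_SucI not_less_eq_eq)
qed

lemma reduced_mark_unique:
  assumes "reduced w" "j < length w" "k < length w" "P (del j w) = P (del k w)"
  shows "j = k"
proof -
  have False if "j < k" "k < length w" "P (del j w) = P (del k w)" for j k
  proof -
    obtain L x M y R where "w = L @ x # M @ y # R" "P (x # M) = P (M @ [y])"
      by (rule two_marks_window[of j k w]) (use \<open>j < k\<close> \<open>k < length w\<close> \<open>P (del j w) = P (del k w)\<close> in auto)
    then show False using two_marks_unreduced reduced_windowD[of L "x # M @ [y]" R] assms(1) by auto
  qed
  then show ?thesis using assms by (metis linorder_cases)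
qed

text \<open>Deleting a letter to the left of both marks leaves the unreduced factor from
  \<open>j\<close> to \<open>k\<close> intact.\<close>

lemma three_marks_unreduced:
  assumes "i < j" "j < k" "k < length w" "P (del j w) = P (del k w)"
  shows "\<not> reduced (del i w)"
proof -
  obtain L x M y R where w: "w = L @ x # M @ y # R" "length L = j" "P (x # M) = P (M @ [y])"
    using two_marks_window assms by metis
  have "del i w = del i L @ (x # M @ [y]) @ R" using w assms by (simp add: del_append_left)
  then show ?thesis using two_marks_unreduced w reduced_windowD by metis
qed

text \<open>The uniqueness half. Among three distinct indices the smallest would have an unreduced
  deletion, whereas all three deletions have the permutation and the length of the reduced word
  \<open>del i w\<close>.\<close>

lemma other_mark_unique:
  assumes "reduced (del i w)" "i < length w" "j < length w" "k < length w"
    and "i \<noteq> j" "i \<noteq> k" "P (del j w) = P (del i w)" "P (del k w) = P (del i w)"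
  shows "j = k"
proof (rule ccontr)
  assume "j \<noteq> k"
  have all: "x < length w \<and> reduced (del x w) \<and> P (del x w) = P (del i w)" if "x \<in> {i, j, k}" for x
    using that assms reduced_cong[of "del j w" "del i w"] reduced_cong[of "del k w" "del i w"]
    by (auto simp: length_del)
  have chain: False if "x < y" "y < z" "x \<in> {i, j, k}" "y \<in> {i, j, k}" "z \<in> {i, j, k}" for x y z
    using three_marks_unreduced[OF that(1,2)] all[OF that(3)] all[OF that(4)] all[OF that(5)] by metis
  show False
    using chain[of i j k] chain[of i k j] chain[of j i k] chain[of j k i] chain[of k i j]
      chain[of k j i] \<open>i \<noteq> j\<close> \<open>i \<noteq> k\<close> \<open>j \<noteq> k\<close>
    by (meson insertCI linorder_neqE_nat)
qed

lemma other_mark: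
  assumes "reduced (del i w)" "i < length w" "\<not> reduced w"
  obtains k where "k < length w" "k \<noteq> i" "P (del k w) = P (del i w)"
proof -
  obtain L x R where "w = L @ x # R" "length L = i" using assms split_at_obtain by blast
  then show ?thesis using other_mark_exists[of L R x] assms that by auto
qed

section \<open>Little bumps as runs of marked words\<close>

text \<open>For an element of \<open>SZ\<close>, this is membership in the parabolic subgroup
  generated by all \<open>sT i\<close> with \<open>i\<close> different from \<open>c\<close>. The
  finitely many non-cuts bound the letters that occur during a bump and so force it to end.\<close>

definition cut :: "(int \<Rightarrow> int) \<Rightarrow> int \<Rightarrow> bool" where
  "cut f c \<longleftrightarrow> (\<forall>x. x \<le> c \<longleftrightarrow> f x \<le> c)"

lemma cut_P_avoid: "c \<notin> set w \<Longrightarrow> cut (P w) c"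
proof (induction w)
  case (Cons i w)
  moreover have "sT i x \<le> c \<longleftrightarrow> x \<le> c" for x using Cons.prems by (auto simp: sT_def)
  ultimately show ?case unfolding cut_def P_Cons comp_apply by (metis list.set_intros(2))
qed (simp add: cut_def)

lemma finite_not_cut: "f \<in> SZ \<Longrightarrow> finite {c. \<not> cut f c}"
proof -
  assume "f \<in> SZ"
  then have "finite (\<Union>x\<in>{x. f x \<noteq> x}. {min x (f x)..max x (f x)})"
    by (auto simp: SZ_def)
  moreover have "{c. \<not> cut f c} \<subseteq> (\<Union>x\<in>{x. f x \<noteq> x}. {min x (f x)..max x (f x)})"
  proof
    fix c assume "c \<in> {c. \<not> cut f c}"
    then obtain x where x: "(x \<le> c) \<noteq> (f x \<le> c)" by (auto simp: cut_def)
    then have "f x \<noteq> x" "min x (f x) \<le> c" "c \<le> max x (f x)" by linarith+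
    then show "c \<in> (\<Union>x\<in>{x. f x \<noteq> x}. {min x (f x)..max x (f x)})" by fastforce
  qed
  ultimately show ?thesis by (rule rev_finite_subset)
qed

text \<open>At the last occurrence of \<open>c\<close>, the crossing wires start on different sides
  of the cut, since no letter further right moves anything across it. If the whole word preserved
  the cut, \<open>L @ R\<close> would invert the two wires, and an exchange in \<open>L @ R\<close>
  would give a word for \<open>P v\<close> that is shorter by two letters.\<close>

lemma reduced_letter_not_cut:
  assumes "reduced v" "c \<in> set v" shows "\<not> cut (P v) c"
proof
  assume cut: "cut (P v) c"
  obtain L R where v: "v = L @ c # R" "c \<notin> set R" using assms(2) by (meson split_list_last)
  obtain p q where pq: "P R p = c" "P R q = c + 1" by (rule wires_obtain)
  have "p \<le> c \<and> c < q" using cut_P_avoid[OF v(2)] pq unfolding cut_def by (metis linorder_not_le order.refl zless_add1_eq)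
  then have "P v p \<le> c \<and> c < P v q" using cut unfolding cut_def by (meson linorder_not_le)
  moreover have Pv: "P v = P (L @ R) \<circ> transpose p q" using P_insert_transpose[OF pq] v by simp
  ultimately have "P (L @ R) q < P (L @ R) p" by simp
  from strong_exchange[OF _ this] \<open>p \<le> c \<and> c < q\<close> obtain j where
    j: "j < length (L @ R)" "P (del j (L @ R)) = P v" using Pv by auto
  then have "length v \<le> length (del j (L @ R))" using assms(1) unfolding reduced_def by blast
  then show False using j(1) v by (simp add: length_del)
qed

text \<open>The wires crossed by \<open>c\<close> start and, without \<open>c\<close>, also end on
  different sides of the cut; hence inserting \<open>c\<close> creates an inversion.\<close>

lemma reduced_insert_cut:
  assumes "reduced (L @ R)" "cut (P (L @ R)) c" shows "reduced (L @ c # R)"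
proof -
  have "c \<notin> set R" using reduced_letter_not_cut[of "L @ R" c] assms by auto
  obtain p q where pq: "P R p = c" "P R q = c + 1" by (rule wires_obtain)
  have *: "p \<le> c \<and> c < q" using cut_P_avoid[OF \<open>c \<notin> set R\<close>] pq unfolding cut_def
    by (metis linorder_not_le order.refl zless_add1_eq)
  then have "P (L @ R) p \<le> c \<and> c < P (L @ R) q" using assms(2) unfolding cut_def by (meson linorder_not_le)
  then show ?thesis using reduced_transpose[OF assms(1) P_insert_transpose[OF pq]] * by auto
qed

section \<open>Runs of increments: uniqueness and termination\<close>

definition inc :: "int list \<Rightarrow> nat \<Rightarrow> int list" where
  "inc w j = w[j := w ! j + 1]"

lemma length_inc [simp]: "length (inc w j) = length w"
  by (simp add: inc_def)

lemma inc_append_Cons [simp]: "inc (u @ x # v) (length u) = u @ (x + 1) # v"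
  by (simp add: inc_def)

lemma inc_append_left: "i < length u \<Longrightarrow> inc (u @ v) i = inc u i @ v"
  by (simp add: inc_def list_update_append nth_append)

lemma inc_append_right: "inc (u @ v) (length u + i) = u @ inc v i"
  by (simp add: inc_def list_update_append nth_append)

lemma del_inc [simp]: "del j (inc w j) = del j w"
  by (simp add: del_def inc_def)

lemma sum_list_inc: "j < length w \<Longrightarrow> sum_list (inc w j) = sum_list w + 1"
  by (rule split_at_obtain[of j w]) auto

text \<open>The iteration of \<^const>\<open>push\<close> up to the next reduced word. The marked index \<open>j\<close> of a state is
  the one that is about to be increased, so no case distinction is needed for the first step.\<close>

inductive run :: "int list \<Rightarrow> nat \<Rightarrow> int list \<Rightarrow> nat \<Rightarrow> bool" where
  stop: "reduced (inc w j) \<Longrightarrow> run w j (inc w j) j"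
| step: "\<not> reduced (inc w j) \<Longrightarrow> k \<noteq> j \<Longrightarrow> k < length w \<Longrightarrow> P (del k (inc w j)) = P (del j w)
    \<Longrightarrow> run (inc w j) k v m \<Longrightarrow> run w j v m"

lemma run_stop: "v = inc w j \<Longrightarrow> reduced v \<Longrightarrow> run w j v j"
  using stop by blast

lemma reduced_del_cong:
  assumes "reduced (del j w)" "P (del k v) = P (del j w)" "k < length v" "j < length w" "length v = length w"
  shows "reduced (del k v)"
  using assms reduced_cong[of "del k v" "del j w"] by (simp add: length_del)

lemma run_invariants:
  "run w j v m \<Longrightarrow> j < length w \<Longrightarrow> reduced v \<and> length v = length w \<and> m < length v \<and> P (del m v) = P (del j w)
    \<and> sum_list w < sum_list v"
  by (induction rule: run.induct) (auto simp: sum_list_inc)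

text \<open>The continuation of a run is forced by the uniqueness of the other mark. Its hypothesis
  passes from state to state, because all marked deletions have the same permutation and
  length.\<close>

lemma run_deterministic:
  assumes "run w j v m" "run w j v' m'" "reduced (del j w)" "j < length w"
  shows "v' = v \<and> m' = m"
  using assms
proof (induction arbitrary: v' m' rule: run.induct)
  case (stop w j)
  then show ?case by (auto elim: run.cases)
next
  case (step w j k v m)
  from step.prems(1) step.hyps(1) obtain k' where
    k': "k' \<noteq> j" "k' < length w" "P (del k' (inc w j)) = P (del j w)" "run (inc w j) k' v' m'"
    by (cases rule: run.cases) auto
  have "k' = k"
    using other_mark_unique[of j "inc w j" k k'] k' step by simp
  moreover have "reduced (del k (inc w j))"
    using reduced_del_cong[of j w k "inc w j"] step by simp
  ultimately show ?case using step k' by simp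
qed

text \<open>As long as the word is unreduced, all its letters are non-cuts of the permutation of the
  marked deletion: the unmarked letters occur in a reduced word for it, and inserting a cut would
  have produced a reduced word. The non-cuts are bounded above, while each increment raises the sum
  of the letters by one.\<close>

lemma run_total:
  assumes "reduced (del j w)" "j < length w"
  shows "\<exists>v m. run w j v m"
proof -
  define S where "S = {c. \<not> cut (P (del j w)) c}"
  have "finite S" unfolding S_def by (rule finite_not_cut[OF P_SZ])
  then obtain K where K: "\<And>c. c \<in> S \<Longrightarrow> c \<le> K"
    by (metis bdd_above.unfold bdd_above_finite)
  define l where "l = length w"
  have sum_le: "sum_list u \<le> int (length u) * K" if "\<And>c. c \<in> set u \<Longrightarrow> c \<le> K" for u :: "int list"
    using that by (induction u) (force simp: algebra_simps)+
  have "\<exists>v m. run u i v m" if "reduced (del i u)" "i < length u" "length u = l" "P (del i u) = P (del j w)" for u i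
    using that
  proof (induction "nat (int l * K + 1 - sum_list u)" arbitrary: u i rule: less_induct)
    case less
    show ?case
    proof (cases "reduced (inc u i)")
      case True
      then show ?thesis using run.stop by blast
    next
      case False
      obtain L x R where LR: "u = L @ x # R" "length L = i" using less split_at_obtain by blast
      have del: "del i u = L @ R" and inc: "inc u i = L @ (x + 1) # R"
        using LR by auto
      have "c \<in> S" if "c \<in> set (L @ R)" for c
        using reduced_letter_not_cut[OF less.prems(1)] that less.prems del by (auto simp: S_def)
      moreover have "x + 1 \<in> S"
        using reduced_insert_cut[of L R "x + 1"] False del inc less.prems by (auto simp: S_def)
      ultimately have "\<And>c. c \<in> set (inc u i) \<Longrightarrow> c \<le> K"
        using K unfolding inc by auto
      then have "sum_list (inc u i) \<le> int l * K"
        using sum_le[of "inc u i"] less.prems(3) by simp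
      moreover have "sum_list (inc u i) = sum_list u + 1" using less sum_list_inc by simp
      ultimately have dec: "nat (int l * K + 1 - sum_list (inc u i)) < nat (int l * K + 1 - sum_list u)"
        by linarith
      obtain k where k: "k < length u" "k \<noteq> i" "P (del k (inc u i)) = P (del i u)"
        using other_mark[of i "inc u i"] less.prems False by auto
      have "\<exists>v m. run (inc u i) k v m"
        using less.hyps[OF dec, of k] k less.prems reduced_del_cong[of i u k "inc u i"] by simp
      then show ?thesis using run.step False k by blast
    qed
  qed
  then show ?thesis using assms l_def by blast
qed

section \<open>Reversal of runs\<close>

definition neg :: "int list \<Rightarrow> int list" where
  "neg = map uminus"

lemma neg_neg [simp]: "neg (neg w) = w"
  by (simp add: neg_def comp_def)

lemma length_neg [simp]: "length (neg w) = length w"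
  by (simp add: neg_def)

lemma del_neg: "del i (neg w) = neg (del i w)"
  by (simp add: neg_def del_def take_map drop_map)

lemma inc_neg_inc [simp]: "j < length w \<Longrightarrow> inc (neg (inc w j)) j = neg w"
  by (rule split_at_obtain[of j w]) (auto simp: inc_def neg_def list_update_append nth_append)

text \<open>Conjugation by \<open>x \<mapsto> 1 - x\<close> maps \<open>s\<^sub>i\<close> to \<open>s\<^bsub>-i\<^esub>\<close>.\<close>

lemma P_neg: "P (neg w) x = 1 - P w (1 - x)"
  by (induction w) (auto simp: neg_def sT_def)

lemma P_neg_eq_iff: "P (neg u) = P (neg v) \<longleftrightarrow> P u = P v"
proof
  assume eq: "P (neg u) = P (neg v)"
  show "P u = P v"
  proof
    fix x show "P u x = P v x" using fun_cong[OF eq, of "1 - x"] by (simp add: P_neg)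
  qed
qed (simp add: fun_eq_iff P_neg)

lemma reduced_neg [simp]: "reduced (neg w) \<longleftrightarrow> reduced w"
proof -
  have "reduced (neg w)" if "reduced w" for w
    unfolding reduced_def
  proof (intro allI impI)
    fix v assume "P v = P (neg w)"
    then have "P (neg v) = P w" by (metis P_neg_eq_iff neg_neg)
    then show "length (neg w) \<le> length v" using that unfolding reduced_def by (metis length_neg)
  qed
  then show ?thesis by (metis neg_neg)
qed

text \<open>The reversed run is assembled from its last part. The hypothesis about \<open>X\<close>
  and \<open>k\<close> is the accumulator: it says how the negated word continues once the letter at
  \<open>j\<close> has been restored, either by stopping because \<open>w\<close> is reduced or by
  passing to the other mark.\<close>

lemma run_reverse_aux:
  assumes "run w j v m" "j < length w"
    and "reduced w \<and> X = neg w \<and> k = j \<or>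
      \<not> reduced w \<and> (\<exists>i. i \<noteq> j \<and> i < length w \<and> P (del i w) = P (del j w) \<and> run (neg w) i X k)"
  shows "run (neg v) m X k"
  using assms
proof (induction arbitrary: X k rule: run.induct)
  case (stop w j)
  then show ?case
    using run.stop[of "neg (inc w j)" j] run.step[of "neg (inc w j)" j]
    by (auto simp: del_neg P_neg_eq_iff)
next
  case (step w j l v m)
  have "run (neg (inc w j)) j X k"
    using step.prems run.stop[of "neg (inc w j)" j] run.step[of "neg (inc w j)" j]
    by (auto simp: del_neg P_neg_eq_iff)
  moreover have "j \<noteq> l" "j < length (inc w j)" "P (del j (inc w j)) = P (del l (inc w j))"
    using step by simp_all
  moreover have "l < length (inc w j)" using step by simp
  ultimately show ?case using step.IH step.hyps(1) by blast
qed

lemma run_reverse: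
  "run w j v m \<Longrightarrow> j < length w \<Longrightarrow> reduced w \<Longrightarrow> run (neg v) m (neg w) j"
  using run_reverse_aux by blast

section \<open>The bumping operator in terms of runs\<close>

lemma run_push:
  assumes "run w j v m" "reduced (del j w)" "j < length w" "P (del j w) = \<pi>" "push \<pi> s = (inc w j, j)"
  shows "\<exists>N>0. (push \<pi> ^^ N) s = (v, m) \<and> (\<forall>k. 0 < k \<longrightarrow> k < N \<longrightarrow> \<not> reduced (fst ((push \<pi> ^^ k) s)))"
  using assms
\<comment> \<open>Only the state reached by pushing \<open>s\<close> enters, so the initial pair of
  a bump, where the mark stays in place, and a later pair, where it moves, are treated
  alike.\<close>
proof (induction arbitrary: s rule: run.induct)
  case (stop w j)
  then show ?case by (intro exI[of _ 1]) auto
next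
  case (step w j k v m)
  let ?w = "inc w j"
  have rk: "reduced (del k ?w)" using reduced_del_cong[of j w k ?w] step by simp
  have "(THE i. i \<noteq> j \<and> marked \<pi> ?w i) = k"
  proof (rule the_equality)
    show "k \<noteq> j \<and> marked \<pi> ?w k" using step rk by (auto simp: marked_def Rwords_def)
    show "i = k" if "i \<noteq> j \<and> marked \<pi> ?w i" for i
      using other_mark_unique[of j ?w i k] that step by (auto simp: marked_def Rwords_def)
  qed
  then have pw: "push \<pi> (?w, j) = (inc ?w k, k)" using step.hyps(1) by (simp add: push_def inc_def Let_def)
  have "k < length ?w" "P (del k ?w) = \<pi>" using step by simp_all
  then obtain N where N: "N > 0" "(push \<pi> ^^ N) (?w, j) = (v, m)"
    "\<forall>k. 0 < k \<longrightarrow> k < N \<longrightarrow> \<not> reduced (fst ((push \<pi> ^^ k) (?w, j)))"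
    using step.IH[OF rk _ _ pw] by blast
  have shift: "(push \<pi> ^^ Suc n) s = (push \<pi> ^^ n) (?w, j)" for n
    using step.prems(4) by (simp add: funpow_swap1)
  have "\<not> reduced (fst ((push \<pi> ^^ i) s))" if "0 < i" "i < Suc N" for i
  proof (cases i)
    case (Suc n)
    then show ?thesis unfolding Suc shift using N(3) that Suc step.hyps(1) by (cases "n = 0") auto
  qed (use that in simp)
  then show ?case using N shift by (intro exI[of _ "Suc N"]) auto
qed

lemma marked_iff: "marked \<pi> w j \<longleftrightarrow> j < length w \<and> reduced (del j w) \<and> P (del j w) = \<pi>"
  by (auto simp: marked_def Rwords_def)

lemma marked_unique: "reduced w \<Longrightarrow> marked \<pi> w j \<Longrightarrow> marked \<pi> w k \<Longrightarrow> j = k"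
  using reduced_mark_unique by (auto simp: marked_iff)

lemma bump_unmarked: "(\<And>i. \<not> marked \<pi> w i) \<Longrightarrow> bump \<pi> w = w"
  by (simp add: bump_def)

lemma bump_eq_run:
  assumes "reduced w" "marked \<pi> w j" "run w j v m"
  shows "bump \<pi> w = v"
proof -
  have the: "(THE i. marked \<pi> w i) = j"
    using assms marked_unique by blast
  have "push \<pi> (w, j) = (inc w j, j)" using assms by (simp add: push_def inc_def)
  then obtain N where N: "N > 0" "(push \<pi> ^^ N) (w, j) = (v, m)"
    "\<forall>k. 0 < k \<longrightarrow> k < N \<longrightarrow> \<not> reduced (fst ((push \<pi> ^^ k) (w, j)))"
    using run_push[OF assms(3)] assms(2) unfolding marked_iff by blast
  have "reduced v" using run_invariants[OF assms(3)] assms(2) by (simp add: marked_iff)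
  have "(LEAST N. 0 < N \<and> reduced (fst ((push \<pi> ^^ N) (w, j)))) = N"
  proof (rule Least_equality)
    show "0 < N \<and> reduced (fst ((push \<pi> ^^ N) (w, j)))" using N \<open>reduced v\<close> by simp
    show "N \<le> n" if "0 < n \<and> reduced (fst ((push \<pi> ^^ n) (w, j)))" for n
      using N(3) that by (meson linorder_not_le)
  qed
  then show ?thesis using assms(2) N(2) by (auto simp: bump_def the Let_def)
qed

lemma marked_run:
  assumes "marked \<pi> w j" "reduced w"
  obtains v m where "run w j v m" "bump \<pi> w = v" "reduced v" "marked \<pi> v m" "length v = length w"
proof -
  obtain v m where r: "run w j v m" using run_total assms marked_iff by blast
  note inv = run_invariants[OF r]
  have "reduced (del m v)" using reduced_del_cong[of j w m v] inv assms by (simp add: marked_iff)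
  then show ?thesis using that[OF r bump_eq_run[OF assms(2,1) r]] inv assms by (auto simp: marked_iff)
qed

lemma bump_props: "reduced w \<Longrightarrow> reduced (bump \<pi> w) \<and> length (bump \<pi> w) = length w"
  using bump_unmarked marked_run by metis

lemma bump_marked_iff: "reduced w \<Longrightarrow> (\<exists>j. marked \<pi> (bump \<pi> w) j) \<longleftrightarrow> (\<exists>j. marked \<pi> w j)"
  using bump_unmarked marked_run by metis

text \<open>The final word is reduced, so it determines the final mark, and the reversed run from
  there is unique.\<close>

lemma bump_inj:
  assumes "reduced w" "reduced w'" "bump \<pi> w = bump \<pi> w'"
  shows "w = w'"
proof (cases "\<exists>j. marked \<pi> w j")
  case True
  then obtain j where j: "marked \<pi> w j" by blast
  obtain j' where j': "marked \<pi> w' j'" using True bump_marked_iff assms by metis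
  obtain v m where v: "run w j v m" "bump \<pi> w = v" "reduced v" "marked \<pi> v m" by (rule marked_run[OF j assms(1)])
  obtain m' where v': "run w' j' v m'" "marked \<pi> v m'"
    using marked_run[OF j' assms(2)] assms(3) v by metis
  have "m' = m" using marked_unique v v' by blast
  then have "run (neg v) m (neg w) j" "run (neg v) m (neg w') j'"
    using run_reverse v v' j j' assms by (auto simp: marked_iff)
  moreover have "reduced (del m (neg v))" "m < length (neg v)" using v by (simp_all add: marked_iff del_neg)
  ultimately have "neg w = neg w'" using run_deterministic by blast
  then show ?thesis by (metis neg_neg)
next
  case False
  then show ?thesis using assms bump_marked_iff[of w' \<pi>] bump_unmarked by metis
qed

lemma bump_surj:
  assumes "reduced v"
  obtains w where "reduced w" "bump \<pi> w = v"
proof (cases "\<exists>m. marked \<pi> v m")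
  case True
  then obtain m where m: "m < length v" "reduced (del m v)" "P (del m v) = \<pi>" by (auto simp: marked_iff)
  then obtain u j where u: "run (neg v) m u j" using run_total[of m "neg v"] by (auto simp: del_neg)
  note inv = run_invariants[OF u]
  have red: "reduced (neg u)" using inv m by simp
  have eq: "P (del j (neg u)) = P (del m v)"
    using inv m by (metis P_neg_eq_iff del_neg neg_neg length_neg)
  then have "reduced (del j (neg u))" using reduced_del_cong[of m v j "neg u"] inv m by simp
  then have "marked \<pi> (neg u) j" using eq inv m by (simp add: marked_iff)
  moreover have "run (neg u) j v m" using run_reverse[OF u] m assms by simp
  ultimately show ?thesis using that[OF red] bump_eq_run[OF red] by blast
next
  case False
  then show ?thesis using that assms bump_unmarked by blast
qed

section \<open>Locality of Little bumps\<close>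

lemma window_del: "i < length M \<Longrightarrow> del (length L + i) (L @ M @ R) = L @ del i M @ R"
  by (simp add: del_append_right del_append_left)

lemma window_inc: "i < length M \<Longrightarrow> inc (L @ M @ R) (length L + i) = L @ inc M i @ R"
  by (simp add: inc_append_right inc_append_left)

lemma P_window_eq_iff: "P (L @ M @ R) = P (L @ M' @ R) \<longleftrightarrow> P M = P M'"
  by (simp add: P_cancel_left P_cancel_right)

text \<open>While the window is unreduced so is the whole word, and the other mark within the window
  is a mark of the whole word; hence every step of the window run is also a step of the whole
  run.\<close>

lemma run_window_stop:
  assumes "run M i N k" "i < length M" "reduced (L @ N @ R)"
  shows "run (L @ M @ R) (length L + i) (L @ N @ R) (length L + k)"
  using assms
proof (induction rule: run.induct)
  case (stop M i)
  then show ?case by (intro run_stop) (simp_all add: window_inc)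
next
  case (step M i l N k)
  have "\<not> reduced (L @ inc M i @ R)" using step reduced_windowD by blast
  moreover have "P (del (length L + l) (L @ inc M i @ R)) = P (del (length L + i) (L @ M @ R))"
    using step by (simp add: window_del)
  ultimately show ?case
    using step run.step[of "L @ M @ R" "length L + i" "length L + l"] by (simp add: window_inc)
qed

text \<open>The complement of \<open>run_window_stop\<close>: the window run is over but the whole
  word is still unreduced, so the run goes on from \<open>j\<close>, the other mark of the whole
  word.\<close>

lemma run_window_step:
  assumes "run M i N k" "i < length M" "\<not> reduced (L @ N @ R)"
    and "j \<noteq> length L + k" "j < length (L @ N @ R)" "P (del j (L @ N @ R)) = P (del (length L + k) (L @ N @ R))"
    and "run (L @ N @ R) j v m"
  shows "run (L @ M @ R) (length L + i) v m"
  using assms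
proof (induction rule: run.induct)
  case (stop M i)
  then show ?case
    using run.step[of "L @ M @ R" "length L + i" j] by (simp add: window_inc window_del del: P_append)
next
  case (step M i l N k)
  have "\<not> reduced (L @ inc M i @ R)" using step reduced_windowD by blast
  moreover have "P (del (length L + l) (L @ inc M i @ R)) = P (del (length L + i) (L @ M @ R))"
    using step by (simp add: window_del)
  ultimately show ?case
    using step run.step[of "L @ M @ R" "length L + i" "length L + l"] by (simp add: window_inc)
qed

text \<open>Marks are paired through the permutations of the deletions and not by position, and the
  two runs need not have equal length. The final marks are paired again automatically, since runs
  preserve the permutation of the deletion.\<close>

definition bump_closed :: "(int list \<Rightarrow> int list \<Rightarrow> bool) \<Rightarrow> bool" where
  "bump_closed E \<longleftrightarrow>
    (\<forall>M M'. E M M' \<longrightarrow> reduced M \<and> reduced M' \<and> length M = length M' \<and> P M = P M') \<and>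
    (\<forall>M M' i i'. E M M' \<longrightarrow> i < length M \<longrightarrow> i' < length M' \<longrightarrow> reduced (del i M)
       \<longrightarrow> P (del i M) = P (del i' M')
       \<longrightarrow> (\<exists>N k N' k'. run M i N k \<and> run M' i' N' k' \<and> E N N'))"

lemma bump_closedD1:
  "bump_closed E \<Longrightarrow> E M M' \<Longrightarrow> reduced M \<and> reduced M' \<and> length M = length M' \<and> P M = P M'"
  by (simp add: bump_closed_def)

lemma bump_closedD2:
  assumes "bump_closed E" "E M M'" "i < length M" "i' < length M'" "reduced (del i M)"
    "P (del i M) = P (del i' M')"
  obtains N k N' k' where "run M i N k" "run M' i' N' k'" "E N N'"
  using assms unfolding bump_closed_def by blast

text \<open>Two marks in words \<open>L @ M @ R\<close> and \<open>L @ M' @ R\<close> that differ in a window and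
  represent the same reflection.\<close>

definition matching :: "int list \<Rightarrow> int list \<Rightarrow> int list \<Rightarrow> int list \<Rightarrow> nat \<Rightarrow> nat \<Rightarrow> bool" where
  "matching L M M' R j j' \<longleftrightarrow>
     j = j' \<and> (j < length L \<or> length L + length M \<le> j \<and> j < length L + length M + length R) \<or>
     (\<exists>i i'. j = length L + i \<and> j' = length L + i' \<and> i < length M \<and> i' < length M' \<and> P (del i M) = P (del i' M'))"

lemma del_outside:
  assumes "P M = P M'" "length M = length M'" "j < length (L @ M @ R)"
    "j < length L \<or> length L + length M \<le> j"
  shows "P (del j (L @ M @ R)) = P (del j (L @ M' @ R))"
proof (cases "j < length L")
  case True
  then show ?thesis using assms by (simp add: del_append_left)
next
  case False
  then obtain i where i: "j = length L + (length M + i)" using assms by (metis le_Suc_ex add.assoc)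
  show ?thesis unfolding i by (subst (2) assms(2)) (simp only: del_append_right P_append assms(1))
qed

lemma inside_cases:
  assumes "j < length (L @ M @ R)" "\<not> (j < length L \<or> length L + length M \<le> j)"
  obtains i where "j = length L + i" "i < length M"
  using assms by (metis le_Suc_ex linorder_not_le nat_add_left_cancel_less)

text \<open>An index outside the window that is the other mark of one word is also the other mark of
  the second word. By uniqueness, either both other marks are outside and equal, or both are inside;
  in the latter case the contexts cancel.\<close>

lemma matching_other:
  assumes M: "P M = P M'" "length M = length M'"
    and j: "matching L M M' R j j'" "j < length (L @ M @ R)" "reduced (del j (L @ M @ R))"
    and k: "k < length (L @ M @ R)" "k \<noteq> j" "P (del k (L @ M @ R)) = P (del j (L @ M @ R))"
    and k': "k' < length (L @ M' @ R)" "k' \<noteq> j'" "P (del k' (L @ M' @ R)) = P (del j' (L @ M' @ R))"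
  shows "matching L M M' R k k'"
proof -
  let ?w = "L @ M @ R" and ?w' = "L @ M' @ R"
  have jj': "P (del j ?w) = P (del j' ?w')" "j' < length ?w'"
    using j(1,2) del_outside[OF M j(2)] M unfolding matching_def by (auto simp: window_del)
  have rj': "reduced (del j' ?w')"
    using reduced_del_cong[of j ?w j' ?w'] jj' j M by simp
  define out where "out = (\<lambda>n. n < length L \<or> length L + length M \<le> n)"
  have jout: "j = j'" if "out j \<or> out j'"
    using j(1) that M unfolding matching_def out_def by auto
  show ?thesis
  proof (cases "out k")
    case True
    have "P (del k ?w') = P (del j' ?w')" using del_outside[OF M k(1)] True k(3) jj' unfolding out_def by metis
    moreover have "k \<noteq> j'" using True jout k(2) by auto
    ultimately have "k = k'" using other_mark_unique[OF rj' jj'(2), of k k'] k k' M by simp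
    then show ?thesis using True k M unfolding matching_def out_def by auto
  next
    case False
    have "\<not> out k'"
    proof
      assume o: "out k'"
      have "P (del k' ?w) = P (del j ?w)"
        using del_outside[OF M, of k' L R] o k' M jj' unfolding out_def by auto
      moreover have "k' \<noteq> j" using o jout k'(2) by auto
      ultimately have "k' = k" using other_mark_unique[OF j(3,2), of k' k] k k' M by simp
      then show False using o False by simp
    qed
    then obtain i i' where i: "k = length L + i" "i < length M" "k' = length L + i'" "i' < length M'"
      using inside_cases[of k L M R] inside_cases[of k' L M' R] False k(1) k'(1) M unfolding out_def by metis
    have "P (L @ del i M @ R) = P (L @ del i' M' @ R)"
      using k(3) k'(3) jj' i by (simp add: window_del)
    then have "P (del i M) = P (del i' M')" unfolding P_window_eq_iff .
    then show ?thesis using i unfolding matching_def by auto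
  qed
qed

text \<open>After cancelling the context, two marks for the same permutation inside a reduced window
  would contradict \<open>reduced_mark_unique\<close>.\<close>

lemma other_outside_reduced_window:
  assumes "reduced N" "i < length N" "k < length (L @ N @ R)" "k \<noteq> length L + i"
    "P (del k (L @ N @ R)) = P (del (length L + i) (L @ N @ R))"
  shows "k < length L \<or> length L + length N \<le> k"
proof (rule ccontr)
  assume "\<not> ?thesis"
  then obtain l where l: "k = length L + l" "l < length N" using inside_cases assms by blast
  then have "P (L @ del l N @ R) = P (L @ del i N @ R)" using assms by (simp add: window_del)
  then have "P (del l N) = P (del i N)" unfolding P_window_eq_iff .
  then show False using reduced_mark_unique[OF assms(1) l(2) assms(2)] l assms by simp
qed

text \<open>The induction is on the increase of the letter sum still to come and not on the run,
  because a whole passage through the window, consisting of an unknown number of increments, is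
  replaced at once.\<close>

lemma run_related_windows:
  assumes E: "bump_closed E"
  shows "run (L @ M @ R) j v m \<Longrightarrow> E M M' \<Longrightarrow> j < length (L @ M @ R) \<Longrightarrow> reduced (del j (L @ M @ R))
    \<Longrightarrow> matching L M M' R j j'
    \<Longrightarrow> \<exists>L1 N N' R1 m'. v = L1 @ N @ R1 \<and> run (L @ M' @ R) j' (L1 @ N' @ R1) m' \<and> E N N' \<and>
        length L1 = length L \<and> length N = length M"
proof (induction "nat (sum_list v - sum_list (L @ M @ R))" arbitrary: L M M' R j j' rule: less_induct)
  case less
  let ?w = "L @ M @ R" and ?w' = "L @ M' @ R"
  note M = bump_closedD1[OF E less.prems(2)]
  have M1: "P M = P M'" and M2: "length M = length M'" using M by auto
  show ?case
  proof (cases "j < length L \<or> length L + length M \<le> j")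
    case out: True
    then have j': "j' = j" using less.prems(5) by (auto simp: matching_def)
    obtain L1 R1 where inc: "inc ?w j = L1 @ M @ R1" "inc ?w' j = L1 @ M' @ R1"
      and len: "length L1 = length L" "length R1 = length R"
    proof (cases "j < length L")
      case True
      then show ?thesis using that[of "inc L j" R] by (simp add: inc_append_left)
    next
      case False
      then obtain i where i: "j = length L + (length M + i)" using out by (metis le_Suc_ex add.assoc)
      have "inc ?w j = L @ M @ inc R i" unfolding i by (simp only: inc_append_right)
      moreover have "inc ?w' j = L @ M' @ inc R i" unfolding i M2 by (simp only: inc_append_right)
      ultimately show ?thesis using that by simp
    qed
    have red: "reduced (L1 @ M @ R1) \<longleftrightarrow> reduced (L1 @ M' @ R1)"
      using reduced_window_cong M1 M2 by blast
    from less.prems(1) show ?thesis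
    proof cases
      case stop
      then have "run ?w' j' (L1 @ M' @ R1) j" unfolding j' using red inc by (intro run_stop) auto
      then show ?thesis using stop inc less.prems(2) len by blast
    next
      \<comment> \<open>The increment takes place in the common context; the other marks of both
        words match again by \<open>matching_other\<close>.\<close>
      case (step k)
      have jlt: "j < length ?w'" using less.prems(3) M2 by simp
      have Pj: "P (del j ?w') = P (del j ?w)"
        using del_outside[OF M1 M2 less.prems(3) out] by simp
      have rj: "reduced (del j ?w')" using reduced_del_cong[OF less.prems(4) Pj jlt less.prems(3)] M2 by simp
      have nr1: "reduced (del j (inc ?w' j))" "j < length (inc ?w' j)" using rj jlt by simp_all
      have nr2: "\<not> reduced (inc ?w' j)" using step(1) red by (simp only: inc simp_thms)
      obtain k' where k': "k' < length (L1 @ M' @ R1)" "k' \<noteq> j" "P (del k' (L1 @ M' @ R1)) = P (del j (L1 @ M' @ R1))"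
        by (rule other_mark[OF nr1 nr2, unfolded inc(2)])
      have dj: "del j (L1 @ M @ R1) = del j ?w" "del j (L1 @ M' @ R1) = del j ?w'" using inc del_inc by metis+
      have jl: "j < length (L1 @ M @ R1)" using less.prems(3) len by simp
      have mj: "matching L1 M M' R1 j j" using out less.prems(3) len by (auto simp: matching_def)
      have kl: "k < length (L1 @ M @ R1)" using step(3) len by simp
      have Pk: "P (del k (L1 @ M @ R1)) = P (del j (L1 @ M @ R1))" using step inc dj by simp
      have mat: "matching L1 M M' R1 k k'"
        by (rule matching_other[OF M1 M2 mj jl _ kl step(2) Pk k']) (use dj less.prems in simp)
      have rk: "reduced (del k (L1 @ M @ R1))"
        using reduced_del_cong[of j ?w k "L1 @ M @ R1"] less.prems Pk dj kl len by simp
      have r: "run (L1 @ M @ R1) k v m" using step inc by simp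
      have "sum_list (L1 @ M @ R1) = sum_list ?w + 1" using sum_list_inc[OF less.prems(3)] inc by simp
      moreover have "sum_list (L1 @ M @ R1) < sum_list v" using run_invariants[OF r kl] by simp
      ultimately have dec: "nat (sum_list v - sum_list (L1 @ M @ R1)) < nat (sum_list v - sum_list ?w)"
        by linarith
      obtain L2 N N' R2 m' where IH: "v = L2 @ N @ R2" "run (L1 @ M' @ R1) k' (L2 @ N' @ R2) m'" "E N N'"
        "length L2 = length L1" "length N = length M"
        using less.hyps[OF dec r less.prems(2) kl rk mat] by blast
      have "run ?w' j (L2 @ N' @ R2) m'"
      proof (rule run.step)
        show "\<not> reduced (inc ?w' j)" using step(1) red inc by simp
        show "k' < length ?w'" using k' len by simp
        show "P (del k' (inc ?w' j)) = P (del j ?w')" using k' inc dj by simp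
        show "run (inc ?w' j) k' (L2 @ N' @ R2) m'" using IH inc by simp
      qed (use k' in simp)
      then show ?thesis using IH len j' by metis
    qed
  next
    case False
    then obtain i i' where i: "j = length L + i" "j' = length L + i'" "i < length M" "i' < length M'"
      "P (del i M) = P (del i' M')" using less.prems(5) by (auto simp: matching_def)
    have "reduced (del i M)" using less.prems(4) reduced_windowD i by (simp add: window_del)
    then obtain N k N' k' where N: "run M i N k" "run M' i' N' k'" "E N N'"
      by (rule bump_closedD2[OF E less.prems(2) i(3,4) _ i(5)])
    note inv = run_invariants[OF N(1) i(3)] and inv' = run_invariants[OF N(2) i(4)]
    have NN: "P N = P N'" "length N = length N'" using bump_closedD1[OF E N(3)] by auto
    have red: "reduced (L @ N @ R) \<longleftrightarrow> reduced (L @ N' @ R)" using reduced_window_cong NN by blast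
    show ?thesis
    proof (cases "reduced (L @ N @ R)")
      case True
      have "v = L @ N @ R"
        using run_deterministic[OF less.prems(1) run_window_stop[OF N(1) i(3) True, folded i(1)]] less.prems by simp
      moreover have "run ?w' j' (L @ N' @ R) (length L + k')"
        using run_window_stop[OF N(2) i(4)] red True i(2) by simp
      ultimately show ?thesis using N(3) inv by blast
    next
      case nred: False
      let ?k = "length L + k" and ?k' = "length L + k'"
      have kl: "?k < length (L @ N @ R)" "?k' < length (L @ N' @ R)" using inv inv' by auto
      have Pk: "P (del ?k (L @ N @ R)) = P (del j ?w)"
        using inv i by (simp add: window_del)
      have rk: "reduced (del ?k (L @ N @ R))"
        using reduced_del_cong[OF less.prems(4) Pk kl(1) less.prems(3)] inv by simp
      obtain l where l: "l < length (L @ N @ R)" "l \<noteq> ?k" "P (del l (L @ N @ R)) = P (del ?k (L @ N @ R))"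
        using other_mark[OF rk kl(1) nred] by blast
      have lout: "l < length L \<or> length L + length N \<le> l"
        using other_outside_reduced_window[of N k l L R] inv l by simp
      have rl: "reduced (del l (L @ N @ R))"
        using reduced_del_cong[OF rk l(3) l(1) kl(1)] by simp
      \<comment> \<open>The run that enters the context at \<open>l\<close> exists by totality;
        preceded by the passage through the window it must be the given run, by determinism.\<close>
      obtain v0 m0 where r0: "run (L @ N @ R) l v0 m0" using run_total[OF rl l(1)] by blast
      have "run ?w j v0 m0"
        using run_window_step[OF N(1) i(3) nred l(2) l(1) l(3) r0] i(1) by simp
      then have "v0 = v" "m0 = m" using run_deterministic[OF less.prems(1) _ less.prems(4,3)] by auto
      then have r: "run (L @ N @ R) l v m" using r0 by simp
      have mat: "matching L N N' R l l" using lout l by (auto simp: matching_def)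
      have "sum_list (L @ N @ R) < sum_list v" using run_invariants[OF r l(1)] by simp
      then have dec: "nat (sum_list v - sum_list (L @ N @ R)) < nat (sum_list v - sum_list ?w)"
        using inv by simp
      obtain L2 N2 N2' R2 m' where IH: "v = L2 @ N2 @ R2" "run (L @ N' @ R) l (L2 @ N2' @ R2) m'" "E N2 N2'"
        "length L2 = length L" "length N2 = length N"
        using less.hyps[OF dec r N(3) l(1) rl mat] by blast
      have "run ?w' j' (L2 @ N2' @ R2) m'" unfolding i(2)
      proof (rule run_window_step[OF N(2) i(4) _ _ _ _ IH(2)])
        show "\<not> reduced (L @ N' @ R)" using red nred by simp
        show "l \<noteq> length L + k'" using lout inv' NN by auto
        show "l < length (L @ N' @ R)" using l NN by simp
        have "P (del l (L @ N' @ R)) = P (del l (L @ N @ R))"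
          using del_outside[OF NN l(1) lout] by simp
        also have "\<dots> = P (del ?k (L @ N @ R))" by (rule l)
        also have "\<dots> = P (del ?k' (L @ N' @ R))" using inv inv' i by (simp add: window_del)
        finally show "P (del l (L @ N' @ R)) = P (del ?k' (L @ N' @ R))" .
      qed
      then show ?thesis using IH inv by metis
    qed
  qed
qed

text \<open>In a reduced word, deleting a letter removes an inversion \<open>(p, q)\<close> of the
  permutation. Since \<open>M'\<close> has the same permutation, it has the same inversion, and the
  exchange property provides the corresponding letter.\<close>

lemma matching_exists:
  assumes "reduced M" and M: "P M = P M'" "length M = length M'" and j: "j < length (L @ M @ R)"
  obtains j' where "matching L M M' R j j'" "j' < length (L @ M' @ R)" "P (del j' (L @ M' @ R)) = P (del j (L @ M @ R))"
proof (cases "j < length L \<or> length L + length M \<le> j")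
  case True
  then show ?thesis using that[of j] M j del_outside[OF M j True] by (auto simp: matching_def)
next
  case False
  then obtain i where i: "j = length L + i" "i < length M" using inside_cases j by blast
  obtain U x V where UV: "M = U @ x # V" "length U = i" using i split_at_obtain by blast
  obtain p q where "p < q" and "\<And>L. P (L @ x # V) = P (L @ V) \<circ> transpose p q"
    using ordered_wires_obtain[of x V] by metis
  then have PM: "P M = P (U @ V) \<circ> transpose p q" using UV by simp
  then have PUV: "P (U @ V) = P M \<circ> transpose p q" by (simp add: comp_assoc)
  have "\<not> P M p < P M q"
  proof
    assume "P M p < P M q"
    then have "P (U @ V) q < P (U @ V) p" using PUV by simp
    from strong_exchange[OF \<open>p < q\<close> this] obtain k where "k < length (U @ V)" "P (del k (U @ V)) = P M"
      using PM by auto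
    moreover from this have "length M \<le> length (del k (U @ V))" using assms(1) unfolding reduced_def by blast
    ultimately show False using UV by (simp add: length_del)
  qed
  moreover have "P M p \<noteq> P M q" using \<open>p < q\<close> by (simp add: P_inj)
  ultimately have "P M' q < P M' p" using M(1) by simp
  from strong_exchange[OF \<open>p < q\<close> this] obtain i' where i': "i' < length M'" "P (del i' M') = P (U @ V)"
    using PUV M(1) by auto
  have "del i M = U @ V" using UV by auto
  then have eq: "P (del i M) = P (del i' M')" using i' by simp
  then have "matching L M M' R j (length L + i')" using i i' by (auto simp: matching_def)
  moreover have "P (del (length L + i') (L @ M' @ R)) = P (del j (L @ M @ R))"
    using eq i i' by (simp add: window_del)
  ultimately show ?thesis using that[of "length L + i'"] i' by simp
qed

text \<open>This transfers a closed relation into an arbitrary context. Both words are marked or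
  both are unmarked, since \<open>matching_exists\<close> applies in either direction; in the
  unmarked case \<open>bump\<close> leaves them alone.\<close>

lemma bump_related_windows:
  assumes E: "bump_closed E" "E M M'" and red: "reduced (L @ M @ R)"
  obtains L1 N N' R1 where "bump \<pi> (L @ M @ R) = L1 @ N @ R1" "bump \<pi> (L @ M' @ R) = L1 @ N' @ R1" "E N N'"
    "length L1 = length L" "length N = length M"
proof -
  note M = bump_closedD1[OF E]
  have red': "reduced (L @ M' @ R)" using red reduced_window_cong M by blast
  have mk: "\<exists>j'. marked \<pi> (L @ M2 @ R) j' \<and> matching L M1 M2 R j j'"
    if hyp: "marked \<pi> (L @ M1 @ R) j" "reduced M1" "P M1 = P M2" "length M1 = length M2" for M1 M2 j
  proof -
    obtain j' where j': "matching L M1 M2 R j j'" "j' < length (L @ M2 @ R)"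
      "P (del j' (L @ M2 @ R)) = P (del j (L @ M1 @ R))"
      by (rule matching_exists[of M1 M2 j L R]) (use hyp in \<open>auto simp: marked_iff\<close>)
    then show ?thesis using hyp reduced_del_cong[OF _ j'(3,2)] by (auto simp: marked_iff)
  qed
  show ?thesis
  proof (cases "\<exists>j. marked \<pi> (L @ M @ R) j")
    case True
    then obtain j where j: "marked \<pi> (L @ M @ R) j" by blast
    then obtain j' where j': "marked \<pi> (L @ M' @ R) j'" "matching L M M' R j j'" using mk M red by blast
    obtain v m where v: "run (L @ M @ R) j v m" "bump \<pi> (L @ M @ R) = v" by (rule marked_run[OF j red])
    obtain L1 N N' R1 m' where *: "v = L1 @ N @ R1" "run (L @ M' @ R) j' (L1 @ N' @ R1) m'" "E N N'"
      "length L1 = length L" "length N = length M"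
      using run_related_windows[OF E(1) v(1) E(2)] j j' unfolding marked_iff by blast
    then show ?thesis using that v bump_eq_run[OF red' j'(1) *(2)] by blast
  next
    case False
    then have "\<nexists>j. marked \<pi> (L @ M' @ R) j" using mk[of M' _ M] M red' by metis
    then show ?thesis using that[of L M R M'] False E(2) bump_unmarked by metis
  qed
qed

section \<open>Concatenations of two increasing words\<close>

lemma interval_extend:
  fixes c t :: int
  shows "{c + 1..<t} \<subseteq> B \<Longrightarrow> {c..<t} \<subseteq> insert c B" "{c..<t} \<subseteq> B \<Longrightarrow> {c..t} \<subseteq> insert t B"
proof -
  show "{c..<t} \<subseteq> insert c B" if "{c + 1..<t} \<subseteq> B"
  proof
    fix u assume "u \<in> {c..<t}"
    then have "u = c \<or> u \<in> {c + 1..<t}" by auto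
    then show "u \<in> insert c B" using that by blast
  qed
  show "{c..t} \<subseteq> insert t B" if "{c..<t} \<subseteq> B"
  proof
    fix u assume "u \<in> {c..t}"
    then have "u = t \<or> u \<in> {c..<t}" by auto
    then show "u \<in> insert t B" using that by blast
  qed
qed

text \<open>The largest letter acts first. A letter \<open>x\<close> is moved only by its own
  transposition, one step up; any other \<open>x\<close> is carried down through the run of letters
  ending at \<open>x - 1\<close> to the start of this run.\<close>

lemma P_increasing:
  assumes "sorted_wrt (<) a"
  shows "x \<in> set a \<Longrightarrow> P a x = x + 1"
    and "x \<notin> set a \<Longrightarrow> P a x \<le> x \<and> {P a x..<x} \<subseteq> set a \<and> P a x - 1 \<notin> set a"
proof -
  have "(x \<in> set a \<longrightarrow> P a x = x + 1) \<and> (x \<notin> set a \<longrightarrow> P a x \<le> x \<and> {P a x..<x} \<subseteq> set a \<and> P a x - 1 \<notin> set a)"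
    using assms
  proof (induction a arbitrary: x)
    case (Cons i a)
    then have gt: "\<And>y. y \<in> set a \<Longrightarrow> i < y" by auto
    consider "x \<in> set a" | "x = i" | "x \<notin> set (i # a)" by auto
    then show ?case
    proof cases
      case 1
      then have "P a x = x + 1" using Cons by simp
      then show ?thesis using 1 gt[OF 1] by (auto simp: sT_def)
    next
      case 2
      have "i \<notin> set a" using gt by auto
      then have *: "P a i \<le> i" "{P a i..<i} \<subseteq> set a" using Cons by auto
      have "P a i = i"
      proof (rule ccontr)
        assume "P a i \<noteq> i"
        then have "P a i \<in> set a" using * by auto
        then show False using gt * by force
      qed
      then show ?thesis using 2 by (auto simp: sT_def)
    next
      case 3
      define y where "y = P a x"
      have y: "y \<le> x" "{y..<x} \<subseteq> set a" "y - 1 \<notin> set a" using Cons 3 by (auto simp: y_def)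
      have "i \<notin> set a" using gt by auto
      have "y \<noteq> i"
      proof
        assume "y = i"
        then have "i \<in> {y..<x}" using y 3 by auto
        then show False using y \<open>i \<notin> set a\<close> by blast
      qed
      have "{i..<x} \<subseteq> set (i # a)" if "y = i + 1" using y(2) that interval_extend(1) by simp
      moreover have "i - 1 \<notin> set a" using gt by force
      ultimately have "sT i y \<le> x \<and> {sT i y..<x} \<subseteq> set (i # a) \<and> sT i y - 1 \<notin> set (i # a)"
        using y \<open>y \<noteq> i\<close> by (auto simp: sT_def)
      then show ?thesis using 3 by (simp add: y_def)
    qed
  qed simp
  then show "x \<in> set a \<Longrightarrow> P a x = x + 1"
    and "x \<notin> set a \<Longrightarrow> P a x \<le> x \<and> {P a x..<x} \<subseteq> set a \<and> P a x - 1 \<notin> set a" by auto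
qed

lemma run_start_unique:
  assumes "{s..<x} \<subseteq> A" "s - 1 \<notin> A" "s \<le> x" "{s'..<x} \<subseteq> A" "s' - 1 \<notin> A" "s' \<le> (x::int)"
  shows "s = s'"
proof (rule ccontr)
  assume "s \<noteq> s'"
  then have "s' - 1 \<in> {s..<x} \<or> s - 1 \<in> {s'..<x}" using assms by auto
  then show False using assms by blast
qed

lemma P_increasing_eqI:
  assumes "sorted_wrt (<) a" "x \<in> set a \<Longrightarrow> s = x + 1"
    "x \<notin> set a \<Longrightarrow> s \<le> x \<and> {s..<x} \<subseteq> set a \<and> s - 1 \<notin> set a"
  shows "P a x = s"
  using P_increasing[OF assms(1), of x] assms(2,3) run_start_unique[of "P a x" x "set a" s] by blast

text \<open>For increasing words with letter sets \<open>A\<close> and \<open>B\<close>, their concatenation is reduced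
  unless some interval common to both sets can be extended neither to the left in \<open>B\<close> nor to the
  right in \<open>A\<close>.\<close>

definition supported :: "int set \<Rightarrow> int set \<Rightarrow> bool" where
  "supported A B \<longleftrightarrow> (\<forall>c t. c \<le> t \<longrightarrow> {c..t} \<subseteq> A \<longrightarrow> {c..t} \<subseteq> B \<longrightarrow> c - 1 \<in> B \<or> t + 1 \<in> A)"

lemma supportedD: "supported A B \<Longrightarrow> c \<le> t \<Longrightarrow> {c..t} \<subseteq> A \<Longrightarrow> {c..t} \<subseteq> B \<Longrightarrow> c - 1 \<in> B \<or> t + 1 \<in> A"
  by (simp add: supported_def)

lemma supportedE:
  assumes "\<not> supported A B"
  obtains c t where "c \<le> t" "{c..t} \<subseteq> A" "{c..t} \<subseteq> B" "c - 1 \<notin> B" "t + 1 \<notin> A"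
  using assms unfolding supported_def by blast

text \<open>The pair is inverted only when \<open>t + 1\<close> is carried down past
  \<open>c\<close>, which moves up to \<open>c + 1\<close>; this requires a run of letters from
  \<open>c\<close> to \<open>t\<close>.\<close>

lemma P_increasing_less_iff:
  assumes "sorted_wrt (<) a" "c \<le> t"
  shows "P a c < P a (t + 1) \<longleftrightarrow> \<not> ({c..t} \<subseteq> set a \<and> t + 1 \<notin> set a)"
proof (cases "t + 1 \<in> set a")
  case True
  then have "P a (t + 1) = t + 2" using P_increasing(1)[OF assms(1)] by simp
  moreover have "P a c \<le> c + 1" using P_increasing[OF assms(1), of c] by (cases "c \<in> set a") auto
  ultimately show ?thesis using True assms(2) by auto
next
  case False
  define s where "s = P a (t + 1)"
  have s: "s \<le> t + 1" "{s..t} \<subseteq> set a" "s - 1 \<notin> set a"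
    using P_increasing(2)[OF assms(1) False] by (auto simp: s_def)
  show ?thesis
  proof (cases "c \<in> set a")
    case True
    have "P a c = c + 1" using P_increasing(1)[OF assms(1) True] .
    moreover have "s \<noteq> c + 1" using s True by auto
    moreover have "s \<le> c \<longleftrightarrow> {c..t} \<subseteq> set a"
    proof
      show "s \<le> c \<Longrightarrow> {c..t} \<subseteq> set a" using s by auto
      show "s \<le> c" if "{c..t} \<subseteq> set a"
      proof (rule ccontr)
        assume "\<not> s \<le> c"
        then have "s - 1 \<in> {c..t}" using s by auto
        then show False using that s by blast
      qed
    qed
    ultimately show ?thesis using False by (auto simp: s_def[symmetric])
  next
    case c: False
    have "P a c \<le> c" using P_increasing(2)[OF assms(1) c] by simp
    moreover have "c < s"
    proof (rule ccontr)
      assume "\<not> c < s"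
      then have "c \<in> {s..t}" using assms by auto
      then show False using s c by blast
    qed
    moreover have "\<not> {c..t} \<subseteq> set a" using c assms(2) by auto
    ultimately show ?thesis by (auto simp: s_def[symmetric])
  qed
qed

text \<open>Only intervals ending at \<open>t\<close> are new, and among them only the one starting
  at \<open>c\<close> cannot be extended to the left in the second set.\<close>

lemma supported_insert_max:
  assumes "\<And>b. b \<in> B \<Longrightarrow> b < t" "c \<le> t" "{c..<t} \<subseteq> B" "c - 1 \<notin> B"
  shows "supported A (insert t B) \<longleftrightarrow> supported A B \<and> \<not> ({c..t} \<subseteq> A \<and> t + 1 \<notin> A)"
proof
  assume s: "supported A (insert t B)"
  have "supported A B" unfolding supported_def
  proof (intro allI impI)
    fix c' t' assume *: "c' \<le> t'" "{c'..t'} \<subseteq> A" "{c'..t'} \<subseteq> B"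
    have "t' \<in> B" using * by auto
    then have "t' < t" using assms by blast
    have "c' - 1 \<in> insert t B \<or> t' + 1 \<in> A" using supportedD[OF s *(1,2)] * by blast
    then show "c' - 1 \<in> B \<or> t' + 1 \<in> A" using * \<open>t' < t\<close> by auto
  qed
  moreover have "{c..t} \<subseteq> insert t B" using assms interval_extend(2) by blast
  then have "\<not> ({c..t} \<subseteq> A \<and> t + 1 \<notin> A)" using supportedD[OF s assms(2)] assms by auto
  ultimately show "supported A B \<and> \<not> ({c..t} \<subseteq> A \<and> t + 1 \<notin> A)" by simp
next
  assume s: "supported A B \<and> \<not> ({c..t} \<subseteq> A \<and> t + 1 \<notin> A)"
  show "supported A (insert t B)" unfolding supported_def
  proof (intro allI impI, rule ccontr)
    fix c' t' assume *: "c' \<le> t'" "{c'..t'} \<subseteq> A" "{c'..t'} \<subseteq> insert t B" "\<not> (c' - 1 \<in> insert t B \<or> t' + 1 \<in> A)"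
    show False
    proof (cases "t' = t")
      case True
      have "{c'..<t} \<subseteq> B" using *(3) True by (force simp: subset_iff)
      then have "c' = c" using run_start_unique[of c' t B c] * True assms by auto
      then show False using * True s by auto
    next
      case False
      have "t' \<in> insert t B" using * by auto
      then have "t' < t" using False assms by auto
      then have "{c'..t'} \<subseteq> B" using *(3) by auto
      then show False using * s supportedD by blast
    qed
  qed
qed

text \<open>The second word grows by its largest letter \<open>t\<close>. The preceding letters
  carry \<open>t\<close> to the start \<open>c\<close> of the run below \<open>t\<close> and fix
  \<open>t + 1\<close>, so appending \<open>t\<close> keeps the word reduced unless the first word
  inverts \<open>c\<close> and \<open>t + 1\<close>. These conditions accumulate to
  \<open>supported\<close>.\<close>

lemma reduced_increasing_append:
  assumes "sorted_wrt (<) a" "sorted_wrt (<) b"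
  shows "reduced (a @ b) \<longleftrightarrow> reduced a \<and> supported (set a) (set b)"
  using assms(2)
proof (induction b rule: rev_induct)
  case Nil
  then show ?case by (auto simp: supported_def)
next
  case (snoc t b)
  have b: "sorted_wrt (<) b" "\<And>y. y \<in> set b \<Longrightarrow> y < t" using snoc.prems by (auto simp: sorted_wrt_append)
  have tb: "t \<notin> set b" "t + 1 \<notin> set b" using b by force+
  define c where "c = P b t"
  have c: "c \<le> t" "{c..<t} \<subseteq> set b" "c - 1 \<notin> set b" using P_increasing(2)[OF b(1) tb(1)] by (auto simp: c_def)
  have "P b (t + 1) = t + 1" by (rule P_increasing_eqI[OF b(1)]) (use tb in auto)
  then have "reduced (a @ b @ [t]) \<longleftrightarrow> reduced (a @ b) \<and> P a c < P a (t + 1)"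
    using reduced_snoc[of "a @ b" t] by (simp add: c_def)
  also have "\<dots> \<longleftrightarrow> reduced a \<and> supported (set a) (set (b @ [t]))"
    using snoc.IH[OF b(1)] P_increasing_less_iff[OF assms(1) c(1)]
      supported_insert_max[of "set b" t c "set a"] b c by auto
  finally show ?case .
qed

lemma reduced_increasing: "sorted_wrt (<) b \<Longrightarrow> reduced b"
  using reduced_increasing_append[of "[]" b] by (auto simp: supported_def)

declare sorted_list_of_set.sorted_key_list_of_set_insert_remove [simp del]
  sorted_list_of_set.sorted_key_list_of_set_insert [simp del]

section \<open>Adjacent factors as pairs of letter sets\<close>

abbreviation sl :: "int set \<Rightarrow> int list" where "sl \<equiv> sorted_list_of_set"

text \<open>An increasing word is determined by its letters, so two adjacent factors are encoded by
  two finite sets, and bumps become operations on sets. The lengths of the factors survive as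
  cardinalities.\<close>

definition cw :: "int set \<Rightarrow> int set \<Rightarrow> int list" where
  "cw A B = sl A @ sl B"

lemma sorted_sl [simp]: "sorted_wrt (<) (sl A)"
  by simp

lemma sl_set: "sorted_wrt (<) a \<Longrightarrow> sl (set a) = a"
  by (simp add: strict_sorted_equal)

lemma length_cw: "length (cw A B) = card A + card B"
  by (simp add: cw_def)

lemma reduced_cw: "finite A \<Longrightarrow> finite B \<Longrightarrow> reduced (cw A B) \<longleftrightarrow> supported A B"
  unfolding cw_def by (subst reduced_increasing_append) (auto simp: reduced_increasing)

text \<open>Without \<open>x\<close>, the position \<open>y + 1\<close> is carried down to
  \<open>x + 1\<close>; with \<open>x\<close>, it goes on to the start of the run below
  \<open>x\<close>, while \<open>x\<close> now moves up to \<open>x + 1\<close>. So the images of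
  \<open>x\<close> and \<open>y + 1\<close> are interchanged.\<close>

lemma P_sl_insert_left:
  assumes "finite A" "x \<notin> A" "{x<..y} \<subseteq> A" "y + 1 \<notin> A" "x \<le> y"
  shows "P (sl (insert x A)) = P (sl A) \<circ> transpose x (y + 1)"
proof
  fix z
  note PA = P_increasing[OF sorted_sl[of A]]
  have "P (sl (insert x A)) z = P (sl A) (transpose x (y + 1) z)"
  proof (rule P_increasing_eqI[OF sorted_sl])
    have y1: "P (sl A) (y + 1) = x + 1"
      by (rule P_increasing_eqI[OF sorted_sl]) (use assms in auto)
    assume "z \<in> set (sl (insert x A))"
    then have "z = x \<or> z \<in> A \<and> z \<noteq> x \<and> z \<noteq> y + 1" using assms by auto
    then show "P (sl A) (transpose x (y + 1) z) = z + 1" using y1 PA(1)[of z] assms(1) by auto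
  next
    assume "z \<notin> set (sl (insert x A))"
    then have z: "z \<noteq> x" "z \<notin> A" using assms(1) by auto
    show "P (sl A) (transpose x (y + 1) z) \<le> z \<and> {P (sl A) (transpose x (y + 1) z)..<z} \<subseteq> set (sl (insert x A))
      \<and> P (sl A) (transpose x (y + 1) z) - 1 \<notin> set (sl (insert x A))"
    proof (cases "z = y + 1")
      case True
      define s where "s = P (sl A) x"
      have s: "s \<le> x" "{s..<x} \<subseteq> A" "s - 1 \<notin> A" using PA(2)[of x] assms by (auto simp: s_def)
      have "{s..<y + 1} \<subseteq> insert x A"
      proof
        fix u assume "u \<in> {s..<y + 1}"
        then show "u \<in> insert x A" using s assms(3) by (cases u x rule: linorder_cases) auto
      qed
      then show ?thesis using True s assms by (auto simp: s_def[symmetric])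
    next
      case False
      define s where "s = P (sl A) z"
      have s: "s \<le> z" "{s..<z} \<subseteq> A" "s - 1 \<notin> A" using PA(2)[of z] z assms by (auto simp: s_def)
      have "s - 1 \<noteq> x"
      proof
        assume "s - 1 = x"
        then have "z \<in> {x<..y} \<or> y + 1 \<in> {s..<z}" using s z False assms by auto
        then show False using z s assms by blast
      qed
      then show ?thesis using s z False assms by (auto simp: s_def[symmetric])
    qed
  qed
  then show "P (sl (insert x A)) z = (P (sl A) \<circ> transpose x (y + 1)) z" by simp
qed

text \<open>The mirror image of \<open>P_sl_insert_left\<close>, interchanging values instead of
  arguments. The transposition is the same in both lemmas, so it cancels in the block
  relation.\<close>

lemma P_sl_insert_right:
  assumes "finite B" "y \<notin> B" "{x..<y} \<subseteq> B" "x - 1 \<notin> B" "x \<le> y"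
  shows "P (sl (insert y B)) = transpose x (y + 1) \<circ> P (sl B)"
proof
  fix z
  note PB = P_increasing[OF sorted_sl[of B]]
  have "P (sl (insert y B)) z = transpose x (y + 1) (P (sl B) z)"
  proof (rule P_increasing_eqI[OF sorted_sl])
    have y1: "P (sl B) y = x"
      by (rule P_increasing_eqI[OF sorted_sl]) (use assms in auto)
    assume "z \<in> set (sl (insert y B))"
    then have "z = y \<or> z \<in> B \<and> z \<noteq> y \<and> z + 1 \<noteq> x" using assms by auto
    then show "transpose x (y + 1) (P (sl B) z) = z + 1" using y1 PB(1)[of z] assms(1) by auto
  next
    assume "z \<notin> set (sl (insert y B))"
    then have z: "z \<noteq> y" "z \<notin> B" using assms(1) by auto
    define s where "s = P (sl B) z"
    have s: "s \<le> z" "{s..<z} \<subseteq> B" "s - 1 \<notin> B" using PB(2)[of z] z assms by (auto simp: s_def)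
    have "s \<noteq> x"
    proof
      assume "s = x"
      then have "z \<in> {x..<y} \<or> y \<in> {s..<z}" using s z assms by auto
      then show False using z s assms by blast
    qed
    moreover have "x \<le> z \<and> {x..<z} \<subseteq> insert y B" if "s = y + 1"
    proof
      show "x \<le> z" using that s assms by simp
      show "{x..<z} \<subseteq> insert y B"
      proof
        fix u assume "u \<in> {x..<z}"
        then show "u \<in> insert y B" using that s assms by (cases u y rule: linorder_cases) auto
      qed
    qed
    ultimately show "transpose x (y + 1) (P (sl B) z) \<le> z \<and> {transpose x (y + 1) (P (sl B) z)..<z} \<subseteq> set (sl (insert y B))
      \<and> transpose x (y + 1) (P (sl B) z) - 1 \<notin> set (sl (insert y B))"
      using s assms by (cases "s = y + 1") (auto simp: s_def[symmetric])
  qed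
  then show "P (sl (insert y B)) z = (transpose x (y + 1) \<circ> P (sl B)) z" by simp
qed

text \<open>The relation behind the crystal operators:
  \<open>s\<^sub>x \<cdots> s\<^sub>y \<cdot> s\<^sub>x \<cdots> s\<^bsub>y-1\<^esub> = s\<^bsub>x+1\<^esub> \<cdots> s\<^sub>y \<cdot> s\<^sub>x \<cdots> s\<^sub>y\<close>.\<close>

lemma P_cw_block:
  assumes "finite A" "finite B" "x \<le> y" "{x..y} \<subseteq> A" "{x..<y} \<subseteq> B" "y \<notin> B" "x - 1 \<notin> B" "y + 1 \<notin> A"
  shows "P (cw A B) = P (cw (A - {x}) (insert y B))"
proof -
  have "P (sl (insert x (A - {x}))) = P (sl (A - {x})) \<circ> transpose x (y + 1)"
    by (rule P_sl_insert_left) (use assms in auto)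
  moreover have "insert x (A - {x}) = A" using assms by auto
  ultimately have "P (sl A) = P (sl (A - {x})) \<circ> transpose x (y + 1)" by simp
  moreover have "P (sl (insert y B)) = transpose x (y + 1) \<circ> P (sl B)"
    by (rule P_sl_insert_right) (use assms in auto)
  ultimately show ?thesis by (simp add: cw_def comp_assoc)
qed

section \<open>Bumps of one increasing word\<close>

definition idx :: "int set \<Rightarrow> int \<Rightarrow> nat" where
  "idx A z = card {u \<in> A. u < z}"

lemma sl_split:
  assumes "finite A" "z \<in> A"
  obtains U V where "sl A = U @ z # V" "length U = idx A z" "sl (A - {z}) = U @ V"
    "\<And>u. u \<in> set U \<Longrightarrow> u < z" "\<And>u. u \<in> set V \<Longrightarrow> z < u" "set U \<union> set V = A - {z}"
proof -
  define U where "U = sl {u \<in> A. u < z}"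
  define V where "V = sl {u \<in> A. z < u}"
  have UV: "set U = {u \<in> A. u < z}" "set V = {u \<in> A. z < u}" using assms by (auto simp: U_def V_def)
  have "sorted_wrt (<) (U @ z # V)" "sorted_wrt (<) (U @ V)"
    using UV by (auto simp: sorted_wrt_append U_def V_def)
  moreover have sets: "set (U @ z # V) = A" "set (U @ V) = A - {z}"
    unfolding set_append list.set UV using assms(2) by force+
  ultimately have "sl A = U @ z # V" "sl (A - {z}) = U @ V" using sl_set by metis+
  moreover have "length U = idx A z" by (simp add: U_def idx_def)
  moreover have "set U \<union> set V = A - {z}" using sets(2) by simp
  ultimately show ?thesis using that[of U V] UV by blast
qed

lemma idx_less: "finite A \<Longrightarrow> z \<in> A \<Longrightarrow> idx A z < card A"
  by (rule sl_split[of A z]) (auto simp flip: length_sorted_list_of_set)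

lemma del_sl: "finite A \<Longrightarrow> z \<in> A \<Longrightarrow> del (idx A z) (sl A) = sl (A - {z})"
  by (metis sl_split del_append_Cons)

lemma sl_index_obtain:
  assumes "finite A" "i < card A"
  obtains z where "z \<in> A" "i = idx A z"
proof -
  have l: "i < length (sl A)" using assms by simp
  let ?z = "sl A ! i"
  have z: "?z \<in> A" using nth_mem[OF l] assms by simp
  obtain U V where UV: "sl A = U @ ?z # V" "length U = idx A ?z" by (rule sl_split[OF assms(1) z])
  have "idx A ?z < length (sl A)" using UV by (metis length_append length_Cons less_add_Suc1 add_Suc_right)
  moreover have "sl A ! idx A ?z = ?z" using UV by (metis nth_append_length)
  ultimately have "i = idx A ?z" using l by (simp add: nth_eq_iff_index_eq)
  then show ?thesis using that z by blast
qed

text \<open>When an increment makes the marked letter equal to its right neighbour, the other mark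
  is that neighbour, and the collision travels to the right until the first gap \<open>y\<close>.
  The bound on \<open>U\<close> is weak because in the intermediate words the left neighbour equals
  the marked letter.\<close>

lemma run_increasing:
  assumes "sorted_wrt (<) U" "\<And>u. u \<in> set U \<Longrightarrow> u \<le> z" "sorted_wrt (<) (z # R)"
    "z < y" "{z<..<y} \<subseteq> set R" "y \<notin> set R"
  shows "\<exists>U' R'. run (U @ z # R) (length U) (U' @ y # R') (length U') \<and> sorted_wrt (<) (U' @ y # R') \<and>
    set (U' @ y # R') = insert y (set U \<union> set R)"
  using assms
proof (induction R arbitrary: U z)
  case Nil
  have "y = z + 1"
  proof (rule ccontr)
    assume "y \<noteq> z + 1"
    then have "z + 1 \<in> {z<..<y}" using Nil.prems(4) by simp
    then show False using Nil.prems(5) by (metis empty_iff empty_set subsetD)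
  qed
  moreover have "sorted_wrt (<) (U @ [z + 1])" using Nil by (force simp: sorted_wrt_append)
  ultimately show ?case
    using run_stop[of "U @ [y]" "U @ [z]" "length U"] reduced_increasing by (intro exI[of _ U] exI[of _ "[]"]) auto
next
  case (Cons r R)
  show ?case
  proof (cases "y = z + 1")
    case True
    have "sorted_wrt (<) (U @ (z + 1) # r # R)" using Cons.prems True by (force simp: sorted_wrt_append)
    then show ?thesis
      using True run_stop[of "U @ (z + 1) # r # R" "U @ z # r # R" "length U"] reduced_increasing
      by (intro exI[of _ U] exI[of _ "r # R"]) auto
  next
    case False
    have r: "r = z + 1"
    proof -
      have "z + 1 \<in> {z<..<y}" using Cons.prems(4) False by simp
      then have "z + 1 \<in> set (r # R)" using Cons.prems(5) by blast
      then show ?thesis using Cons.prems by auto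
    qed
    let ?w = "U @ (z + 1) # (z + 1) # R"
    have inc: "inc (U @ z # r # R) (length U) = ?w" using r by simp
    have nred: "\<not> reduced ?w"
      using two_marks_unreduced[of "z + 1" "[]" "z + 1"] reduced_windowD[of U "[z + 1, z + 1]" R] by auto
    have del: "del (Suc (length U)) ?w = del (length U) (U @ z # r # R)"
      using del_append_Cons[of "U @ [z + 1]" "z + 1" R] r by simp
    have "\<exists>U' R'. run ((U @ [z + 1]) @ (z + 1) # R) (length (U @ [z + 1])) (U' @ y # R') (length U') \<and>
      sorted_wrt (<) (U' @ y # R') \<and> set (U' @ y # R') = insert y (set (U @ [z + 1]) \<union> set R)"
    proof (rule Cons.IH)
      show "sorted_wrt (<) (U @ [z + 1])" using Cons.prems by (force simp: sorted_wrt_append)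
      show "\<And>u. u \<in> set (U @ [z + 1]) \<Longrightarrow> u \<le> z + 1" using Cons.prems(2) by force
      show "{z + 1<..<y} \<subseteq> set R" using Cons.prems(5) r by (force simp: subset_iff)
    qed (use Cons.prems r False in auto)
    then obtain U' R' where *: "run ?w (Suc (length U)) (U' @ y # R') (length U')"
      "sorted_wrt (<) (U' @ y # R')" "set (U' @ y # R') = insert y (set (U @ [z + 1]) \<union> set R)" by auto
    have "run (U @ z # r # R) (length U) (U' @ y # R') (length U')"
      by (rule run.step[of _ _ "Suc (length U)"]) (use inc nred del * in auto)
    then show ?thesis using * r by (intro exI[of _ U'] exI[of _ R']) auto
  qed
qed

text \<open>The inequality \<open>z < y\<close> makes \<open>z\<close> itself a letter of
  \<open>A\<close>. A bump of an increasing word starting at \<open>z\<close> replaces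
  \<open>z\<close> by this gap \<open>y\<close>, which amounts to shifting the run
  \<open>{z..<y}\<close> up by one.\<close>

definition nxt :: "int set \<Rightarrow> int \<Rightarrow> int \<Rightarrow> bool" where
  "nxt A z y \<longleftrightarrow> z < y \<and> {z..<y} \<subseteq> A \<and> y \<notin> A"

lemma interval_exit:
  fixes c t :: int
  assumes "c \<in> A" "\<not> {c..t} \<subseteq> A"
  obtains u where "nxt A c u" "u \<le> t"
proof -
  obtain v where v: "c \<le> v" "v \<le> t" "v \<notin> A" using assms(2) by (meson atLeastAtMost_iff subsetI)
  then have "\<exists>n. c + int n \<notin> A" by (metis zle_iff_zadd)
  then obtain n where n: "c + int n \<notin> A" "\<And>k. k < n \<Longrightarrow> c + int k \<in> A"
    using exists_least_iff[of "\<lambda>n. c + int n \<notin> A"] by blast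
  have "{c..<c + int n} \<subseteq> A"
  proof
    fix u assume u: "u \<in> {c..<c + int n}"
    then have "c + int (nat (u - c)) \<in> A" by (intro n(2)) auto
    then show "u \<in> A" using u by simp
  qed
  moreover have "n \<noteq> 0" using n assms by (metis add.right_neutral of_nat_0)
  moreover have "c + int n \<le> t"
  proof (rule ccontr)
    assume "\<not> c + int n \<le> t"
    then have "v \<in> {c..<c + int n}" using v by auto
    then show False using v calculation(1) by blast
  qed
  ultimately show ?thesis using that[of "c + int n"] n by (simp add: nxt_def)
qed

lemma nxt_exists:
  assumes "finite A" "z \<in> A" obtains y where "nxt A z y"
proof -
  obtain v where "z \<le> v" "v \<notin> A" using assms(1) infinite_Ici[of z] by (meson atLeast_iff finite_subset subsetI)
  then have "\<not> {z..v} \<subseteq> A" by auto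
  then show ?thesis using interval_exit[OF assms(2)] that by blast
qed

lemma run_sl:
  assumes "finite A" "z \<in> A" "nxt A z y"
  shows "run (sl A) (idx A z) (sl (insert y (A - {z}))) (idx (insert y (A - {z})) y)"
proof -
  obtain U V where UV: "sl A = U @ z # V" "length U = idx A z" "sl (A - {z}) = U @ V"
    "\<And>u. u \<in> set U \<Longrightarrow> u < z" "\<And>u. u \<in> set V \<Longrightarrow> z < u" "set U \<union> set V = A - {z}"
    using sl_split[OF assms(1,2)] by metis
  have srt: "sorted_wrt (<) (U @ z # V)" using sorted_sl[of A] UV(1) by simp
  have "\<exists>U' R'. run (U @ z # V) (length U) (U' @ y # R') (length U') \<and> sorted_wrt (<) (U' @ y # R') \<and>
    set (U' @ y # R') = insert y (set U \<union> set V)"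
  proof (rule run_increasing)
    show "sorted_wrt (<) U" "sorted_wrt (<) (z # V)" using srt by (auto simp: sorted_wrt_append)
    show "{z<..<y} \<subseteq> set V"
    proof
      fix u assume u: "u \<in> {z<..<y}"
      then have "u \<in> set U \<union> set V" using assms(3) unfolding UV(6) nxt_def by auto
      then show "u \<in> set V" using u UV(4) by force
    qed
    show "y \<notin> set V" using UV(6) assms(3) by (auto simp: nxt_def)
    show "z < y" using assms(3) by (simp add: nxt_def)
  qed (use UV(4) in force)
  then obtain U' R' where *: "run (U @ z # V) (length U) (U' @ y # R') (length U')"
    "sorted_wrt (<) (U' @ y # R')" "set (U' @ y # R') = insert y (A - {z})" using UV(6) by auto
  have "sl (insert y (A - {z})) = U' @ y # R'" using sl_set[OF *(2)] *(3) by simp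
  moreover have "length U' = idx (insert y (A - {z})) y"
  proof -
    have "{u \<in> insert y (A - {z}). u < y} = set U'"
      unfolding *(3)[symmetric] using *(2) by (auto simp: sorted_wrt_append)
    moreover have "distinct U'" using *(2) by (auto simp: sorted_wrt_append strict_sorted_iff)
    ultimately show ?thesis by (simp add: idx_def distinct_card)
  qed
  ultimately show ?thesis using * UV by simp
qed

section \<open>Bumps of two increasing factors\<close>

lemma del_cw_left: "finite A \<Longrightarrow> z \<in> A \<Longrightarrow> del (idx A z) (cw A B) = cw (A - {z}) B"
  by (simp add: cw_def del_append_left idx_less del_sl)

lemma del_cw_right: "finite B \<Longrightarrow> z \<in> B \<Longrightarrow> del (card A + idx B z) (cw A B) = cw A (B - {z})"
  using del_append_right[of "sl A" "idx B z" "sl B"] by (simp add: cw_def del_sl)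

lemma run_cw_left_stop:
  assumes "finite A" "finite B" "z \<in> A" "nxt A z y" "supported (insert y (A - {z})) B"
  shows "\<exists>k. run (cw A B) (idx A z) (cw (insert y (A - {z})) B) k"
  using run_window_stop[OF run_sl[OF assms(1,3,4)], of "[]" "sl B"] reduced_cw assms
  by (auto simp: cw_def idx_less)

lemma run_cw_right_stop:
  assumes "finite A" "finite B" "z \<in> B" "nxt B z y" "supported A (insert y (B - {z}))"
  shows "\<exists>k. run (cw A B) (card A + idx B z) (cw A (insert y (B - {z}))) k"
  using run_window_stop[OF run_sl[OF assms(2,3,4)], of "sl A" "[]"] reduced_cw[of A "insert y (B - {z})"] assms
  by (auto simp: cw_def idx_less)

text \<open>A violation of \<open>supported\<close> after the shift must involve the new letter
  \<open>y\<close>, and it cannot start below \<open>y\<close>, because its part below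
  \<open>y\<close> would already be a violation for \<open>A - {z}\<close>. It is therefore
  \<open>{y..q}\<close>, and the block relation on this interval shows that the other mark is the
  letter \<open>q\<close> of the second factor.\<close>

lemma run_cw_left_step:
  assumes fin: "finite A" "finite B" and z: "z \<in> A" "nxt A z y" and sup: "supported (A - {z}) B"
    and nsup: "\<not> supported (insert y (A - {z})) B"
  obtains q y' where "y \<le> q" "{y..q} \<subseteq> B" "{y<..q} \<subseteq> A" "y - 1 \<notin> B" "q + 1 \<notin> A" "nxt B q y'"
    "\<exists>k. run (cw A B) (idx A z) (cw (insert y (A - {z})) (insert y' (B - {q}))) k"
proof -
  let ?A = "insert y (A - {z})"
  have zy: "z < y" "y \<notin> A" using z by (auto simp: nxt_def)
  obtain c q where cq: "c \<le> q" "{c..q} \<subseteq> ?A" "{c..q} \<subseteq> B" "c - 1 \<notin> B" "q + 1 \<notin> ?A"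
    using nsup by (rule supportedE)
  have "y \<in> {c..q}"
  proof (rule ccontr)
    assume "y \<notin> {c..q}"
    then have "{c..q} \<subseteq> A - {z}" using cq by auto
    then show False using supportedD[OF sup cq(1)] cq by blast
  qed
  moreover have "\<not> c < y"
  proof
    assume "c < y"
    then have "{c..y - 1} \<subseteq> A - {z}" "{c..y - 1} \<subseteq> B" using cq \<open>y \<in> {c..q}\<close> by (auto simp: subset_iff)
    then show False using supportedD[OF sup, of c "y - 1"] \<open>c < y\<close> cq zy by auto
  qed
  ultimately have c: "c = y" by auto
  have q: "y \<le> q" "{y..q} \<subseteq> B" "{y..q} \<subseteq> ?A" "y - 1 \<notin> B" "q + 1 \<notin> ?A" using cq c by auto
  have qB: "q \<in> B" using q by auto
  obtain y' where y': "nxt B q y'" using nxt_exists[OF fin(2) qB] .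
  let ?B = "insert y' (B - {q})"
  have qy': "q < y'" "{q..<y'} \<subseteq> B" "y' \<notin> B" using y' by (auto simp: nxt_def)
  have block: "P (cw ?A (B - {q})) = P (cw (A - {z}) B)"
  proof -
    have "P (cw ?A (B - {q})) = P (cw (?A - {y}) (insert q (B - {q})))"
      by (rule P_cw_block) (use fin q in auto)
    moreover have "?A - {y} = A - {z}" "insert q (B - {q}) = B" using zy qB by auto
    ultimately show ?thesis by simp
  qed
  have cA: "card ?A = card A" using z zy fin by (metis card_insert_disjoint card_Suc_Diff1 finite_Diff Diff_iff)
  have len: "length (cw ?A (B - {q})) = length (cw (A - {z}) B)"
    unfolding length_cw cA using card_Suc_Diff1[OF fin(1) z(1)] card_Suc_Diff1[OF fin(2) qB] by linarith
  have supq: "supported ?A (B - {q})"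
    using reduced_cong[OF block len] sup fin by (simp add: reduced_cw)
  \<comment> \<open>A second violation would contain \<open>y'\<close>. As \<open>q\<close> has left
    the second factor and \<open>{q + 1..<y'}\<close> lies in it, the violation would start at
    \<open>q + 1\<close>, which is missing from the first factor. So the run stops here.\<close>
  have sup': "supported ?A ?B" unfolding supported_def
  proof (intro allI impI, rule ccontr)
    fix c t assume ct: "c \<le> t" "{c..t} \<subseteq> ?A" "{c..t} \<subseteq> ?B" "\<not> (c - 1 \<in> ?B \<or> t + 1 \<in> ?A)"
    have "y' \<in> {c..t}"
    proof (rule ccontr)
      assume "y' \<notin> {c..t}"
      then have "{c..t} \<subseteq> B - {q}" using ct by auto
      then show False using supportedD[OF supq ct(1,2)] ct by blast
    qed
    have "q \<notin> ?B" using qy' by auto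
    then have "q \<notin> {c..t}" using ct(3) by blast
    then have "q + 1 \<le> c" using \<open>y' \<in> {c..t}\<close> qy' by auto
    moreover have "{q + 1..<y'} \<subseteq> ?B" using qy' by (force simp: subset_iff)
    then have "c - 1 \<notin> {q + 1..<y'}" using ct(4) by blast
    ultimately have "c = q + 1" using \<open>y' \<in> {c..t}\<close> by auto
    then show False using ct q by auto
  qed
  note runA = run_sl[OF fin(1) z]
  have nred: "\<not> reduced ([] @ sl ?A @ sl B)" using nsup fin reduced_cw[of ?A B] by (simp add: cw_def)
  obtain k where k: "run (cw ?A B) (card ?A + idx B q) (cw ?A ?B) k"
    using run_cw_right_stop[of ?A B q y'] fin qB y' sup' by auto
  have idx1: "idx ?A y < card ?A" using idx_less[of ?A y] fin by simp
  have "run ([] @ sl A @ sl B) (length ([]::int list) + idx A z) (cw ?A ?B) k"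
  proof (rule run_window_step[OF runA _ nred])
    show "idx A z < length (sl A)" using idx_less[OF fin(1) z(1)] by simp
    show "card ?A + idx B q \<noteq> length [] + idx ?A y" using idx1 by simp
    show "card ?A + idx B q < length ([] @ sl ?A @ sl B)" using idx_less[OF fin(2) qB] fin by simp
    have "del (idx ?A y) (cw ?A B) = cw (A - {z}) B"
      using del_cw_left[of ?A y B] fin zy by simp
    moreover have "del (card ?A + idx B q) (cw ?A B) = cw ?A (B - {q})"
      by (rule del_cw_right[OF fin(2) qB])
    ultimately have "P (del (card ?A + idx B q) (cw ?A B)) = P (del (idx ?A y) (cw ?A B))" using block by simp
    then show "P (del (card ?A + idx B q) ([] @ sl ?A @ sl B)) = P (del (length [] + idx ?A y) ([] @ sl ?A @ sl B))"
      by (simp add: cw_def del: P_append)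
    show "run ([] @ sl ?A @ sl B) (card ?A + idx B q) (cw ?A ?B) k" using k by (simp add: cw_def)
  qed
  then have "\<exists>k. run (cw A B) (idx A z) (cw ?A ?B) k" by (auto simp: cw_def)
  moreover have "{y<..q} \<subseteq> {y..q} - {y}" by auto
  then have "{y<..q} \<subseteq> A" using q(3) by blast
  moreover have "q + 1 \<notin> A" using q zy by auto
  ultimately show ?thesis using that q y' by blast
qed

text \<open>The counterpart of \<open>run_cw_left_step\<close>: here the violation ends at the new
  letter \<open>y\<close> and starts right after the gap left at \<open>z\<close>, so the other mark
  is \<open>z + 1\<close> in the first factor, whose run reaches exactly to
  \<open>y + 1\<close>.\<close>

lemma run_cw_right_step:
  assumes fin: "finite A" "finite B" and z: "z \<in> B" "nxt B z y" and sup: "supported A (B - {z})"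
    and nsup: "\<not> supported A (insert y (B - {z}))"
  shows "{z + 1..y} \<subseteq> A" "y + 1 \<notin> A"
    "\<exists>k. run (cw A B) (card A + idx B z) (cw (insert (y + 1) (A - {z + 1})) (insert y (B - {z}))) k"
proof -
  let ?B = "insert y (B - {z})"
  have zy: "z < y" "{z..<y} \<subseteq> B" "y \<notin> B" using z by (auto simp: nxt_def)
  obtain p t where pt: "p \<le> t" "{p..t} \<subseteq> A" "{p..t} \<subseteq> ?B" "p - 1 \<notin> ?B" "t + 1 \<notin> A"
    using nsup by (rule supportedE)
  have yin: "y \<in> {p..t}"
  proof (rule ccontr)
    assume "y \<notin> {p..t}"
    then have "{p..t} \<subseteq> B - {z}" using pt by auto
    then show False using supportedD[OF sup pt(1,2)] pt by blast
  qed
  moreover have "\<not> y < t"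
  proof
    assume "y < t"
    have "{y + 1..t} \<subseteq> {p..t} - {y}" using yin by auto
    then have "{y + 1..t} \<subseteq> A" "{y + 1..t} \<subseteq> B - {z}" using pt(2,3) by blast+
    then show False using supportedD[OF sup, of "y + 1" t] \<open>y < t\<close> pt zy by auto
  qed
  ultimately have t: "t = y" by auto
  have "z \<notin> ?B" using zy by auto
  then have "z \<notin> {p..t}" using pt(3) by blast
  then have "z + 1 \<le> p" using yin zy by auto
  moreover have "{z + 1..<y} \<subseteq> ?B" using zy by (force simp: subset_iff)
  then have "p - 1 \<notin> {z + 1..<y}" using pt(4) by blast
  ultimately have p: "p = z + 1" using yin by auto
  show zA: "{z + 1..y} \<subseteq> A" and yA: "y + 1 \<notin> A" using pt p t by auto
  have z1: "z + 1 \<in> A" using zA zy by auto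
  let ?A = "insert (y + 1) (A - {z + 1})"
  have block: "P (cw A (B - {z})) = P (cw (A - {z + 1}) ?B)"
    by (rule P_cw_block) (use fin zA yA zy in auto)
  have cB: "card ?B = card B" using z zy fin by (metis card_insert_disjoint card_Suc_Diff1 finite_Diff Diff_iff)
  have len: "length (cw A (B - {z})) = length (cw (A - {z + 1}) ?B)"
    unfolding length_cw cB using card_Suc_Diff1[OF fin(1) z1] card_Suc_Diff1[OF fin(2) z(1)] by linarith
  have supp: "supported (A - {z + 1}) ?B"
    using reduced_cong[OF block len] sup fin by (simp add: reduced_cw)
  have sup': "supported ?A ?B" unfolding supported_def
  proof (intro allI impI, rule ccontr)
    fix c t assume ct: "c \<le> t" "{c..t} \<subseteq> ?A" "{c..t} \<subseteq> ?B" "\<not> (c - 1 \<in> ?B \<or> t + 1 \<in> ?A)"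
    have yin: "y + 1 \<in> {c..t}"
    proof (rule ccontr)
      assume "y + 1 \<notin> {c..t}"
      then have "{c..t} \<subseteq> A - {z + 1}" using ct by auto
      then show False using supportedD[OF supp ct(1)] ct by blast
    qed
    have "c \<noteq> y + 1" using ct by auto
    then have "c \<le> y" using yin by auto
    then have "{c..y} \<subseteq> A - {z + 1}" "{c..y} \<subseteq> ?B" using ct yin by (auto simp: subset_iff)
    then show False using supportedD[OF supp \<open>c \<le> y\<close>] ct yA by blast
  qed
  note runB = run_sl[OF fin(2) z]
  have nred: "\<not> reduced (sl A @ sl ?B @ [])" using nsup fin reduced_cw[of A ?B] by (simp add: cw_def)
  have nx: "nxt A (z + 1) (y + 1)" using zA yA zy by (auto simp: nxt_def)
  obtain k where k: "run (cw A ?B) (idx A (z + 1)) (cw ?A ?B) k"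
    using run_cw_left_stop[of A ?B "z + 1" "y + 1"] fin z1 nx sup' by auto
  have idx1: "idx A (z + 1) < card A" using idx_less[OF fin(1) z1] .
  have "run (sl A @ sl B @ []) (length (sl A) + idx B z) (cw ?A ?B) k"
  proof (rule run_window_step[OF runB _ nred])
    show "idx B z < length (sl B)" using idx_less[OF fin(2) z(1)] by simp
    show "idx A (z + 1) \<noteq> length (sl A) + idx ?B y" using idx1 by simp
    show "idx A (z + 1) < length (sl A @ sl ?B @ [])" using idx1 by simp
    have "del (card A + idx ?B y) (cw A ?B) = cw A (B - {z})"
      using del_cw_right[of ?B y A] fin zy by simp
    moreover have "del (idx A (z + 1)) (cw A ?B) = cw (A - {z + 1}) ?B"
      by (rule del_cw_left[OF fin(1) z1])
    ultimately have "P (del (idx A (z + 1)) (cw A ?B)) = P (del (card A + idx ?B y) (cw A ?B))" using block by simp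
    then show "P (del (idx A (z + 1)) (sl A @ sl ?B @ [])) = P (del (length (sl A) + idx ?B y) (sl A @ sl ?B @ []))"
      by (simp add: cw_def del: P_append)
    show "run (sl A @ sl ?B @ []) (idx A (z + 1)) (cw ?A ?B) k" using k by (simp add: cw_def)
  qed
  then show "\<exists>k. run (cw A B) (card A + idx B z) (cw ?A ?B) k" by (auto simp: cw_def)
qed

section \<open>Bracket heights\<close>

text \<open>The height of the bracket word in which a letter \<open>t\<close> of the first factor is a closing
  bracket and a letter \<open>t\<close> of the second factor an opening bracket just after it.\<close>

definition ht :: "int set \<Rightarrow> int set \<Rightarrow> int \<Rightarrow> int" where
  "ht A B t = int (card {a \<in> A. a \<le> t}) - int (card {b \<in> B. b < t})"

lemma ht_insert_left: "finite A \<Longrightarrow> y \<notin> A \<Longrightarrow> ht (insert y A) B t = ht A B t + (if y \<le> t then 1 else 0)"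
proof -
  assume "finite A" "y \<notin> A"
  moreover have "{a \<in> insert y A. a \<le> t} = (if y \<le> t then insert y {a \<in> A. a \<le> t} else {a \<in> A. a \<le> t})" by auto
  ultimately show ?thesis by (simp add: ht_def)
qed

lemma ht_insert_right: "finite B \<Longrightarrow> y \<notin> B \<Longrightarrow> ht A (insert y B) t = ht A B t - (if y < t then 1 else 0)"
proof -
  assume "finite B" "y \<notin> B"
  moreover have "{a \<in> insert y B. a < t} = (if y < t then insert y {a \<in> B. a < t} else {a \<in> B. a < t})" by auto
  ultimately show ?thesis by (simp add: ht_def)
qed

lemma ht_remove_left: "finite A \<Longrightarrow> z \<in> A \<Longrightarrow> ht (A - {z}) B t = ht A B t - (if z \<le> t then 1 else 0)"
  using ht_insert_left[of "A - {z}" z B t] by (simp add: insert_absorb)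

lemma ht_remove_right: "finite B \<Longrightarrow> z \<in> B \<Longrightarrow> ht A (B - {z}) t = ht A B t + (if z < t then 1 else 0)"
  using ht_insert_right[of "B - {z}" z A t] by (simp add: insert_absorb)

lemma ht_step:
  assumes "finite A" "finite B"
  shows "ht A B t = ht A B (t - 1) + (if t \<in> A then 1 else 0) - (if t - 1 \<in> B then 1 else 0)"
proof -
  have "{a \<in> A. a \<le> t} = (if t \<in> A then insert t {a \<in> A. a \<le> t - 1} else {a \<in> A. a \<le> t - 1})"
    by (auto simp: order_le_less)
  moreover have "b < t \<longleftrightarrow> b = t - 1 \<or> b < t - 1" for b by linarith
  then have "{b \<in> B. b < t} = (if t - 1 \<in> B then insert (t - 1) {b \<in> B. b < t - 1} else {b \<in> B. b < t - 1})"
    by auto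
  ultimately show ?thesis using assms by (simp add: ht_def)
qed

lemma ht_step':
  assumes "finite A" "finite B"
  shows "ht A B (t + 1) = ht A B t + (if t + 1 \<in> A then 1 else 0) - (if t \<in> B then 1 else 0)"
  using ht_step[OF assms, of "t + 1"] by simp

section \<open>Heights after shifting a run\<close>

lemma ht_shift_left:
  assumes "finite A" "z \<in> A" "nxt A z y"
  shows "ht (insert y (A - {z})) B t = ht A B t - (if z \<le> t \<and> t < y then 1 else 0)"
proof -
  have "ht (insert y (A - {z})) B t = ht (A - {z}) B t + (if y \<le> t then 1 else 0)"
    by (rule ht_insert_left) (use assms in \<open>auto simp: nxt_def\<close>)
  then show ?thesis using ht_remove_left[OF assms(1,2)] assms by (auto simp: nxt_def)
qed

lemma ht_shift_right:
  assumes "finite B" "z \<in> B" "nxt B z y"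
  shows "ht A (insert y (B - {z})) t = ht A B t + (if z < t \<and> t \<le> y then 1 else 0)"
proof -
  have "ht A (insert y (B - {z})) t = ht A (B - {z}) t - (if y < t then 1 else 0)"
    by (rule ht_insert_right) (use assms in \<open>auto simp: nxt_def\<close>)
  then show ?thesis using ht_remove_right[OF assms(1,2)] assms by (auto simp: nxt_def)
qed

lemma nxt_unique: "nxt A z y \<Longrightarrow> nxt A z y' \<Longrightarrow> y = y'"
proof (rule ccontr)
  assume *: "nxt A z y" "nxt A z y'" "y \<noteq> y'"
  then have "y \<in> {z..<y'} \<or> y' \<in> {z..<y}" by (auto simp: nxt_def)
  then show False using * unfolding nxt_def by blast
qed

lemma nxt_shifted: "nxt B z y \<Longrightarrow> {z + 1..y} \<subseteq> insert y (B - {z})"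
proof
  fix u assume *: "nxt B z y" "u \<in> {z + 1..y}"
  then have "u = y \<or> u \<in> {z..<y} \<and> u \<noteq> z" by auto
  then show "u \<in> insert y (B - {z})" using *(1) unfolding nxt_def by blast
qed

text \<open>A first gap \<open>u\<close> of \<open>A\<close> above \<open>c\<close>, with
  \<open>u\<close> at most \<open>t\<close>, would make \<open>{c..u - 1}\<close> a common interval
  that cannot be extended in either permitted direction.\<close>

lemma supported_interval:
  assumes "supported A B" "c \<in> A" "{c..<t} \<subseteq> B" "c - 1 \<notin> B"
  shows "{c..t} \<subseteq> A"
proof (rule ccontr)
  assume "\<not> {c..t} \<subseteq> A"
  then obtain u where u: "nxt A c u" "u \<le> t" using interval_exit assms by blast
  then have "{c..u - 1} \<subseteq> {c..<u}" "{c..u - 1} \<subseteq> {c..<t}" "c \<le> u - 1" by (auto simp: nxt_def)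
  then show False using supportedD[OF assms(1), of c "u - 1"] u assms unfolding nxt_def by auto
qed

text \<open>In the shifted set \<open>q\<close> is missing, and \<open>q + 1\<close> is not in
  \<open>A\<close>, so the new height does not change from \<open>q\<close> to \<open>q + 1\<close>;
  from there to \<open>y\<close> every gain from \<open>A\<close> is offset by a letter of the
  run.\<close>

lemma ht_right_shift_le:
  assumes "finite A" "finite B" "q \<in> B" "nxt B q y" "q + 1 \<notin> A" "q < t" "t \<le> y"
  shows "ht A (insert y (B - {q})) t \<le> ht A B q"
  using assms(6,7)
proof (induction t rule: int_gr_induct)
  case base
  then show ?case
    using ht_shift_right[OF assms(2-4), of A q] ht_step'[of A "insert y (B - {q})" q] assms by (auto simp: nxt_def)
next
  case (step t)
  have "t \<in> B - {q}" using step assms(4) by (auto simp: nxt_def)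
  then show ?case using step ht_step'[of A "insert y (B - {q})" t] assms by auto
qed

text \<open>By \<open>supported_interval\<close>, the shifted run forces a run of letters of
  \<open>A\<close> reaching one step further. Gains and losses of the new height then cancel along
  the run, and at \<open>y + 1\<close> the shift has no effect.\<close>

lemma ht_right_shift_supported:
  assumes "finite A" "finite B" "z \<in> B" "nxt B z y" "z + 1 \<in> A" "supported A (insert y (B - {z}))"
  shows "{z + 1..y + 1} \<subseteq> A" "z < t \<Longrightarrow> t \<le> y + 1 \<Longrightarrow> ht A (insert y (B - {z})) t = ht A B (y + 1)"
proof -
  let ?B = "insert y (B - {z})"
  have y: "z < y" "{z..<y} \<subseteq> B" "y \<notin> B" using assms(4) by (auto simp: nxt_def)
  have yB: "{z + 1..<y + 1} \<subseteq> ?B" using nxt_shifted[OF assms(4)] by (simp add: atLeastLessThanPlusOne_atLeastAtMost_int)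
  show A: "{z + 1..y + 1} \<subseteq> A"
    by (rule supported_interval[OF assms(6,5) yB]) (use y in auto)
  have const: "ht A ?B t = ht A ?B (z + 1)" if "z + 1 \<le> t" "t \<le> y + 1" for t
    using that
  proof (induction t rule: int_ge_induct)
    case (step t)
    have "t \<in> ?B" "t + 1 \<in> A" using yB A step by auto
    then show ?case using step ht_step'[of A ?B t] assms by auto
  qed simp
  show "ht A ?B t = ht A B (y + 1)" if "z < t" "t \<le> y + 1"
    using const[of t] const[of "y + 1"] that y ht_shift_right[OF assms(2-4), of A "y + 1"] by auto
qed

text \<open>For finite letter sets the height vanishes far to the left, so a first maximum exists
  exactly when some height is positive. This separates the words on which \<open>f\<close> is
  defined from those with \<open>f = 0\<close>.\<close>

definition first_max :: "int set \<Rightarrow> int set \<Rightarrow> int \<Rightarrow> bool" where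
  "first_max A B x \<longleftrightarrow> (\<forall>t. ht A B t \<le> ht A B x) \<and> (\<forall>t<x. ht A B t < ht A B x)"

lemma first_maxI:
  assumes "ht A B x = M" "\<And>t. x < t \<Longrightarrow> ht A B t \<le> M" "\<And>t. t < x \<Longrightarrow> ht A B t < M"
  shows "first_max A B x"
  unfolding first_max_def
proof (intro conjI allI impI)
  fix t show "ht A B t \<le> ht A B x" using assms by (cases t x rule: linorder_cases) (auto simp: less_imp_le)
qed (use assms in auto)

text \<open>\<open>lower A B x y\<close> states that the lowering operator removes \<open>x\<close> from \<open>A\<close> and adds \<open>y\<close> to \<open>B\<close>.\<close>

definition lower :: "int set \<Rightarrow> int set \<Rightarrow> int \<Rightarrow> int \<Rightarrow> bool" where
  "lower A B x y \<longleftrightarrow> first_max A B x \<and> x \<le> y \<and> {x..<y} \<subseteq> B \<and> y \<notin> B"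

text \<open>A rise of the height at \<open>x\<close> requires \<open>x\<close> in \<open>A\<close>
  and \<open>x - 1\<close> outside \<open>B\<close>. Then \<open>supported_interval\<close> yields
  the block in \<open>A\<close>, along which the height is constant, and \<open>y + 1\<close> in
  \<open>A\<close> would push the height above its maximum.\<close>

lemma lower_block:
  assumes "finite A" "finite B" "supported A B" "lower A B x y"
  shows "x - 1 \<notin> B" "{x..y} \<subseteq> A" "y + 1 \<notin> A" "t \<in> {x..y + 1} \<Longrightarrow> ht A B t = ht A B x"
    "P (cw A B) = P (cw (A - {x}) (insert y B))" "supported (A - {x}) (insert y B)"
proof -
  have fm: "first_max A B x" and y: "x \<le> y" "{x..<y} \<subseteq> B" "y \<notin> B" using assms(4) by (auto simp: lower_def)
  have "ht A B (x - 1) < ht A B x" using fm by (simp add: first_max_def)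
  then have x: "x \<in> A" "x - 1 \<notin> B" using ht_step[OF assms(1,2), of x] by (auto split: if_splits)
  show "x - 1 \<notin> B" by (rule x)
  show A: "{x..y} \<subseteq> A" by (rule supported_interval[OF assms(3) x(1) y(2) x(2)])
  have const: "ht A B t = ht A B x" if "x \<le> t" "t \<le> y" for t
    using that
  proof (induction t rule: int_ge_induct)
    case (step t)
    have "t \<in> B" "t + 1 \<in> A" using A y step by auto
    then show ?case using step ht_step'[OF assms(1,2), of t] by auto
  qed simp
  have "ht A B (y + 1) \<le> ht A B x" using fm by (simp add: first_max_def)
  then show yA: "y + 1 \<notin> A" using ht_step'[OF assms(1,2), of y] const[of y] y by (auto split: if_splits)
  show "t \<in> {x..y + 1} \<Longrightarrow> ht A B t = ht A B x"
    using const[of t] const[of y] yA y ht_step'[OF assms(1,2), of y] by (cases "t = y + 1") auto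
  show eq: "P (cw A B) = P (cw (A - {x}) (insert y B))"
    by (rule P_cw_block) (use assms x y A yA in auto)
  have "length (cw A B) = length (cw (A - {x}) (insert y B))"
    using assms y card_Suc_Diff1[OF assms(1) x(1)] by (simp add: length_cw)
  from reduced_cong[OF eq this] show "supported (A - {x}) (insert y B)"
    using assms by (simp add: reduced_cw)
qed

lemma supported_cong:
  assumes "finite A" "finite B" "finite A'" "finite B'" "P (cw A B) = P (cw A' B')"
    "card A + card B = card A' + card B'"
  shows "supported A B \<longleftrightarrow> supported A' B'"
  using reduced_cong[OF assms(5)] assms by (simp add: reduced_cw length_cw)

text \<open>Meant for the lowered word, where \<open>{y..q}\<close> is known in advance: it is
  itself a violation, and the conditions at its right end identify it with the one produced by
  \<open>run_cw_left_step\<close>.\<close>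

lemma run_cw_left_stepI:
  assumes fin: "finite A" "finite B" and z: "z \<in> A" "nxt A z y" and sup: "supported (A - {z}) B"
    and q: "y \<le> q" "{y..q} \<subseteq> B" "{y<..q} \<subseteq> A" "y - 1 \<notin> B" "q + 1 \<notin> A" "nxt B q y'"
  shows "\<exists>k. run (cw A B) (idx A z) (cw (insert y (A - {z})) (insert y' (B - {q}))) k"
proof -
  have zy: "z < y" using z by (simp add: nxt_def)
  have "{y..q} \<subseteq> insert y (A - {z})" using q(3) zy by (force simp: subset_iff)
  then have "\<not> supported (insert y (A - {z})) B"
    using supportedD[of "insert y (A - {z})" B y q] q zy by auto
  from run_cw_left_step[OF fin z sup this] obtain q2 y2 where
    2: "y \<le> q2" "{y<..q2} \<subseteq> A" "q2 + 1 \<notin> A" "nxt B q2 y2"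
    "\<exists>k. run (cw A B) (idx A z) (cw (insert y (A - {z})) (insert y2 (B - {q2}))) k" by metis
  have "q2 = q"
  proof (rule ccontr)
    assume "q2 \<noteq> q"
    then have "q + 1 \<in> {y<..q2} \<or> q2 + 1 \<in> {y<..q}" using 2 q by auto
    then show False using 2 q by blast
  qed
  then show ?thesis using 2 q nxt_unique by metis
qed

lemma run_cw_right_stepI:
  assumes fin: "finite A" "finite B" and z: "z \<in> B" "nxt B z y" and sup: "supported A (B - {z})"
    and "{z + 1..y} \<subseteq> A" "y + 1 \<notin> A"
  shows "\<exists>k. run (cw A B) (card A + idx B z) (cw (insert (y + 1) (A - {z + 1})) (insert y (B - {z}))) k"
proof -
  have zy: "z < y" "{z..<y} \<subseteq> B" "y \<notin> B" using z by (auto simp: nxt_def)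
  have "{z + 1..y} \<subseteq> insert y (B - {z})" by (rule nxt_shifted[OF z(2)])
  then have "\<not> supported A (insert y (B - {z}))"
    using supportedD[of A "insert y (B - {z})" "z + 1" y] assms zy by auto
  then show ?thesis using run_cw_right_step[OF fin z sup] by blast
qed

text \<open>The shift in \<open>A\<close> can only lower the height, and the raise caused by the
  shift in \<open>B\<close> is bounded through \<open>ht_right_shift_le\<close> by the old height at
  \<open>q\<close>.\<close>

lemma ht_left_step:
  assumes fin: "finite A" "finite B" and z: "z \<in> A" "nxt A z y"
    and q: "y \<le> q" "{y..q} \<subseteq> B" "q + 1 \<notin> A" "nxt B q y'"
  shows "ht (insert y (A - {z})) (insert y' (B - {q})) t \<le> (if q < t \<and> t \<le> y' then ht A B q else ht A B t)"
    and "\<not> (z \<le> t \<and> t < y) \<Longrightarrow> \<not> (q < t \<and> t \<le> y')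
      \<Longrightarrow> ht (insert y (A - {z})) (insert y' (B - {q})) t = ht A B t"
proof -
  let ?A = "insert y (A - {z})"
  have qB: "q \<in> B" and zy: "z < y" using q z by (auto simp: nxt_def)
  have eq: "ht ?A (insert y' (B - {q})) t = ht ?A B t + (if q < t \<and> t \<le> y' then 1 else 0)" for t
    by (rule ht_shift_right[OF fin(2) qB q(4)])
  note left = ht_shift_left[OF fin(1) z, of B]
  have "q + 1 \<notin> ?A" using q by auto
  then have "ht ?A (insert y' (B - {q})) t \<le> ht ?A B q" if "q < t" "t \<le> y'"
    using ht_right_shift_le[of ?A B q y' t] fin qB q that by simp
  moreover have "ht ?A B q = ht A B q" using left[of q] q by simp
  ultimately show "ht ?A (insert y' (B - {q})) t \<le> (if q < t \<and> t \<le> y' then ht A B q else ht A B t)"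
    using eq[of t] left[of t] by auto
  show "\<not> (z \<le> t \<and> t < y) \<Longrightarrow> \<not> (q < t \<and> t \<le> y') \<Longrightarrow> ht ?A (insert y' (B - {q})) t = ht A B t"
    using eq[of t] left[of t] by auto
qed

text \<open>The shift in \<open>B\<close> raises the height exactly on \<open>{z<..y}\<close>, and
  the shift in \<open>A\<close> lowers it exactly there.\<close>

lemma ht_right_step:
  assumes "finite A" "finite B" "z \<in> B" "nxt B z y" "{z + 1..y} \<subseteq> A" "y + 1 \<notin> A"
  shows "ht (insert (y + 1) (A - {z + 1})) (insert y (B - {z})) t = ht A B t"
proof -
  have zy: "z < y" using assms by (simp add: nxt_def)
  have "z + 1 \<in> A" "nxt A (z + 1) (y + 1)" using assms zy by (auto simp: nxt_def)
  then show ?thesis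
    using ht_shift_left[OF assms(1), of "z + 1" "y + 1"] ht_shift_right[OF assms(2-4)] by auto
qed

text \<open>The cases \<open>z + 1\<close> outside and inside \<open>A\<close> fall under
  \<open>ht_right_shift_le\<close> and \<open>ht_right_shift_supported\<close>. All bounds are
  values of the old height, so a run that stops in \<open>B\<close> cannot raise the
  maximum.\<close>

lemma ht_right_stop:
  assumes "finite A" "finite B" "z \<in> B" "nxt B z y" "supported A (insert y (B - {z}))"
  shows "ht A (insert y (B - {z})) t \<le>
    (if z < t \<and> t \<le> y then max (ht A B z) (if y + 1 \<in> A then ht A B (y + 1) else ht A B z) else ht A B t)"
proof (cases "z < t \<and> t \<le> y")
  case True
  show ?thesis
  proof (cases "z + 1 \<in> A")
    case z1: True
    have "y + 1 \<in> A" using ht_right_shift_supported(1)[OF assms(1-4) z1 assms(5)] assms(4) by (auto simp: nxt_def)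
    then show ?thesis using ht_right_shift_supported(2)[OF assms(1-4) z1 assms(5), of t] True by simp
  next
    case False
    then show ?thesis using ht_right_shift_le[OF assms(1-4), of t] True by auto
  qed
next
  case False
  then show ?thesis using ht_shift_right[OF assms(2-4), of A t] by auto
qed

section \<open>Bumps commute with the lowering operator\<close>

text \<open>The index \<open>i'\<close> marks the lowered pair for the same transposition as
  \<open>i\<close>. The condition on \<open>card A1\<close> fixes the border between the factors,
  which is invisible in the concatenated word.\<close>

definition lowered_run :: "int set \<Rightarrow> int set \<Rightarrow> nat \<Rightarrow> int set \<Rightarrow> int set \<Rightarrow> bool" where
  "lowered_run A B i A' B' \<longleftrightarrow> (\<exists>i' A1 B1 x y. i' < length (cw A' B') \<and>
     P (del i' (cw A' B')) = P (del i (cw A B)) \<and> finite A1 \<and> finite B1 \<and> card A1 = card A \<and>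
     lower A1 B1 x y \<and> (\<exists>k. run (cw A B) i (cw A1 B1) k) \<and>
     (\<exists>k. run (cw A' B') i' (cw (A1 - {x}) (insert y B1)) k))"

lemma lowered_runI:
  assumes "i' < length (cw A' B')" "P (del i' (cw A' B')) = P (del i (cw A B))" "finite A1" "finite B1"
    "card A1 = card A" "lower A1 B1 x y" "\<exists>k. run (cw A B) i (cw A1 B1) k"
    "A1' = A1 - {x}" "B1' = insert y B1" "\<exists>k. run (cw A' B') i' (cw A1' B1') k"
  shows "lowered_run A B i A' B'"
  using assms unfolding lowered_run_def by blast

lemma card_nxt: "finite A \<Longrightarrow> z \<in> A \<Longrightarrow> nxt A z y \<Longrightarrow> card (insert y (A - {z})) = card A"
  by (metis Diff_iff card_Suc_Diff1 card_insert_disjoint finite_Diff nxt_def)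

lemma run_supported:
  assumes "\<exists>k. run (cw A B) i (cw A1 B1) k" "i < length (cw A B)" "finite A1" "finite B1"
  shows "supported A1 B1"
  using assms run_invariants reduced_cw by blast

section \<open>Case analysis by the position of the mark relative to the block\<close>

locale lowering =
  fixes A B :: "int set" and x e :: int
  assumes fin: "finite A" "finite B" and sup: "supported A B" and low: "lower A B x e"
begin

abbreviation A' where "A' \<equiv> A - {x}"
abbreviation B' where "B' \<equiv> insert e B"

lemma basic:
  "x \<le> e" "x - 1 \<notin> B" "{x..e} \<subseteq> A" "{x..<e} \<subseteq> B" "e \<notin> B" "e + 1 \<notin> A" "x \<in> A" "first_max A B x"
  "\<And>t. t \<in> {x..e + 1} \<Longrightarrow> ht A B t = ht A B x" "\<And>t. ht A B t \<le> ht A B x" "\<And>t. t < x \<Longrightarrow> ht A B t < ht A B x"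
proof -
  show xe: "x \<le> e" and "{x..<e} \<subseteq> B" "e \<notin> B" and fm: "first_max A B x"
    using low by (simp_all add: lower_def)
  show "\<And>t. ht A B t \<le> ht A B x" "\<And>t. t < x \<Longrightarrow> ht A B t < ht A B x"
    using fm by (simp_all add: first_max_def)
  note block = lower_block[OF fin sup low]
  show "x - 1 \<notin> B" "{x..e} \<subseteq> A" "e + 1 \<notin> A" "\<And>t. t \<in> {x..e + 1} \<Longrightarrow> ht A B t = ht A B x"
    by (fact block)+
  show "x \<in> A" using block(2) xe by auto
qed

lemma fin': "finite A'" "finite B'" using fin by auto

lemma card': "Suc (card A') = card A" "card B' = Suc (card B)"
  using card_Suc_Diff1[OF fin(1) basic(7)] card_insert_disjoint[OF fin(2) basic(5)] by simp_all

text \<open>The conditions of the block relation survive the deletion of a letter outside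
  \<open>{x..e}\<close>. Hence such a mark sits at the same letter in the lowered word.\<close>

lemma block_left:
  assumes "z \<in> A" "z \<notin> {x..e}"
  shows "P (cw (A' - {z}) B') = P (cw (A - {z}) B)"
proof -
  have "P (cw (A - {z}) B) = P (cw (A - {z} - {x}) B')"
    by (rule P_cw_block) (use fin basic(1-7) assms in auto)
  moreover have "A - {z} - {x} = A' - {z}" by auto
  ultimately show ?thesis by simp
qed

lemma block_right:
  assumes "z \<in> B" "z \<notin> {x..e}"
  shows "P (cw A' (B' - {z})) = P (cw A (B - {z}))"
proof -
  have "P (cw A (B - {z})) = P (cw A' (insert e (B - {z})))"
    by (rule P_cw_block) (use fin basic(1-7) assms in auto)
  moreover have "insert e (B - {z}) = B' - {z}" using basic(1-7) assms by auto
  ultimately show ?thesis by simp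
qed

lemma supported_left:
  assumes "z \<in> A" "z \<notin> {x..e}" "supported (A - {z}) B"
  shows "supported (A' - {z}) B'"
proof -
  have "z \<in> A'" using assms basic(1-7) by auto
  then have "card (A' - {z}) + card B' = card (A - {z}) + card B"
    using card' card_Suc_Diff1[OF fin(1) assms(1)] card_Suc_Diff1[OF fin'(1) \<open>z \<in> A'\<close>] by linarith
  then show ?thesis using supported_cong[OF _ _ _ _ block_left[OF assms(1,2)]] assms(3) fin by simp
qed

lemma supported_right:
  assumes "z \<in> B" "z \<notin> {x..e}" "supported A (B - {z})"
  shows "supported A' (B' - {z})"
proof -
  have "z \<in> B'" using assms by auto
  then have "card A' + card (B' - {z}) = card A + card (B - {z})"
    using card' card_Suc_Diff1[OF fin(2) assms(1)] card_Suc_Diff1[OF fin'(2) \<open>z \<in> B'\<close>] by linarith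
  then show ?thesis using supported_cong[OF _ _ _ _ block_right[OF assms(1,2)]] assms(3) fin by simp
qed

text \<open>The run from \<open>z\<close> absorbs the part of the block in \<open>A\<close> and ends
  at \<open>e + 1\<close>, where the next lowering then starts. In the lowered word \<open>x\<close>
  is a gap: if \<open>z\<close> lies before it, the run in the first factor ends at \<open>x\<close>
  and continues at the letter \<open>e\<close> of the second factor; if \<open>z = x\<close>, the
  mark is \<open>e\<close> from the beginning.\<close>

lemma left_through_block:
  assumes z: "z \<in> A" "z \<le> x" "{z..x} \<subseteq> A" and zs: "supported (A - {z}) B"
  shows "lowered_run A B (idx A z) A' B'"
proof -
  let ?A = "insert (e + 1) (A - {z})"
  have nz: "nxt A z (e + 1)"
  proof -
    have "{z..<e + 1} \<subseteq> {z..x} \<union> {x..e}" by auto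
    then show ?thesis using z basic(1-7) unfolding nxt_def by auto
  qed
  obtain y' where y': "nxt B' e y'" using nxt_exists[of B' e] fin by auto
  have "{e + 1..<y'} \<subseteq> {e..<y'} - {e}" by auto
  then have y1: "e < y'" "{e + 1..<y'} \<subseteq> B" "y' \<notin> B"
    using y' unfolding nxt_def by blast+
  have htA: "ht ?A B t = ht A B t - (if z \<le> t \<and> t < e + 1 then 1 else 0)" for t
    by (rule ht_shift_left[OF fin(1) z(1) nz])
  have htA_less: "ht ?A B t < ht A B x" if "t < e + 1" for t
    using htA[of t] basic(9)[of t] basic(11)[of t] that z(2) by (cases "t < x") (simp_all split: if_splits)
  have htA_e: "ht ?A B (e + 1) = ht A B x" using htA[of "e + 1"] basic(1) basic(9)[of "e + 1"] by simp
  \<comment> \<open>Whether or not the bump enters the second factor, lowering its result turns the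
    second factor into \<open>insert y' B\<close>, so the two cases can be merged.\<close>
  obtain B1 w where B1: "finite B1" "\<exists>k. run (cw A B) (idx A z) (cw ?A B1) k" "lower ?A B1 (e + 1) w"
    "insert w B1 = insert y' B"
  proof (cases "supported ?A B")
    case True
    have "first_max ?A B (e + 1)"
    proof (rule first_maxI[OF htA_e])
      show "ht ?A B t \<le> ht A B x" for t using htA[of t] basic(10)[of t] by simp
    qed (rule htA_less)
    then have "lower ?A B (e + 1) y'" using y1 by (simp add: lower_def)
    then show ?thesis using that[of B y'] run_cw_left_stop[OF fin z(1) nz True] fin by simp
  next
    case False
    from run_cw_left_step[OF fin z(1) nz zs this] obtain q y2 where
      q: "e + 1 \<le> q" "{e + 1..q} \<subseteq> B" "{e + 1<..q} \<subseteq> A" "q + 1 \<notin> A" "nxt B q y2"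
        "\<exists>k. run (cw A B) (idx A z) (cw ?A (insert y2 (B - {q}))) k" by metis
    have y2: "q < y2" "{q..<y2} \<subseteq> B" "y2 \<notin> B" using q(5) by (auto simp: nxt_def)
    have "{e..<y2} \<subseteq> {e} \<union> {e + 1..q} \<union> {q..<y2}" by auto
    then have "nxt B' e y2" using q y2 unfolding nxt_def by auto
    then have yy: "y2 = y'" using y' nxt_unique by blast
    let ?B = "insert y' (B - {q})"
    note st = ht_left_step[OF fin z(1) nz q(1,2,4), of y', folded yy, OF q(5), unfolded yy]
    have "first_max ?A ?B (e + 1)"
    proof (rule first_maxI)
      show "ht ?A ?B (e + 1) = ht A B x" using st(2)[of "e + 1"] basic(1) basic(9)[of "e + 1"] q(1) by simp
      show "ht ?A ?B t \<le> ht A B x" for t using st(1)[of t] basic(10)[of t] basic(10)[of q] by (auto split: if_splits)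
      have "ht ?A ?B t = ht ?A B t" if "t < e + 1" for t
        using ht_shift_right[OF fin(2) _ q(5), of ?A t] q(1,2) that unfolding yy by auto
      then show "ht ?A ?B t < ht A B x" if "t < e + 1" for t using htA_less that by simp
    qed
    moreover have "q \<notin> ?B" using y2 yy by auto
    moreover have "{e + 1..<q} \<subseteq> ?B" using q(2) by (force simp: subset_iff)
    ultimately have "lower ?A ?B (e + 1) q" using q(1) by (simp add: lower_def)
    moreover have "insert q ?B = insert y' B" using q by auto
    ultimately show ?thesis using that[of ?B q] fin q(6) yy by simp
  qed
  have sup1: "supported ?A B1"
    by (rule run_supported[OF B1(2)]) (use fin B1 idx_less[OF fin(1) z(1)] in \<open>auto simp: length_cw\<close>)
  have A1: "?A - {e + 1} = A - {z}" using basic(1-7) by auto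
  have "supported (?A - {e + 1}) (insert w B1)"
    by (rule lower_block(6)[OF _ B1(1) sup1 B1(3)]) (use fin in simp)
  then have sup2: "supported (A - {z}) (insert y' B)" unfolding A1 B1(4) .
  have B'e: "insert y' (B' - {e}) = insert y' B" using basic(1-7) by auto
  show ?thesis
  proof (cases "z = x")
    case True
    show ?thesis
    proof (rule lowered_runI[OF _ _ _ B1(1) card_nxt[OF fin(1) z(1) nz] B1(3) B1(2)])
      show "card A' + idx B' e < length (cw A' B')" using idx_less[OF fin'(2)] by (simp add: length_cw)
      \<comment> \<open>Deleting \<open>x\<close> before lowering and deleting \<open>e\<close>
        after lowering leave the same pair \<open>A - {x}\<close>, \<open>B\<close>.\<close>
      have "del (card A' + idx B' e) (cw A' B') = cw A' (B' - {e})"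
        by (rule del_cw_right) (use fin in auto)
      also have "\<dots> = del (idx A z) (cw A B)" using del_cw_left[OF fin(1) z(1)] basic(1-7) True by simp
      finally show "P (del (card A' + idx B' e) (cw A' B')) = P (del (idx A z) (cw A B))" by simp
      show "\<exists>k. run (cw A' B') (card A' + idx B' e) (cw A' (insert y' B)) k"
        using run_cw_right_stop[OF fin' _ y'] sup2 True unfolding B'e by simp
      show "A' = ?A - {e + 1}" using A1 unfolding True by (rule sym)
    qed (use fin B1 in auto)
  next
    case False
    have zA': "z \<in> A'" using z False by simp
    have nz': "nxt A' z x" using z False by (auto simp: nxt_def)
    have zs': "supported (A' - {z}) B'" by (rule supported_left) (use z False zs in auto)
    have "\<exists>k. run (cw A' B') (idx A' z) (cw (insert x (A' - {z})) (insert y' (B' - {e}))) k"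
    proof (rule run_cw_left_stepI[OF fin' zA' nz' zs' basic(1) _ _ _ _ y'])
      show "{x..e} \<subseteq> B'" by (rule interval_extend(2)[OF basic(4)])
      show "{x<..e} \<subseteq> A'" using basic(3) by auto
      show "x - 1 \<notin> B'" "e + 1 \<notin> A'" using basic(1-7) by auto
    qed
    moreover have "insert x (A' - {z}) = A - {z}" using False basic(1-7) by auto
    ultimately have r: "\<exists>k. run (cw A' B') (idx A' z) (cw (A - {z}) (insert y' B)) k" unfolding B'e by simp
    show ?thesis
    proof (rule lowered_runI[OF _ _ _ B1(1) card_nxt[OF fin(1) z(1) nz] B1(3) B1(2) _ _ r])
      show "idx A' z < length (cw A' B')" using idx_less[OF fin'(1) zA'] by (simp add: length_cw)
      show "P (del (idx A' z) (cw A' B')) = P (del (idx A z) (cw A B))"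
        using del_cw_left[OF fin(1) z(1)] del_cw_left[OF fin'(1) zA'] block_left[of z] z False by simp
    qed (use fin B1 A1 in auto)
  qed
qed

text \<open>A bump that stays away from the block leaves the next lowering to remove
  \<open>x\<close> and add \<open>e\<close> again. Support of the lowered result follows from that
  of the first result by \<open>lower_block\<close>, and is therefore granted to the last
  assumption.\<close>

lemma disjoint_run:
  assumes "i < length (cw A B)" "i' < length (cw A' B')" "P (del i' (cw A' B')) = P (del i (cw A B))"
    and "finite A1" "finite B1" "card A1 = card A" "\<exists>k. run (cw A B) i (cw A1 B1) k"
    and "first_max A1 B1 x" "{x..<e} \<subseteq> B1" "e \<notin> B1"
    and "supported (A1 - {x}) (insert e B1) \<Longrightarrow> \<exists>k. run (cw A' B') i' (cw (A1 - {x}) (insert e B1)) k"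
  shows "lowered_run A B i A' B'"
proof -
  have l: "lower A1 B1 x e" using assms basic(1-7) by (simp add: lower_def)
  have "supported A1 B1" by (rule run_supported) (use assms in auto)
  then have "supported (A1 - {x}) (insert e B1)" using lower_block(6) l assms by blast
  then show ?thesis using assms l by (intro lowered_runI) auto
qed

lemma left_outside:
  assumes z: "z \<in> A" "nxt A z y" "y < x \<or> e + 1 < z" and zs: "supported (A - {z}) B"
  shows "lowered_run A B (idx A z) A' B'"
proof -
  let ?A = "insert y (A - {z})"
  have zy: "z < y" "{z..<y} \<subseteq> A" "y \<notin> A" using z by (auto simp: nxt_def)
  have zout: "z \<notin> {x..e}" using z zy by auto
  have zA': "z \<in> A'" using z zout basic(1) by auto
  have nz': "nxt A' z y" using zy z(3) basic(1) by (auto simp: nxt_def)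
  have zs': "supported (A' - {z}) B'" by (rule supported_left[OF z(1) zout zs])
  have il: "idx A z < length (cw A B)" "idx A' z < length (cw A' B')"
    using idx_less[OF fin(1) z(1)] idx_less[OF fin'(1) zA'] by (auto simp: length_cw)
  have Pz: "P (del (idx A' z) (cw A' B')) = P (del (idx A z) (cw A B))"
    using del_cw_left[OF fin(1) z(1)] del_cw_left[OF fin'(1) zA'] block_left[OF z(1) zout] by simp
  have xA: "?A - {x} = insert y (A' - {z})" using z(3) zy basic(1-7) by auto
  have fA: "finite ?A" using fin by simp
  show ?thesis
  proof (cases "supported ?A B")
    case True
    have htA: "ht ?A B t = ht A B t - (if z \<le> t \<and> t < y then 1 else 0)" for t
      by (rule ht_shift_left[OF fin(1) z(1,2)])
    have fm: "first_max ?A B x"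
    proof (rule first_maxI)
      show "ht ?A B x = ht A B x" using htA[of x] z(3) zout basic(1) zy by auto
      show "ht ?A B t \<le> ht A B x" for t using htA[of t] basic(10)[of t] by auto
      show "ht ?A B t < ht A B x" if "t < x" for t using htA[of t] basic(11)[OF that] by auto
    qed
    show ?thesis
      by (rule disjoint_run[OF il Pz fA fin(2) card_nxt[OF fin(1) z(1,2)] run_cw_left_stop[OF fin z(1,2) True] fm
            basic(4,5)]) (unfold xA, rule run_cw_left_stop[OF fin' zA' nz'])
  next
    case False
    from run_cw_left_step[OF fin z(1,2) zs this] obtain q y' where
      q: "y \<le> q" "{y..q} \<subseteq> B" "{y<..q} \<subseteq> A" "y - 1 \<notin> B" "q + 1 \<notin> A" "nxt B q y'"
        "\<exists>k. run (cw A B) (idx A z) (cw ?A (insert y' (B - {q}))) k" by metis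
    let ?B = "insert y' (B - {q})"
    have qy: "q < y'" "{q..<y'} \<subseteq> B" "y' \<notin> B" using q(6) by (auto simp: nxt_def)
    \<comment> \<open>Since \<open>x - 1\<close> is not in \<open>B\<close>, neither a violating
      interval nor a run in the second factor that starts to the left of \<open>x\<close> can reach
      the block.\<close>
    have far: "y' < x \<and> q < x - 1 \<or> e + 1 < z"
    proof (cases "y < x")
      case True
      have "x - 1 \<notin> {y..q}" using q(2) basic(2) by blast
      then have "q < x - 1" using True by auto
      moreover have "x - 1 \<notin> {q..<y'}" using qy(2) basic(2) by blast
      ultimately show ?thesis by auto
    qed (use z in auto)
    have qB: "q \<in> B" using q by auto
    note st = ht_left_step[OF fin z(1,2) q(1,2,5,6)]
    have fm: "first_max ?A ?B x"
    proof (rule first_maxI)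
      show "ht ?A ?B x = ht A B x" using st(2)[of x] far z(3) q(1) zy basic(1) by auto
      show "ht ?A ?B t \<le> ht A B x" for t using st(1)[of t] basic(10)[of t] basic(10)[of q] by (auto split: if_splits)
      show "ht ?A ?B t < ht A B x" if "t < x" for t
        using st(1)[of t] basic(11)[OF that] basic(11)[of q] far that q(1) zy basic(1) by (auto split: if_splits)
    qed
    have "q \<noteq> e" "y' \<noteq> e" using far q(1) zy qy basic(1) by auto
    have qout: "q \<notin> {x..<e}" using far q(1) zy by auto
    have xB: "insert e ?B = insert y' (B' - {q})" using \<open>q \<noteq> e\<close> by auto
    show ?thesis
    proof (rule disjoint_run[OF il Pz fA _ card_nxt[OF fin(1) z(1,2)] q(7) fm])
      show "{x..<e} \<subseteq> ?B" using basic(4) qout by blast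
      show "e \<notin> ?B" using basic(5) \<open>y' \<noteq> e\<close> by auto
      show "\<exists>k. run (cw A' B') (idx A' z) (cw (?A - {x}) (insert e ?B)) k"
        unfolding xA xB
      proof (rule run_cw_left_stepI[OF fin' zA' nz' zs' q(1)])
        show "{y..q} \<subseteq> B'" using q(2) by blast
        have "x \<notin> {y<..q}" using far zy basic(1) by auto
        then show "{y<..q} \<subseteq> A'" using q(3) by blast
        have "y - 1 \<noteq> e" using z(3) zy basic(1) by auto
        then show "y - 1 \<notin> B'" using q(4) by simp
        show "q + 1 \<notin> A'" using q(5) by simp
        show "nxt B' q y'" using qy \<open>y' \<noteq> e\<close> by (auto simp: nxt_def)
      qed
    qed (use fin in simp)
  qed
qed

text \<open>The run in \<open>B\<close> fills the gap at \<open>e\<close> and opens one at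
  \<open>z\<close>; this violates \<open>supported\<close> and continues in \<open>A\<close> from
  \<open>z + 1\<close> to \<open>e + 1\<close>. Heights are unchanged, so the next lowering removes
  \<open>x\<close> and adds \<open>z\<close>. In the lowered word the mark is \<open>z + 1\<close>
  in \<open>A'\<close>, and a single shift there gives the same result while \<open>B'\<close> stays
  fixed.\<close>

lemma right_inside:
  assumes z: "z \<in> B" "x \<le> z" "z < e" and zs: "supported A (B - {z})"
  shows "lowered_run A B (card A + idx B z) A' B'"
proof -
  let ?A = "insert (e + 1) (A - {z + 1})" and ?B = "insert e (B - {z})"
  have nz: "nxt B z e" using basic(1-7) z by (auto simp: nxt_def)
  have zA: "{z + 1..e} \<subseteq> A" using basic(3) z(2) by auto
  have z1: "z + 1 \<in> A" "z + 1 \<in> A'" using zA z by auto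
  have run1: "\<exists>k. run (cw A B) (card A + idx B z) (cw ?A ?B) k"
    by (rule run_cw_right_stepI[OF fin z(1) nz zs zA basic(6)])
  have nA: "nxt A (z + 1) (e + 1)" "nxt A' (z + 1) (e + 1)" using zA basic(6) z by (auto simp: nxt_def)
  have fm: "first_max ?A ?B x"
    using basic(8) ht_right_step[OF fin z(1) nz zA basic(6)] by (simp add: first_max_def)
  have lw: "lower ?A ?B x z"
  proof -
    have "{x..<z} \<subseteq> ?B" using basic(4) z by (force simp: subset_iff)
    then show ?thesis using fm z by (simp add: lower_def)
  qed
  have fAB: "finite ?A" "finite ?B" using fin by auto
  have sup1: "supported ?A ?B"
    by (rule run_supported[OF run1]) (use fin idx_less[OF fin(2) z(1)] in \<open>auto simp: length_cw\<close>)
  have eqs: "?A - {x} = insert (e + 1) (A' - {z + 1})" "insert z ?B = B'" using z basic(1-7) by auto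
  have "supported (?A - {x}) (insert z ?B)" by (rule lower_block(6)[OF fAB sup1 lw])
  then have sup2: "supported (insert (e + 1) (A' - {z + 1})) B'" unfolding eqs .
  show ?thesis
  proof (rule lowered_runI[OF _ _ fAB card_nxt[OF fin(1) z1(1) nA(1)] lw run1 eqs(1)[symmetric] eqs(2)[symmetric]])
    show "idx A' (z + 1) < length (cw A' B')" using idx_less[OF fin'(1) z1(2)] by (simp add: length_cw)
    show "\<exists>k. run (cw A' B') (idx A' (z + 1)) (cw (insert (e + 1) (A' - {z + 1})) B') k"
      by (rule run_cw_left_stop[OF fin' z1(2) nA(2) sup2])
    \<comment> \<open>The block relation is used twice: on \<open>{z + 1..e}\<close> to move the
      deletion into the first factor, and on \<open>{x..z}\<close> to carry out the
      lowering.\<close>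
    have "P (cw A (B - {z})) = P (cw (A - {z + 1}) ?B)"
      by (rule P_cw_block) (use fin z zA basic(1-7) in auto)
    also have "\<dots> = P (cw (A - {z + 1} - {x}) (insert z ?B))"
      by (rule P_cw_block) (use fin z zA basic(1-7) in auto)
    also have "A - {z + 1} - {x} = A' - {z + 1}" by auto
    finally show "P (del (idx A' (z + 1)) (cw A' B')) = P (del (card A + idx B z) (cw A B))"
      unfolding eqs del_cw_right[OF fin(2) z(1)] del_cw_left[OF fin'(1) z1(2)] by simp
  qed
qed

lemma right_outside:
  assumes z: "z \<in> B" "nxt B z y" "y < x - 1 \<or> e < z" and zs: "supported A (B - {z})"
  shows "lowered_run A B (card A + idx B z) A' B'"
proof -
  let ?B = "insert y (B - {z})"
  have zy: "z < y" "{z..<y} \<subseteq> B" "y \<notin> B" using z by (auto simp: nxt_def)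
  have zout: "z \<notin> {x..e}" using z zy by auto
  have zB': "z \<in> B'" using z by auto
  have "y \<noteq> e" using z(3) zy basic(1) by auto
  then have nz': "nxt B' z y" using zy by (auto simp: nxt_def)
  have zs': "supported A' (B' - {z})" by (rule supported_right[OF z(1) zout zs])
  have il: "card A + idx B z < length (cw A B)" "card A' + idx B' z < length (cw A' B')"
    using idx_less[OF fin(2) z(1)] idx_less[OF fin'(2) zB'] by (auto simp: length_cw)
  have Pz: "P (del (card A' + idx B' z) (cw A' B')) = P (del (card A + idx B z) (cw A B))"
    using del_cw_right[OF fin(2) z(1)] del_cw_right[OF fin'(2) zB'] block_right[OF z(1) zout] by simp
  have "z \<noteq> e" using z zy basic(1) by auto
  then have xB: "insert e ?B = insert y (B' - {z})" by auto
  have fB: "finite ?B" using fin by simp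
  have sB: "{x..<e} \<subseteq> ?B" using basic(4) zout by (auto simp: subset_iff)
  have eB: "e \<notin> ?B" using basic(5) \<open>y \<noteq> e\<close> by auto
  show ?thesis
  proof (cases "supported A ?B")
    case True
    have bnd: "ht A ?B t \<le> (if z < t \<and> t \<le> y then max (ht A B z) (if y + 1 \<in> A then ht A B (y + 1) else ht A B z) else ht A B t)" for t
      by (rule ht_right_stop[OF fin z(1,2) True])
    have fm: "first_max A ?B x"
    proof (rule first_maxI)
      show "ht A ?B x = ht A B x" using ht_shift_right[OF fin(2) z(1,2), of A x] z(3) zy basic(1) by auto
      show "ht A ?B t \<le> ht A B x" for t
        using bnd[of t] basic(10)[of t] basic(10)[of z] basic(10)[of "y + 1"] by (auto split: if_splits)
      show "ht A ?B t < ht A B x" if "t < x" for t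
        using bnd[of t] basic(11)[OF that] basic(11)[of z] basic(11)[of "y + 1"] z(3) zy basic(1) that
        by (auto split: if_splits)
    qed
    show ?thesis
      by (rule disjoint_run[OF il Pz fin(1) fB refl run_cw_right_stop[OF fin z(1,2) True] fm sB eB])
        (unfold xB, rule run_cw_right_stop[OF fin' zB' nz'])
  next
    case False
    note st = run_cw_right_step[OF fin z(1,2) zs False]
    let ?A = "insert (y + 1) (A - {z + 1})"
    have fm: "first_max ?A ?B x"
      using basic(8) ht_right_step[OF fin z(1,2) st(1,2)] by (simp add: first_max_def)
    have nA: "z + 1 \<in> A" "nxt A (z + 1) (y + 1)" using st zy by (auto simp: nxt_def)
    have xA: "?A - {x} = insert (y + 1) (A' - {z + 1})" using z(3) zy basic(1) by auto
    show ?thesis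
    proof (rule disjoint_run[OF il Pz _ fB card_nxt[OF fin(1) nA] st(3) fm sB eB])
      show "\<exists>k. run (cw A' B') (card A' + idx B' z) (cw (?A - {x}) (insert e ?B)) k"
        unfolding xA xB
      proof (rule run_cw_right_stepI[OF fin' zB' nz' zs'])
        have "x \<notin> {z + 1..y}" using z(3) basic(1) by auto
        then show "{z + 1..y} \<subseteq> A'" using st(1) by blast
        show "y + 1 \<notin> A'" using st(2) by simp
      qed
    qed (use fin in simp)
  qed
qed

text \<open>The shifted run in \<open>B\<close> touches the block: the raised heights reach the
  maximum, so the next lowering starts at \<open>z + 1\<close> instead of \<open>x\<close>. In the
  lowered word \<open>x\<close> is a gap of the first factor; there the shift violates
  \<open>supported\<close>, and the run continues from \<open>z + 1\<close> to
  \<open>x\<close>.\<close>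

lemma right_adjacent:
  assumes z: "z \<in> B" "nxt B z (x - 1)" and zs: "supported A (B - {z})"
  shows "lowered_run A B (card A + idx B z) A' B'"
proof -
  let ?B = "insert (x - 1) (B - {z})"
  have zy: "z < x - 1" "{z..<x - 1} \<subseteq> B" using z by (auto simp: nxt_def)
  have supB: "supported A ?B" using run_cw_right_step(2)[OF fin z zs] basic(7) by auto
  have hx: "ht A B (x - 1) = ht A B x - 1" using ht_step[OF fin, of x] basic(2,7) by simp
  have hx1: "ht A ?B (x - 1) = ht A B x"
    using ht_shift_right[OF fin(2) z, of A "x - 1"] zy hx by simp
  \<comment> \<open>The shift raises the height at \<open>x - 1\<close> to the maximum; without
    \<open>z + 1\<close> in \<open>A\<close> it would be bounded by the height at \<open>z\<close>,
    which is smaller.\<close>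
  have z1: "z + 1 \<in> A"
  proof (rule ccontr)
    assume "z + 1 \<notin> A"
    then have "ht A ?B (x - 1) \<le> ht A B z" using ht_right_shift_le[OF fin z, of "x - 1"] zy by simp
    then show False using hx1 basic(11)[of z] zy by simp
  qed
  note st = ht_right_shift_supported[OF fin z z1 supB, simplified]
  have fm: "first_max A ?B (z + 1)"
  proof (rule first_maxI)
    show "ht A ?B (z + 1) = ht A B x" using st(2)[of "z + 1"] zy by simp
    show "ht A ?B t \<le> ht A B x" for t
      using st(2)[of t] ht_shift_right[OF fin(2) z, of A t] basic(10)[of t] by (auto split: if_splits)
    show "ht A ?B t < ht A B x" if "t < z + 1" for t
      using ht_shift_right[OF fin(2) z, of A t] basic(11)[of t] that zy by auto
  qed
  have lw: "lower A ?B (z + 1) e"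
  proof -
    have "{z + 1..<e} \<subseteq> {z + 1..x - 1} \<union> ({x..<e} - {z})" using zy by auto
    moreover have "{z + 1..x - 1} \<subseteq> ?B" by (rule nxt_shifted[OF z(2)])
    moreover have "{x..<e} - {z} \<subseteq> ?B" using basic(4) by blast
    ultimately have "{z + 1..<e} \<subseteq> ?B" by blast
    moreover have "e \<notin> ?B" using basic(1,5) by auto
    ultimately show ?thesis using fm zy basic(1) by (simp add: lower_def)
  qed
  have zout: "z \<notin> {x..e}" using zy by auto
  have zB': "z \<in> B'" using z by auto
  have nz': "nxt B' z (x - 1)" using z(2) basic(1) by (auto simp: nxt_def)
  have "\<exists>k. run (cw A' B') (card A' + idx B' z) (cw (insert (x - 1 + 1) (A' - {z + 1})) (insert (x - 1) (B' - {z}))) k"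
  proof (rule run_cw_right_stepI[OF fin' zB' nz' supported_right[OF z(1) zout zs]])
    show "{z + 1..x - 1} \<subseteq> A'" using st(1) by (force simp: subset_iff)
  qed simp
  moreover have "insert (x - 1 + 1) (A' - {z + 1}) = A - {z + 1}" using basic(7) zy by auto
  moreover have "insert (x - 1) (B' - {z}) = insert e ?B" using zy basic(1) by auto
  ultimately have run2: "\<exists>k. run (cw A' B') (card A' + idx B' z) (cw (A - {z + 1}) (insert e ?B)) k" by simp
  show ?thesis
  proof (rule lowered_runI[OF _ _ fin(1) _ refl lw run_cw_right_stop[OF fin z supB] refl refl run2])
    show "card A' + idx B' z < length (cw A' B')" using idx_less[OF fin'(2) zB'] by (simp add: length_cw)
    show "P (del (card A' + idx B' z) (cw A' B')) = P (del (card A + idx B z) (cw A B))"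
      using del_cw_right[OF fin(2) z(1)] del_cw_right[OF fin'(2) zB'] block_right[OF z(1) zout] by simp
  qed (use fin in simp)
qed

lemma lowered_run_left:
  assumes "z \<in> A" "supported (A - {z}) B"
  shows "lowered_run A B (idx A z) A' B'"
proof -
  obtain y where y: "nxt A z y" using nxt_exists[OF fin(1) assms(1)] .
  consider "z \<le> x" "{z..x} \<subseteq> A" | "z < x" "\<not> {z..x} \<subseteq> A" | "x < z" "z \<le> e" | "e < z"
    using basic(1) assms(1) by (cases z x rule: linorder_cases; cases "z \<le> e") auto
  then show ?thesis
  proof cases
    case 1
    then show ?thesis using left_through_block assms by blast
  next
    case 2
    then obtain u where "nxt A z u" "u \<le> x" using interval_exit assms(1) by blast
    moreover have "u \<noteq> x" using calculation basic(7) by (auto simp: nxt_def)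
    ultimately show ?thesis using left_outside[OF assms(1)] assms(2) by auto
  next
    case 3
    \<comment> \<open>A mark at a block letter of \<open>A\<close> above \<open>x\<close> is
      impossible: \<open>supported_interval\<close> for \<open>A - {z}\<close> would put
      \<open>z\<close> into \<open>A - {z}\<close>.\<close>
    have "{x..<z} \<subseteq> B" using basic(4) 3 by auto
    then have "{x..z} \<subseteq> A - {z}"
      using supported_interval[OF assms(2), of x z] basic(2,7) 3 by auto
    moreover have "z \<in> {x..z}" using 3 by simp
    ultimately show ?thesis by blast
  next
    case 4
    then have "e + 1 < z" using assms(1) basic(6) by (cases "z = e + 1") auto
    then show ?thesis using left_outside[OF assms(1) y] assms(2) by blast
  qed
qed

lemma lowered_run_right:
  assumes "z \<in> B" "supported A (B - {z})"
  shows "lowered_run A B (card A + idx B z) A' B'"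
proof -
  obtain y where y: "nxt B z y" using nxt_exists[OF fin(2) assms(1)] .
  consider "z < x" | "x \<le> z" "z < e" | "e < z"
    using assms(1) basic(5) by (cases z e rule: linorder_cases) force+
  then show ?thesis
  proof cases
    case 1
    have "x - 1 \<notin> {z..<y}" using y basic(2) unfolding nxt_def by blast
    then have "y < x - 1 \<or> y = x - 1" using 1 by auto
    then show ?thesis using right_outside[OF assms(1) y] right_adjacent[OF assms(1)] y assms(2) by blast
  next
    case 2
    then show ?thesis using right_inside assms by blast
  next
    case 3
    then show ?thesis using right_outside[OF assms(1) y] assms(2) by blast
  qed
qed

end

section \<open>Relations closed under bumps\<close>

text \<open>The parameter \<open>p\<close> records the length of the first factor, since a list does
  not show where the factors meet; the bumped window can then be cut at the same place.\<close>

definition lowered_words :: "nat \<Rightarrow> int list \<Rightarrow> int list \<Rightarrow> bool" where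
  "lowered_words p M M' \<longleftrightarrow> (\<exists>A B x y. finite A \<and> finite B \<and> supported A B \<and> lower A B x y \<and>
     card A = p \<and> M = cw A B \<and> M' = cw (A - {x}) (insert y B))"

text \<open>A diagonal relation: it expresses an invariant of single words in the form required by
  \<open>bump_closed\<close>.\<close>

definition top_words :: "nat \<Rightarrow> int list \<Rightarrow> int list \<Rightarrow> bool" where
  "top_words p M M' \<longleftrightarrow> (\<exists>A B. finite A \<and> finite B \<and> supported A B \<and> (\<forall>t. ht A B t \<le> 0) \<and>
     card A = p \<and> M = cw A B \<and> M' = M)"

lemma lowered_wordsI:
  "finite A \<Longrightarrow> finite B \<Longrightarrow> supported A B \<Longrightarrow> lower A B x y \<Longrightarrow> card A = p
    \<Longrightarrow> lowered_words p (cw A B) (cw (A - {x}) (insert y B))"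
  unfolding lowered_words_def by blast

lemma cw_mark_cases:
  assumes "finite A" "finite B" "i < length (cw A B)" "reduced (del i (cw A B))"
  obtains z where "z \<in> A" "i = idx A z" "supported (A - {z}) B"
    | z where "z \<in> B" "i = card A + idx B z" "supported A (B - {z})"
proof (cases "i < card A")
  case True
  then obtain z where z: "z \<in> A" "i = idx A z" using sl_index_obtain assms by blast
  then have "supported (A - {z}) B" using assms del_cw_left[of A z B] by (simp add: reduced_cw)
  then show ?thesis using that(1) z by blast
next
  case False
  then have "i - card A < card B" using assms by (simp add: length_cw)
  then obtain z where z: "z \<in> B" "i - card A = idx B z" using sl_index_obtain assms by blast
  then have i: "i = card A + idx B z" using False by simp
  then have "supported A (B - {z})" using assms del_cw_right[of B z A] z by (simp add: reduced_cw)
  then show ?thesis using that(2) z i by blast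
qed

lemma lowered_words_closed: "bump_closed (lowered_words p)"
  unfolding bump_closed_def
proof (intro conjI allI impI)
  fix M M' assume "lowered_words p M M'"
  then obtain A B x y where M: "finite A" "finite B" "supported A B" "lower A B x y"
    "M = cw A B" "M' = cw (A - {x}) (insert y B)" unfolding lowered_words_def by blast
  interpret lowering A B x y by unfold_locales (use M in auto)
  note block = lower_block[OF M(1-4)]
  show "reduced M" "reduced M'" "P M = P M'" using M block by (simp_all add: reduced_cw)
  show "length M = length M'" using card' M by (simp add: length_cw)
next
  fix M M' i i' assume E: "lowered_words p M M'" and i: "i < length M" "i' < length M'" "reduced (del i M)"
    "P (del i M) = P (del i' M')"
  obtain A B x y where M: "finite A" "finite B" "supported A B" "lower A B x y" "card A = p"
    "M = cw A B" "M' = cw (A - {x}) (insert y B)" using E unfolding lowered_words_def by blast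
  interpret lowering A B x y by unfold_locales (use M in auto)
  have "lowered_run A B i (A - {x}) (insert y B)"
    by (rule cw_mark_cases[of A B i]) (use M i lowered_run_left lowered_run_right in auto)
  then obtain i0 A1 B1 x1 y1 where 1: "i0 < length M'" "P (del i0 M') = P (del i M)" "finite A1" "finite B1"
    "card A1 = card A" "lower A1 B1 x1 y1" "\<exists>k. run M i (cw A1 B1) k"
    "\<exists>k. run M' i0 (cw (A1 - {x1}) (insert y1 B1)) k"
    unfolding lowered_run_def M by blast
  have "reduced M'" using M lower_block(6)[OF M(1-4)] by (simp add: reduced_cw)
  \<comment> \<open>The case analysis supplies some mark \<open>i0\<close> of \<open>M'\<close>; by
    uniqueness in a reduced word it is the prescribed \<open>i'\<close>.\<close>
  then have "i0 = i'" using reduced_mark_unique[of M' i0 i'] 1 i by simp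
  moreover have "supported A1 B1" using run_supported[of A B i A1 B1] 1 i M by simp
  ultimately show "\<exists>N k N' k'. run M i N k \<and> run M' i' N' k' \<and> lowered_words p N N'"
    using 1 M lowered_wordsI[of A1 B1 x1 y1 p] by metis
qed

lemma top_words_closed: "bump_closed (top_words p)"
  unfolding bump_closed_def
proof (intro conjI allI impI)
  fix M M' assume "top_words p M M'"
  then show "reduced M" "reduced M'" "P M = P M'" "length M = length M'"
    unfolding top_words_def using reduced_cw by blast+
next
  fix M M' i i' assume E: "top_words p M M'" and i: "i < length M" "i' < length M'" "reduced (del i M)"
    "P (del i M) = P (del i' M')"
  obtain A B where M: "finite A" "finite B" "supported A B" "\<forall>t. ht A B t \<le> 0" "card A = p"
    "M = cw A B" "M' = cw A B" using E unfolding top_words_def by blast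
  have "reduced M" using M by (simp add: reduced_cw)
  then have ii: "i' = i" using reduced_mark_unique[of M i i'] i M by simp
  have il: "i < length (cw A B)" "reduced (del i (cw A B))" using i M by auto
  have "\<exists>A1 B1. finite A1 \<and> finite B1 \<and> card A1 = p \<and> (\<forall>t. ht A1 B1 t \<le> 0) \<and> (\<exists>k. run (cw A B) i (cw A1 B1) k)"
    using M(1,2) il
  proof (cases rule: cw_mark_cases)
    case (1 z)
    obtain y where y: "nxt A z y" using nxt_exists[OF M(1) 1(1)] .
    let ?A = "insert y (A - {z})"
    have cA: "finite ?A" "card ?A = p" using card_nxt[OF M(1) 1(1) y] M by auto
    show ?thesis
    proof (cases "supported ?A B")
      case True
      have "ht ?A B t \<le> 0" for t
        using ht_shift_left[OF M(1) 1(1) y, of B t] M(4)[rule_format, of t] by simp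
      then show ?thesis using run_cw_left_stop[OF M(1,2) 1(1) y True] cA M(2) 1(2) by blast
    next
      case False
      from run_cw_left_step[OF M(1,2) 1(1) y 1(3) this] obtain q y' where
        q: "y \<le> q" "{y..q} \<subseteq> B" "q + 1 \<notin> A" "nxt B q y'"
          "\<exists>k. run (cw A B) (idx A z) (cw ?A (insert y' (B - {q}))) k" by metis
      have "ht ?A (insert y' (B - {q})) t \<le> 0" for t
        using ht_left_step(1)[OF M(1,2) 1(1) y q(1-4), of t] M(4)[rule_format, of t] M(4)[rule_format, of q]
        by (auto split: if_splits)
      then show ?thesis using q(5) cA M(2) 1(2) by (metis finite_Diff finite_insert)
    qed
  next
    case (2 z)
    obtain y where y: "nxt B z y" using nxt_exists[OF M(2) 2(1)] .
    let ?B = "insert y (B - {z})"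
    have fB: "finite ?B" using M by simp
    show ?thesis
    proof (cases "supported A ?B")
      case True
      have "ht A ?B t \<le> 0" for t
        using ht_right_stop[OF M(1,2) 2(1) y True, of t] M(4)[rule_format, of z] M(4)[rule_format, of t]
          M(4)[rule_format, of "y + 1"] by (auto split: if_splits)
      then show ?thesis using run_cw_right_stop[OF M(1,2) 2(1) y True] fB M(1,5) 2(2) by blast
    next
      case False
      note st = run_cw_right_step[OF M(1,2) 2(1) y 2(3) False]
      let ?A = "insert (y + 1) (A - {z + 1})"
      have "z + 1 \<in> A" "nxt A (z + 1) (y + 1)" using st y by (auto simp: nxt_def)
      then have "finite ?A" "card ?A = p" using card_nxt[OF M(1)] M by auto
      moreover have "ht ?A ?B t \<le> 0" for t
        using ht_right_step[OF M(1,2) 2(1) y st(1,2)] M(4) by simp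
      ultimately show ?thesis using st(3) fB 2(2) by blast
    qed
  qed
  then obtain A1 B1 k where 1: "finite A1" "finite B1" "card A1 = p" "\<forall>t. ht A1 B1 t \<le> 0" "run (cw A B) i (cw A1 B1) k"
    by blast
  have "supported A1 B1" using run_supported[of A B i A1 B1] 1 il by blast
  then have "top_words p (cw A1 B1) (cw A1 B1)" using 1 unfolding top_words_def by blast
  then show "\<exists>N k N' k'. run M i N k \<and> run M' i' N' k' \<and> top_words p N N'"
    using 1(5) M ii by metis
qed

section \<open>Ascents and descents\<close>

definition increasing_word :: "int list \<Rightarrow> int list \<Rightarrow> bool" where
  "increasing_word M M' \<longleftrightarrow> sorted_wrt (<) M \<and> M' = M"

lemma increasing_word_closed: "bump_closed increasing_word"
  unfolding bump_closed_def
proof (intro conjI allI impI)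
  fix M M' i i' assume E: "increasing_word M M'" and i: "i < length M" "i' < length M'" "reduced (del i M)"
    "P (del i M) = P (del i' M')"
  have M: "M' = M" "sorted_wrt (<) M" "reduced M" using E reduced_increasing by (auto simp: increasing_word_def)
  have ii: "i' = i" using reduced_mark_unique[of M i i'] i M by simp
  have sl: "sl (set M) = M" by (rule sl_set[OF M(2)])
  have "i < card (set M)" using i(1) sl by (metis length_sorted_list_of_set)
  then obtain z where z: "z \<in> set M" "i = idx (set M) z" using sl_index_obtain by blast
  obtain y where y: "nxt (set M) z y" using nxt_exists z by blast
  obtain k where "run M i (sl (insert y (set M - {z}))) k" using run_sl[OF _ z(1) y] z(2) sl by auto
  then show "\<exists>N k N' k'. run M i N k \<and> run M' i' N' k' \<and> increasing_word N N'"
    unfolding increasing_word_def ii M(1) using sorted_sl by blast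
qed (auto simp: increasing_word_def reduced_increasing)

definition descent_word :: "int list \<Rightarrow> int list \<Rightarrow> bool" where
  "descent_word M M' \<longleftrightarrow> (\<exists>x y. y < x \<and> M = [x, y] \<and> M' = M)"

lemma reduced_descent: "y < x \<Longrightarrow> reduced [x, y]"
  using reduced_snoc[of "[x]" y] reduced_snoc[of "[]" x] by (auto simp: sT_def)

lemma descent_word_closed: "bump_closed descent_word"
  unfolding bump_closed_def
proof (intro conjI allI impI)
  fix M M' i i' assume E: "descent_word M M'" and i: "i < length M" "i' < length M'" "reduced (del i M)"
    "P (del i M) = P (del i' M')"
  obtain x y where M: "y < x" "M = [x, y]" "M' = M" using E by (auto simp: descent_word_def)
  have ii: "i' = i" using reduced_mark_unique[of M i i'] i M reduced_descent by simp
  have "\<exists>x' y' k. y' < x' \<and> run M i [x', y'] k"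
  proof (cases "i = 0")
    case True
    have "run M i [x + 1, y] 0" unfolding M True by (rule run_stop) (use M reduced_descent in \<open>auto simp: inc_def\<close>)
    moreover have "y < x + 1" using M(1) by simp
    ultimately show ?thesis by blast
  next
    case False
    then have i1: "i = 1" using i M by simp
    have inc: "inc [x, y] 1 = [x, y + 1]" by (simp add: inc_def)
    show ?thesis
    proof (cases "y + 1 = x")
      case True
      \<comment> \<open>The increment has made both letters equal, so the other mark is the first
        letter.\<close>
      have "run [x, x] 0 [x + 1, x] 0" by (rule run_stop) (use reduced_descent in \<open>auto simp: inc_def\<close>)
      then have "run [x, y] 1 [x + 1, x] 0"
        using two_marks_unreduced[of x "[]" x] inc True
        by (intro run.step[of "[x, y]" 1 0]) (auto simp: del_def)
      moreover have "x < x + 1" by simp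
      ultimately show ?thesis unfolding M(2) i1 by blast
    next
      case False
      then have "run [x, y] 1 [x, y + 1] 1" using M reduced_descent inc by (intro run_stop) auto
      then show ?thesis using M i1 False by (metis order_le_less zless_imp_add1_zle)
    qed
  qed
  then show "\<exists>N k N' k'. run M i N k \<and> run M' i' N' k' \<and> descent_word N N'"
    using M ii unfolding descent_word_def by metis
qed (auto simp: descent_word_def reduced_descent)

text \<open>By reducedness adjacent letters differ, so a two-letter window is an ascent or a
  descent. Both kinds are closed under bumps, which gives the two directions.\<close>

lemma bump_ascent_iff:
  assumes "reduced w" "Suc j < length w"
  shows "bump \<pi> w ! j < bump \<pi> w ! Suc j \<longleftrightarrow> w ! j < w ! Suc j"
proof -
  let ?L = "take j w" and ?M = "[w ! j, w ! Suc j]" and ?R = "drop (Suc (Suc j)) w"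
  have w: "w = ?L @ ?M @ ?R"
    using assms(2) by (simp add: Cons_nth_drop_Suc)
  have len: "length ?L = j" using assms(2) by simp
  have red: "reduced (?L @ ?M @ ?R)" using assms(1) w by simp
  have neq: "w ! j \<noteq> w ! Suc j"
  proof
    assume "w ! j = w ! Suc j"
    then have "\<not> reduced ?M" using two_marks_unreduced[of "w ! j" "[]" "w ! Suc j"] by simp
    then show False using reduced_windowD red by blast
  qed
  have nths: "(L1 @ N @ R1) ! j = N ! 0 \<and> (L1 @ N @ R1) ! Suc j = N ! 1" if "length L1 = j" "length N = 2"
    for L1 N R1 :: "int list" using that by (auto simp: nth_append)
  show ?thesis
  proof (cases "w ! j < w ! Suc j")
    case True
    then have "increasing_word ?M ?M" by (simp add: increasing_word_def)
    then obtain L1 N N' R1 where "bump \<pi> (?L @ ?M @ ?R) = L1 @ N @ R1" "increasing_word N N'"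
      "length L1 = length ?L" "length N = length ?M"
      using bump_related_windows[OF increasing_word_closed _ red] by metis
    then show ?thesis using nths[of L1 N R1] True len w[symmetric]
      by (auto simp: increasing_word_def sorted_wrt_iff_nth_less)
  next
    case False
    then have "descent_word ?M ?M" using neq by (simp add: descent_word_def)
    then obtain L1 N N' R1 where "bump \<pi> (?L @ ?M @ ?R) = L1 @ N @ R1" "descent_word N N'"
      "length L1 = length ?L" "length N = length ?M"
      using bump_related_windows[OF descent_word_closed _ red] by metis
    then show ?thesis using nths[of L1 N R1] False len w[symmetric] by (auto simp: descent_word_def)
  qed
qed

text \<open>Removing a matched pair of brackets changes the height only strictly between them,
  where the height without the pair is constant.\<close>

lemma ht_remove_pair:
  assumes "finite A" "finite Y" "x0 \<in> A" "y \<notin> Y" "y < x0"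
  shows "ht A (insert y Y) t = ht (A - {x0}) Y t - (if y < t \<and> t < x0 then 1 else 0)"
  using ht_insert_right[OF assms(2,4), of A t] ht_remove_left[OF assms(1,3), of Y t] assms(5) by auto

lemma ht_const:
  assumes "finite A" "finite Y" "\<And>v. v \<in> Y \<Longrightarrow> v < y" "y \<le> t" "A \<inter> {y<..t} = {}"
  shows "ht A Y t = ht A Y y"
  using assms(4,5)
proof (induction t rule: int_ge_induct)
  case (step t)
  then have "A \<inter> {y<..t} = {}" "t + 1 \<notin> A" by auto
  moreover have "t \<notin> Y" using assms(3) step by force
  ultimately show ?case using step ht_step'[OF assms(1,2), of t] by simp
qed simp

section \<open>Unpaired letters as records of the height\<close>

lemma snd_pair_aux: "snd ` set (pair_aux A ys) \<subseteq> set ys"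
proof (induction ys arbitrary: A)
  case (Cons y ys)
  show ?case
    using Cons.IH[of A] Cons.IH[of "remove1 (Min {x \<in> set A. y < x}) A"] by (auto simp: Let_def)
qed simp

text \<open>The largest \<open>y\<close> is processed first. If nothing in \<open>A\<close> exceeds
  it, it stays unpaired and lowers the height behind it, where the height was constant. Otherwise
  removing the pair \<open>(x0, y)\<close> affects the height only strictly between the two, where
  the remaining height is constant; records at other letters are unaffected, and neither partner is
  one. Thus the unpaired letters are the strict records of the height, seen from the left for
  \<open>A\<close> and from the right for \<open>ys\<close>.\<close>

lemma pair_aux_unpaired:
  assumes "distinct A" "sorted_wrt (>) ys"
  shows "(\<forall>x\<in>set A. x \<notin> fst ` set (pair_aux A ys) \<longleftrightarrow> (\<forall>s<x. ht (set A) (set ys) s < ht (set A) (set ys) x)) \<and>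
    (\<forall>y\<in>set ys. y \<notin> snd ` set (pair_aux A ys) \<longleftrightarrow> (\<forall>t>y. ht (set A) (set ys) t < ht (set A) (set ys) y))"
  using assms
proof (induction A ys rule: pair_aux.induct)
  case (1 A)
  have "ht (set A) {} s < ht (set A) {} x" if "x \<in> set A" "s < x" for x s
  proof -
    have "{a \<in> set A. a \<le> s} \<subseteq> {a \<in> set A. a \<le> x}" "x \<in> {a \<in> set A. a \<le> x}" "x \<notin> {a \<in> set A. a \<le> s}"
      using that by auto
    then have "{a \<in> set A. a \<le> s} \<subset> {a \<in> set A. a \<le> x}" by blast
    then have "card {a \<in> set A. a \<le> s} < card {a \<in> set A. a \<le> x}" by (intro psubset_card_mono) auto
    then show ?thesis by (simp add: ht_def)
  qed
  then show ?case by auto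
next
  case (2 A y ys)
  have ys: "\<And>v. v \<in> set ys \<Longrightarrow> v < y" "sorted_wrt (>) ys" using 2 by auto
  have yY: "y \<notin> set ys" using ys(1) by blast
  define H where "H = ht (set A) (set (y # ys))"
  show ?case
  proof (cases "{x \<in> set A. y < x} = {}")
    case True
    define H' where "H' = ht (set A) (set ys)"
    have pa: "pair_aux A (y # ys) = pair_aux A ys" using True by (simp only: pair_aux.simps if_True simp_thms)
    have HH: "H t = H' t - (if y < t then 1 else 0)" for t
      using ht_insert_right[of "set ys" y "set A" t] yY by (simp add: H_def H'_def)
    have const: "H' t = H' y" if "y \<le> t" for t
      unfolding H'_def by (rule ht_const[OF _ _ ys(1) that]) (use True in auto)
    note IH = 2(1)[OF True 2(3) ys(2), folded H'_def]
    have y: "y \<notin> snd ` set (pair_aux A ys)" using snd_pair_aux[of A ys] yY by blast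
    have yy: "H t < H y" if "y < t" for t using HH[of t] HH[of y] const[of t] that by simp
    have left: "(\<forall>s<x. H s < H x) \<longleftrightarrow> (\<forall>s<x. H' s < H' x)" if "x \<in> set A" for x
    proof -
      have "x \<le> y" using True that by force
      then show ?thesis using HH by auto
    qed
    have right: "(\<forall>t>v. H t < H v) \<longleftrightarrow> (\<forall>t>v. H' t < H' v)" if "v \<in> set ys" for v
    proof -
      have "v < y" using ys(1) that .
      then have Hv: "H v = H' v" "H y = H' y" using HH[of v] HH[of y] by auto
      show ?thesis
      proof (intro iffI allI impI)
        fix t assume *: "\<forall>t>v. H t < H v" "v < t"
        show "H' t < H' v"
        proof (cases "y < t")
          case True
          then show ?thesis using const[of t] *(1)[rule_format, of y] Hv \<open>v < y\<close> by simp
        next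
          case False
          then show ?thesis using HH[of t] *(1)[rule_format, of t] *(2) Hv by (auto split: if_splits)
        qed
      next
        fix t assume *: "\<forall>t>v. H' t < H' v" "v < t"
        have "H t \<le> H' t" using HH[of t] by simp
        then show "H t < H v" using *(1)[rule_format, OF *(2)] Hv by linarith
      qed
    qed
    show ?thesis unfolding pa H_def[symmetric] using IH y yy left right by (auto simp del: pair_aux.simps)
  next
    case False
    define x0 where "x0 = Min {x \<in> set A. y < x}"
    have "x0 \<in> {x \<in> set A. y < x}" unfolding x0_def using False by (intro Min_in) auto
    then have x0: "x0 \<in> set A" "y < x0" by auto
    have x0min: "x0 \<le> x" if "x \<in> set A" "y < x" for x unfolding x0_def using that by (intro Min_le) auto
    define H' where "H' = ht (set A - {x0}) (set ys)"
    have pa: "pair_aux A (y # ys) = (x0, y) # pair_aux (remove1 x0 A) ys"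
      using False by (simp only: pair_aux.simps if_False Let_def x0_def)
    have HH: "H t = H' t - (if y < t \<and> t < x0 then 1 else 0)" for t
      using ht_remove_pair[of "set A" "set ys" x0 y t] yY x0 by (simp add: H_def H'_def)
    have const: "H' t = H' y" if "y \<le> t" "t \<le> x0" for t
      unfolding H'_def by (rule ht_const[OF _ _ ys(1) that(1)]) (use x0min that in force)+
    have "distinct (remove1 x0 A)" "set (remove1 x0 A) = set A - {x0}" using 2(3) by auto
    then have IH: "(\<forall>x\<in>set A - {x0}. x \<notin> fst ` set (pair_aux (remove1 x0 A) ys) \<longleftrightarrow> (\<forall>s<x. H' s < H' x)) \<and>
      (\<forall>y\<in>set ys. y \<notin> snd ` set (pair_aux (remove1 x0 A) ys) \<longleftrightarrow> (\<forall>t>y. H' t < H' y))"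
      using 2(2)[OF False x0_def _ ys(2)] unfolding H'_def by simp
    have Hle: "H t \<le> H' t" for t using HH[of t] by simp
    have Hy: "H y = H' y" "H x0 = H' y" using HH[of y] HH[of x0] const[of x0] x0 by auto
    have left: "(\<forall>s<x. H s < H x) \<longleftrightarrow> (\<forall>s<x. H' s < H' x)" if "x \<in> set A - {x0}" for x
    proof -
      have x: "x \<le> y \<or> x0 < x" using x0min[of x] that by force
      then have Hx: "H x = H' x" using HH[of x] by auto
      show ?thesis
      proof (intro iffI allI impI)
        fix s assume *: "\<forall>s<x. H s < H x" "s < x"
        show "H' s < H' x"
        proof (cases "y < s \<and> s < x0")
          case True
          then show ?thesis using const[of s] *(1)[rule_format, of y] *(2) Hy Hx by simp
        next
          case False
          then show ?thesis using HH[of s] *(1)[rule_format, of s] *(2) Hx by (auto split: if_splits)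
        qed
      next
        fix s assume *: "\<forall>s<x. H' s < H' x" "s < x"
        show "H s < H x" using Hle[of s] *(1)[rule_format, OF *(2)] Hx by linarith
      qed
    qed
    have right: "(\<forall>t>v. H t < H v) \<longleftrightarrow> (\<forall>t>v. H' t < H' v)" if "v \<in> set ys" for v
    proof -
      have "v < y" using ys(1) that .
      then have Hv: "H v = H' v" using HH[of v] by auto
      show ?thesis
      proof (intro iffI allI impI)
        fix t assume *: "\<forall>t>v. H t < H v" "v < t"
        show "H' t < H' v"
        proof (cases "y < t \<and> t < x0")
          case True
          then show ?thesis using const[of t] *(1)[rule_format, of y] Hv Hy \<open>v < y\<close> by simp
        next
          case False
          then show ?thesis using HH[of t] *(1)[rule_format, of t] *(2) Hv by (auto split: if_splits)
        qed
      next
        fix t assume *: "\<forall>t>v. H' t < H' v" "v < t"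
        show "H t < H v" using Hle[of t] *(1)[rule_format, OF *(2)] Hv by linarith
      qed
    qed
    have nx: "\<not> (\<forall>s<x0. H s < H x0)" and ny: "\<not> (\<forall>t>y. H t < H y)"
      using Hy x0(2) by (metis order_less_irrefl)+
    let ?Q = "pair_aux (remove1 x0 A) ys"
    show ?thesis unfolding pa H_def[symmetric]
    proof (intro conjI ballI)
      fix x assume x: "x \<in> set A"
      show "x \<notin> fst ` set ((x0, y) # ?Q) \<longleftrightarrow> (\<forall>s<x. H s < H x)"
      proof (cases "x = x0")
        case True
        then show ?thesis using nx by simp
      next
        case False
        then have "x \<notin> fst ` set ((x0, y) # ?Q) \<longleftrightarrow> x \<notin> fst ` set ?Q" by simp
        also have "\<dots> \<longleftrightarrow> (\<forall>s<x. H' s < H' x)" using IH x False by blast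
        finally show ?thesis using left x False by blast
      qed
    next
      fix v assume v: "v \<in> set (y # ys)"
      show "v \<notin> snd ` set ((x0, y) # ?Q) \<longleftrightarrow> (\<forall>t>v. H t < H v)"
      proof (cases "v = y")
        case True
        then show ?thesis using ny by simp
      next
        case False
        then have "v \<notin> snd ` set ((x0, y) # ?Q) \<longleftrightarrow> v \<notin> snd ` set ?Q" by simp
        also have "\<dots> \<longleftrightarrow> (\<forall>t>v. H' t < H' v)" using IH v False by auto
        finally show ?thesis using right v False by auto
      qed
    qed
  qed
qed

section \<open>The crystal operators in terms of heights\<close>

lemma unpaired_left_eq:
  assumes "sorted_wrt (<) a" "sorted_wrt (<) b"
  shows "unpaired_left a b = {x \<in> set a. \<forall>s<x. ht (set a) (set b) s < ht (set a) (set b) x}"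
  using pair_aux_unpaired[of a "rev b"] assms
  by (auto simp: unpaired_left_def pairing_def strict_sorted_iff sorted_wrt_rev)

lemma unpaired_right_eq:
  assumes "sorted_wrt (<) a" "sorted_wrt (<) b"
  shows "unpaired_right a b = {y \<in> set b. \<forall>t>y. ht (set a) (set b) t < ht (set a) (set b) y}"
  using pair_aux_unpaired[of a "rev b"] assms
  by (auto simp: unpaired_right_def pairing_def strict_sorted_iff sorted_wrt_rev)

lemma record_mem: "finite A \<Longrightarrow> finite B \<Longrightarrow> (\<forall>s<x. ht A B s < ht A B x) \<Longrightarrow> x \<in> A"
  using ht_step[of A B x] by (auto dest: spec[of _ "x - 1"] split: if_splits)

lemma last_record_mem: "finite A \<Longrightarrow> finite B \<Longrightarrow> (\<forall>t>y. ht A B t < ht A B y) \<Longrightarrow> y \<in> B"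
  using ht_step'[of A B y] by (auto dest: spec[of _ "y + 1"] split: if_splits)

lemma first_above:
  fixes g :: "int \<Rightarrow> int"
  assumes "x < t" "c < g t"
  obtains u where "x < u" "c < g u" "\<And>s. x < s \<Longrightarrow> s < u \<Longrightarrow> g s \<le> c"
proof -
  have "c < g (x + 1 + int (nat (t - x - 1)))" using assms by simp
  then have "\<exists>n. c < g (x + 1 + int n)" by blast
  then obtain n where n: "c < g (x + 1 + int n)" "\<And>k. k < n \<Longrightarrow> \<not> c < g (x + 1 + int k)"
    using exists_least_iff[of "\<lambda>n. c < g (x + 1 + int n)"] by blast
  show ?thesis
  proof (rule that[of "x + 1 + int n"])
    show "g s \<le> c" if "x < s" "s < x + 1 + int n" for s
    proof -
      have "nat (s - x - 1) < n" using that by linarith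
      then show ?thesis using n(2)[of "nat (s - x - 1)"] that by simp
    qed
  qed (use n in auto)
qed

lemma last_above:
  fixes g :: "int \<Rightarrow> int"
  assumes "t < x" "c < g t"
  obtains u where "u < x" "c < g u" "\<And>s. u < s \<Longrightarrow> s < x \<Longrightarrow> g s \<le> c"
proof -
  obtain u where u: "- x < u" "c < g (- u)" "\<And>s. - x < s \<Longrightarrow> s < u \<Longrightarrow> g (- s) \<le> c"
    using first_above[of "- x" "- t" c "\<lambda>s. g (- s)"] assms by auto
  show ?thesis
  proof (rule that[of "- u"])
    show "g s \<le> c" if "- u < s" "s < x" for s using u(3)[of "- s"] that by simp
  qed (use u in auto)
qed

lemma ht_low:
  assumes "finite A" "finite B"
  obtains m where "\<And>s. s < m \<Longrightarrow> ht A B s = 0"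
proof -
  have "finite (A \<union> B)" using assms by simp
  then obtain m where m: "\<And>v. v \<in> A \<union> B \<Longrightarrow> m \<le> v" by (metis bdd_below.unfold bdd_below_finite)
  have "ht A B s = 0" if "s < m" for s
  proof -
    have "{a \<in> A. a \<le> s} = {}" "{b \<in> B. b < s} = {}" using m that by force+
    then show ?thesis by (simp only: ht_def card.empty)
  qed
  then show ?thesis using that by blast
qed

text \<open>Far to the left the height is zero. A positive height therefore yields a record, namely
  the first point where it becomes positive, and conversely a record has positive height.\<close>

lemma unpaired_left_empty_iff:
  assumes "sorted_wrt (<) a" "sorted_wrt (<) b"
  shows "unpaired_left a b = {} \<longleftrightarrow> (\<forall>t. ht (set a) (set b) t \<le> 0)"
proof -
  let ?h = "ht (set a) (set b)"
  obtain m where m: "\<And>s. s < m \<Longrightarrow> ?h s = 0" using ht_low[of "set a" "set b"] by auto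
  show ?thesis
  proof (intro iffI allI)
    fix t assume U: "unpaired_left a b = {}"
    show "?h t \<le> 0"
    proof (rule ccontr)
      assume "\<not> ?h t \<le> 0"
      \<comment> \<open>The search starts to the left of \<open>t\<close>, at a point where the
        height is still zero.\<close>
      then have "min m t - 1 < t" "0 < ?h t" by auto
      then obtain u where u: "min m t - 1 < u" "0 < ?h u" "\<And>s. min m t - 1 < s \<Longrightarrow> s < u \<Longrightarrow> ?h s \<le> 0"
        using first_above[of "min m t - 1" t 0 ?h] by blast
      have "?h s < ?h u" if "s < u" for s
        using u(2) u(3)[of s] m[of s] that by (cases "min m t - 1 < s") auto
      moreover from this have "u \<in> set a" using record_mem[of "set a" "set b" u] by simp
      ultimately show False using U unfolding unpaired_left_eq[OF assms] by blast
    qed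
  next
    assume le: "\<forall>t. ?h t \<le> 0"
    have False if "\<forall>s<x. ?h s < ?h x" for x
    proof -
      have "?h (min m x - 1) < ?h x" using that by simp
      then show False using m[of "min m x - 1"] le[rule_format, of x] by simp
    qed
    then show "unpaired_left a b = {}" unfolding unpaired_left_eq[OF assms] by blast
  qed
qed

text \<open>A higher value to the right of the last record would produce a further record. So the
  last record is a maximum, and being a record it is the first one.\<close>

lemma unpaired_left_first_max:
  assumes "sorted_wrt (<) a" "sorted_wrt (<) b"
  shows "unpaired_left a b \<noteq> {} \<Longrightarrow> first_max (set a) (set b) (Max (unpaired_left a b))"
    and "first_max (set a) (set b) x \<Longrightarrow> unpaired_left a b \<noteq> {} \<and> Max (unpaired_left a b) = x"
proof -
  let ?h = "ht (set a) (set b)" and ?U = "unpaired_left a b"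
  have U: "x \<in> ?U \<longleftrightarrow> (\<forall>s<x. ?h s < ?h x)" for x
    unfolding unpaired_left_eq[OF assms] using record_mem[of "set a" "set b" x] by auto
  have fin: "finite ?U" unfolding unpaired_left_eq[OF assms] by simp
  show "first_max (set a) (set b) (Max ?U)" if "?U \<noteq> {}"
  proof -
    let ?x = "Max ?U"
    have x: "\<forall>s<?x. ?h s < ?h ?x" using Max_in[OF fin that] U by blast
    have "?h t \<le> ?h ?x" if "?x < t" for t
    proof (rule ccontr)
      assume "\<not> ?h t \<le> ?h ?x"
      then have "?h ?x < ?h t" by simp
      then obtain u where u: "?x < u" "?h ?x < ?h u" "\<And>s. ?x < s \<Longrightarrow> s < u \<Longrightarrow> ?h s \<le> ?h ?x"
        using first_above[of ?x t "?h ?x" ?h] \<open>?x < t\<close> by blast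
      have "?h s < ?h u" if "s < u" for s
        using u(2) u(3)[of s] x[rule_format, of s] that by (cases s ?x rule: linorder_cases) auto
      then have "u \<in> ?U" using U by blast
      then show False using Max_ge[OF fin] u(1) by (meson linorder_not_le)
    qed
    then show ?thesis using x by (intro first_maxI) auto
  qed
  show "?U \<noteq> {} \<and> Max ?U = x" if fm: "first_max (set a) (set b) x"
  proof -
    have x: "x \<in> ?U" using fm U by (simp add: first_max_def)
    have "u \<le> x" if "u \<in> ?U" for u
    proof (rule ccontr)
      assume "\<not> u \<le> x"
      then have "?h x < ?h u" using that U by simp
      then show False using fm by (auto simp: first_max_def not_less[symmetric])
    qed
    then show ?thesis using x Max_eqI[OF fin] by blast
  qed
qed

definition last_max :: "int set \<Rightarrow> int set \<Rightarrow> int \<Rightarrow> bool" where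
  "last_max A B y \<longleftrightarrow> (\<forall>t. ht A B t \<le> ht A B y) \<and> (\<forall>t>y. ht A B t < ht A B y)"

lemma unpaired_right_last_max:
  assumes "sorted_wrt (<) a" "sorted_wrt (<) b"
  shows "unpaired_right a b \<noteq> {} \<Longrightarrow> last_max (set a) (set b) (Min (unpaired_right a b))"
    and "last_max (set a) (set b) x \<Longrightarrow> unpaired_right a b \<noteq> {} \<and> Min (unpaired_right a b) = x"
proof -
  let ?h = "ht (set a) (set b)" and ?U = "unpaired_right a b"
  have U: "x \<in> ?U \<longleftrightarrow> (\<forall>t>x. ?h t < ?h x)" for x
    unfolding unpaired_right_eq[OF assms] using last_record_mem[of "set a" "set b" x] by auto
  have fin: "finite ?U" unfolding unpaired_right_eq[OF assms] by simp
  show "last_max (set a) (set b) (Min ?U)" if "?U \<noteq> {}"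
  proof -
    let ?x = "Min ?U"
    have x: "\<forall>t>?x. ?h t < ?h ?x" using Min_in[OF fin that] U by blast
    have "?h t \<le> ?h ?x" if "t < ?x" for t
    proof (rule ccontr)
      assume "\<not> ?h t \<le> ?h ?x"
      then have "?h ?x < ?h t" by simp
      then obtain u where u: "u < ?x" "?h ?x < ?h u" "\<And>s. u < s \<Longrightarrow> s < ?x \<Longrightarrow> ?h s \<le> ?h ?x"
        using last_above[of t ?x "?h ?x" ?h] \<open>t < ?x\<close> by blast
      have "?h s < ?h u" if "u < s" for s
        using u(2) u(3)[of s] x[rule_format, of s] that by (cases s ?x rule: linorder_cases) auto
      then have "u \<in> ?U" using U by blast
      then show False using Min_le[OF fin] u(1) by (meson linorder_not_le)
    qed
    then have "?h t \<le> ?h ?x" for t using x[rule_format, of t] by (cases t ?x rule: linorder_cases) auto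
    then show ?thesis using x by (simp add: last_max_def)
  qed
  show "?U \<noteq> {} \<and> Min ?U = x" if lm: "last_max (set a) (set b) x"
  proof -
    have x: "x \<in> ?U" using lm U by (simp add: last_max_def)
    have "x \<le> u" if "u \<in> ?U" for u
    proof (rule ccontr)
      assume "\<not> x \<le> u"
      then have "?h x < ?h u" using that U by simp
      then show False using lm by (auto simp: last_max_def not_less[symmetric])
    qed
    then show ?thesis using x Min_eqI[OF fin] by blast
  qed
qed

section \<open>Lowering and raising as explicit operations\<close>

definition raise :: "int set \<Rightarrow> int set \<Rightarrow> int \<Rightarrow> int \<Rightarrow> bool" where
  "raise A B x y \<longleftrightarrow> last_max A B y \<and> x \<le> y \<and> {x<..y} \<subseteq> A \<and> x \<notin> A"

lemma lower_exists:
  assumes "finite B" "first_max A B x" obtains y where "lower A B x y"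
proof (cases "x \<in> B")
  case True
  then obtain y where "nxt B x y" using nxt_exists assms by blast
  then show ?thesis using that[of y] assms by (simp add: lower_def nxt_def)
next
  case False
  then show ?thesis using that[of x] assms by (simp add: lower_def)
qed

lemma raise_exists:
  assumes "finite A" "last_max A B y" obtains x where "raise A B x y"
proof (cases "y \<in> A")
  case True
  \<comment> \<open>\<open>nxt\<close> searches upwards, so the gap below \<open>y\<close> is found
    in the reflected set.\<close>
  then have "- y \<in> uminus ` A" by simp
  then obtain u where u: "nxt (uminus ` A) (- y) u" using nxt_exists[of "uminus ` A"] assms by blast
  have "{- u<..y} \<subseteq> A"
  proof
    fix v assume "v \<in> {- u<..y}"
    then have "- v \<in> {- y..<u}" by auto
    then have "- v \<in> uminus ` A" using u unfolding nxt_def by blast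
    then show "v \<in> A" by force
  qed
  moreover have "- u \<notin> A" using u by (force simp: nxt_def)
  ultimately show ?thesis using that[of "- u"] u assms by (auto simp: raise_def nxt_def)
next
  case False
  then show ?thesis using that[of y] assms by (simp add: raise_def)
qed

lemma lower_Least: "lower A B x y \<Longrightarrow> (LEAST y. x \<le> y \<and> y \<notin> B) = y"
proof (rule Least_equality)
  fix z assume "lower A B x y" "x \<le> z \<and> z \<notin> B"
  then have "z \<notin> {x..<y}" unfolding lower_def by blast
  then show "y \<le> z" using \<open>x \<le> z \<and> z \<notin> B\<close> by simp
qed (simp add: lower_def)

lemma raise_Greatest: "raise A B x y \<Longrightarrow> (GREATEST x. x \<le> y \<and> x \<notin> A) = x"
proof (rule Greatest_equality)
  fix z assume "raise A B x y" "z \<le> y \<and> z \<notin> A"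
  then have "z \<notin> {x<..y}" unfolding raise_def by blast
  then show "z \<le> x" using \<open>z \<le> y \<and> z \<notin> A\<close> by simp
qed (simp add: raise_def)

lemma remove1_eq_sl: "sorted_wrt (<) a \<Longrightarrow> remove1 x a = sl (set a - {x})"
  using sl_set[of "remove1 x a"] by (simp add: strict_sorted_iff sorted_remove1)

lemma insort_eq_sl: "sorted_wrt (<) b \<Longrightarrow> y \<notin> set b \<Longrightarrow> insort y b = sl (insert y (set b))"
  using sl_set[of "insort y b"] by (simp add: strict_sorted_iff sorted_insort distinct_insort set_insort_key)

lemma adjacent_factors:
  assumes "i = Suc (length W1)"
  shows "(W1 @ [a, b] @ W2) ! (i - 1) = a" "(W1 @ [a, b] @ W2) ! i = b"
    "(W1 @ [a, b] @ W2)[i - 1 := c, i := d] = W1 @ [c, d] @ W2"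
  using assms by (auto simp: nth_append list_update_append)

lemma fop_factors:
  assumes "sorted_wrt (<) a" "sorted_wrt (<) b" "i = Suc (length W1)"
  shows "(\<forall>t. ht (set a) (set b) t \<le> 0) \<Longrightarrow> fop i (W1 @ [a, b] @ W2) = None"
    and "lower (set a) (set b) x y
      \<Longrightarrow> fop i (W1 @ [a, b] @ W2) = Some (W1 @ [sl (set a - {x}), sl (insert y (set b))] @ W2)"
    and "\<not> (\<forall>t. ht (set a) (set b) t \<le> 0) \<Longrightarrow> \<exists>x y. lower (set a) (set b) x y"
proof -
  note nth = adjacent_factors(1,2)[OF assms(3)] and upd = adjacent_factors(3)[OF assms(3)]
  show "fop i (W1 @ [a, b] @ W2) = None" if "\<forall>t. ht (set a) (set b) t \<le> 0"
    using unpaired_left_empty_iff[OF assms(1,2)] that unfolding fop_def nth Let_def by simp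
  show "fop i (W1 @ [a, b] @ W2) = Some (W1 @ [sl (set a - {x}), sl (insert y (set b))] @ W2)"
    if l: "lower (set a) (set b) x y"
  proof -
    have U: "unpaired_left a b \<noteq> {}" "Max (unpaired_left a b) = x"
      using unpaired_left_first_max(2)[OF assms(1,2)] l by (auto simp: lower_def)
    have "y \<notin> set b" using l by (simp add: lower_def)
    then show ?thesis
      unfolding fop_def nth Let_def if_not_P[OF U(1)] U(2) lower_Least[OF l] upd
        remove1_eq_sl[OF assms(1)] using insort_eq_sl[OF assms(2)] by simp
  qed
  show "\<exists>x y. lower (set a) (set b) x y" if "\<not> (\<forall>t. ht (set a) (set b) t \<le> 0)"
  proof -
    have "first_max (set a) (set b) (Max (unpaired_left a b))"
      using unpaired_left_first_max(1)[OF assms(1,2)] unpaired_left_empty_iff[OF assms(1,2)] that by blast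
    then show ?thesis using lower_exists by (metis List.finite_set)
  qed
qed

lemma eop_factors:
  assumes "sorted_wrt (<) a" "sorted_wrt (<) b" "i = Suc (length W1)"
  shows "raise (set a) (set b) x y
      \<Longrightarrow> eop i (W1 @ [a, b] @ W2) = Some (W1 @ [sl (insert x (set a)), sl (set b - {y})] @ W2)"
    and "eop i (W1 @ [a, b] @ W2) \<noteq> None \<Longrightarrow> \<exists>x y. raise (set a) (set b) x y"
proof -
  note nth = adjacent_factors(1,2)[OF assms(3)] and upd = adjacent_factors(3)[OF assms(3)]
  show "eop i (W1 @ [a, b] @ W2) = Some (W1 @ [sl (insert x (set a)), sl (set b - {y})] @ W2)"
    if l: "raise (set a) (set b) x y"
  proof -
    have U: "unpaired_right a b \<noteq> {}" "Min (unpaired_right a b) = y"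
      using unpaired_right_last_max(2)[OF assms(1,2)] l by (auto simp: raise_def)
    have "x \<notin> set a" using l by (simp add: raise_def)
    then show ?thesis
      unfolding eop_def nth Let_def if_not_P[OF U(1)] U(2) raise_Greatest[OF l] upd
        remove1_eq_sl[OF assms(2)] using insort_eq_sl[OF assms(1)] by simp
  qed
  show "\<exists>x y. raise (set a) (set b) x y" if "eop i (W1 @ [a, b] @ W2) \<noteq> None"
  proof -
    have "unpaired_right a b \<noteq> {}" using that unfolding eop_def nth Let_def by meson
    then have "last_max (set a) (set b) (Min (unpaired_right a b))"
      using unpaired_right_last_max(1)[OF assms(1,2)] by blast
    then show ?thesis using raise_exists by (metis List.finite_set)
  qed
qed

text \<open>Lowering subtracts one from the height from \<open>x\<close> on and another one beyond
  \<open>y\<close>. The maximum drops by one and is last attained at \<open>y\<close>.\<close>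

lemma lower_raise:
  assumes "finite A" "finite B" "supported A B" "lower A B x y"
  shows "raise (A - {x}) (insert y B) x y"
proof -
  interpret lowering A B x y by unfold_locales (use assms in auto)
  let ?h = "ht A B" and ?h' = "ht (A - {x}) (insert y B)"
  have h': "?h' t = ?h t - (if x \<le> t then 1 else 0) - (if y < t then 1 else 0)" for t
    using ht_insert_right[of B y "A - {x}" t] ht_remove_left[OF fin(1) basic(7), of B t] basic(5) fin by simp
  have hy: "?h' y = ?h x - 1" using h'[of y] basic(9)[of y] basic(1) by simp
  have gt: "?h' t < ?h' y" if "y < t" for t using h'[of t] hy basic(10)[of t] basic(1) that by simp
  have "?h' t \<le> ?h' y" for t
    using h'[of t] hy basic(10)[of t] basic(11)[of t] by (cases "t < x") auto
  then have "last_max (A - {x}) (insert y B) y" using gt by (simp add: last_max_def)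
  then show ?thesis using basic(1,3) by (auto simp: raise_def)
qed

text \<open>Raising adds one to the height from \<open>x\<close> on and another one beyond
  \<open>y\<close>; as \<open>y\<close> was the last maximum, the maximum grows by one and is first
  attained at \<open>x\<close>. The block in \<open>B\<close>, which \<open>raise\<close> does not
  mention, comes from \<open>supported\<close>.\<close>

lemma raise_lower:
  assumes fin: "finite A" "finite B" and sup: "supported A B" and r: "raise A B x y"
  shows "y \<in> B" "x \<notin> A" "supported (insert x A) (B - {y})" "lower (insert x A) (B - {y}) x y"
    "P (cw (insert x A) (B - {y})) = P (cw A B)"
proof -
  let ?h = "ht A B" and ?h' = "ht (insert x A) (B - {y})"
  have x: "x \<le> y" "{x<..y} \<subseteq> A" "x \<notin> A" and lm: "\<And>t. ?h t \<le> ?h y" "\<And>t. y < t \<Longrightarrow> ?h t < ?h y"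
    using r by (auto simp: raise_def last_max_def)
  show "x \<notin> A" by (rule x)
  show yB: "y \<in> B" using last_record_mem[OF fin] lm(2) by blast
  have yA: "y + 1 \<notin> A" using ht_step'[OF fin, of y] lm(2)[of "y + 1"] yB by (auto split: if_splits)
  have xB: "{x..y} \<subseteq> B"
  proof (rule ccontr)
    assume "\<not> {x..y} \<subseteq> B"
    then obtain v where v: "x \<le> v" "v \<le> y" "v \<notin> B" by (meson atLeastAtMost_iff subsetI)
    \<comment> \<open>The indicator of the complement of \<open>B\<close> turns
      \<open>last_above\<close> into a search for the last gap \<open>u\<close> of \<open>B\<close>
      up to \<open>y\<close>; the interval after \<open>u\<close> will violate
      \<open>supported\<close>.\<close>
    have "v < y + 1" "(if v \<in> B then 0 else 1) > (0::int)" using v by auto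
    then obtain u where u: "u < y + 1" "u \<notin> B" "\<And>s. u < s \<Longrightarrow> s < y + 1 \<Longrightarrow> s \<in> B" "v \<le> u"
    proof (rule last_above[of v "y + 1" 0 "\<lambda>v. if v \<in> B then 0 else 1"])
      fix u :: int
      assume *: "u < y + 1" "0 < (if u \<in> B then 0 else 1 :: int)"
        "\<And>s. u < s \<Longrightarrow> s < y + 1 \<Longrightarrow> (if s \<in> B then 0 else 1 :: int) \<le> 0"
      have 1: "u \<notin> B" using *(2) by (auto split: if_splits)
      have 2: "s \<in> B" if "u < s" "s < y + 1" for s using *(3)[OF that] by (auto split: if_splits)
      have "v \<le> u" using 2[of v] v by force
      then show thesis using that[of u] 1 2 *(1) by blast
    qed
    have "u \<noteq> y" using u(2) yB by blast
    have "{u + 1..y} \<subseteq> A" using x(2) u(4) v(1) by (auto simp: subset_iff)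
    moreover have "{u + 1..y} \<subseteq> B" using u(3) by auto
    ultimately show False using supportedD[OF sup, of "u + 1" y] u(1,2) \<open>u \<noteq> y\<close> yA by auto
  qed
  have const: "?h t = ?h x" if "x \<le> t" "t \<le> y" for t
    using that
  proof (induction t rule: int_ge_induct)
    case (step t)
    have "t \<in> {x..y}" "t + 1 \<in> {x<..y}" using step by auto
    then have "t \<in> B" "t + 1 \<in> A" using xB x(2) by blast+
    then show ?case using step ht_step'[OF fin, of t] by auto
  qed simp
  have hx: "?h x = ?h y" using const[of y] x by simp
  have x1: "x - 1 \<notin> B" using ht_step[OF fin, of x] hx lm(1)[of "x - 1"] x(3) by (auto split: if_splits)
  have h': "?h' t = ?h t + (if x \<le> t then 1 else 0) + (if y < t then 1 else 0)" for t
    using ht_remove_right[OF fin(2) yB, of "insert x A" t] ht_insert_left[OF fin(1) x(3), of B t] by simp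
  have "first_max (insert x A) (B - {y}) x"
  proof (rule first_maxI)
    show "?h' x = ?h y + 1" using h'[of x] hx x(1) by simp
    show "?h' t \<le> ?h y + 1" if "x < t" for t using h'[of t] lm(1)[of t] lm(2)[of t] by auto
    show "?h' t < ?h y + 1" if "t < x" for t using h'[of t] lm(1)[of t] x(1) that by auto
  qed
  moreover have "{x..<y} \<subseteq> B - {y}" using xB by (auto simp: subset_iff)
  ultimately show "lower (insert x A) (B - {y}) x y" using x(1) by (simp add: lower_def)
  have "{x..y} \<subseteq> insert x A"
  proof
    fix u assume "u \<in> {x..y}"
    then have "u = x \<or> u \<in> {x<..y}" by auto
    then show "u \<in> insert x A" using x(2) by blast
  qed
  then have "P (cw (insert x A) (B - {y})) = P (cw (insert x A - {x}) (insert y (B - {y})))"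
    using x(1) xB x1 yA fin by (intro P_cw_block) auto
  moreover have "insert x A - {x} = A" "insert y (B - {y}) = B" using x(3) yB by auto
  ultimately show eq: "P (cw (insert x A) (B - {y})) = P (cw A B)" by simp
  have "card (insert x A) + card (B - {y}) = card A + card B"
    using card_Suc_Diff1[OF fin(2) yB] fin x(3) by simp
  then show "supported (insert x A) (B - {y})"
    using supported_cong[OF _ _ fin eq] sup fin by simp
qed

section \<open>The isomorphism\<close>

text \<open>Every word represents an element of \<open>SZ\<close>, so the union over all
  permutations imposes nothing beyond reducedness.\<close>

definition factorizations :: "nat \<Rightarrow> int list list set" where
  "factorizations n = {w. length w = n \<and> (\<forall>u\<in>set w. sorted_wrt (<) u) \<and> reduced (concat w)}"

lemma Union_Rn: "(\<Union>\<sigma>\<in>SZ. Rn n \<sigma>) = factorizations n"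
  using P_SZ by (auto simp: Rn_def Rwords_def factorizations_def)

section \<open>Bumping factorizations\<close>

lemma split_by_props:
  "sum_list ks = length v \<Longrightarrow> concat (split_by ks v) = v \<and> map length (split_by ks v) = ks"
proof (induction ks arbitrary: v)
  case (Cons k ks)
  then have "sum_list ks = length (drop k v)" "k \<le> length v" by auto
  then show ?case using Cons.IH[of "drop k v"] by simp
qed simp

lemma split_by_concat: "split_by (map length W) (concat W) = W"
  by (induction W) auto

lemma bump_fact_eqI: "map length W = map length w \<Longrightarrow> concat W = bump \<pi> (concat w) \<Longrightarrow> bump_fact \<pi> w = W"
  unfolding bump_fact_def by (metis split_by_concat)

lemma bump_fact_props:
  "reduced (concat w) \<Longrightarrow> concat (bump_fact \<pi> w) = bump \<pi> (concat w) \<and> map length (bump_fact \<pi> w) = map length w"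
  unfolding bump_fact_def using bump_props[of "concat w" \<pi>]
  by (intro split_by_props) (simp add: length_concat)

lemma sorted_iff_ascents:
  fixes u :: "int list"
  shows "sorted_wrt (<) u \<longleftrightarrow> (\<forall>j. Suc j < length u \<longrightarrow> u ! j < u ! Suc j)"
  by (rule sorted_wrt_iff_nth_Suc_transp) (rule transp_on_less)

lemma sorted_split_by_cong:
  fixes u v :: "int list"
  assumes "length u = length v" "\<And>j. Suc j < length u \<Longrightarrow> u ! j < u ! Suc j \<longleftrightarrow> v ! j < v ! Suc j"
  shows "(\<forall>f\<in>set (split_by ks u). sorted_wrt (<) f) \<longleftrightarrow> (\<forall>f\<in>set (split_by ks v). sorted_wrt (<) f)"
  using assms
proof (induction ks arbitrary: u v)
  case (Cons k ks)
  have "sorted_wrt (<) (take k u) \<longleftrightarrow> sorted_wrt (<) (take k v)"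
    unfolding sorted_iff_ascents using Cons.prems by auto
  moreover have "(\<forall>f\<in>set (split_by ks (drop k u)). sorted_wrt (<) f) \<longleftrightarrow> (\<forall>f\<in>set (split_by ks (drop k v)). sorted_wrt (<) f)"
    using Cons.prems by (intro Cons.IH) (auto simp: less_diff_conv add.commute)
  ultimately show ?case by simp
qed simp

text \<open>One direction shows that bumps preserve factorizations, the other that the preimage of a
  factorization is again one.\<close>

lemma bump_fact_sorted_iff:
  assumes "reduced (concat w)"
  shows "(\<forall>u\<in>set (bump_fact \<pi> w). sorted_wrt (<) u) \<longleftrightarrow> (\<forall>u\<in>set w. sorted_wrt (<) u)"
proof -
  have "(\<forall>u\<in>set (split_by (map length w) (bump \<pi> (concat w))). sorted_wrt (<) u) \<longleftrightarrow>
    (\<forall>u\<in>set (split_by (map length w) (concat w)). sorted_wrt (<) u)"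
    using bump_props[OF assms, of \<pi>] bump_ascent_iff[OF assms, of _ \<pi>] by (intro sorted_split_by_cong) auto
  then show ?thesis by (simp add: bump_fact_def split_by_concat)
qed

lemma bump_fact_bij: "bij_betw (bump_fact \<pi>) (factorizations n) (factorizations n)"
  unfolding bij_betw_def
proof
  show "inj_on (bump_fact \<pi>) (factorizations n)"
  proof (rule inj_onI)
    fix w w' assume w: "w \<in> factorizations n" "w' \<in> factorizations n" "bump_fact \<pi> w = bump_fact \<pi> w'"
    then have r: "reduced (concat w)" "reduced (concat w')" by (auto simp: factorizations_def)
    then have "map length w = map length w'" "bump \<pi> (concat w) = bump \<pi> (concat w')"
      using bump_fact_props w(3) by metis+
    moreover from this have "concat w = concat w'" using bump_inj r by blast
    ultimately show "w = w'" by (metis split_by_concat)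
  qed
  show "bump_fact \<pi> ` factorizations n = factorizations n"
  proof
    show "bump_fact \<pi> ` factorizations n \<subseteq> factorizations n"
    proof
      fix v assume "v \<in> bump_fact \<pi> ` factorizations n"
      then obtain w where w: "w \<in> factorizations n" "v = bump_fact \<pi> w" by blast
      then have r: "reduced (concat w)" by (simp add: factorizations_def)
      show "v \<in> factorizations n"
        using w bump_fact_props[OF r, of \<pi>] bump_props[OF r, of \<pi>] bump_fact_sorted_iff[OF r, of \<pi>]
        by (auto simp: factorizations_def dest: map_eq_imp_length_eq)
    qed
    show "factorizations n \<subseteq> bump_fact \<pi> ` factorizations n"
    proof
      fix v assume v: "v \<in> factorizations n"
      then have "reduced (concat v)" by (simp add: factorizations_def)
      then obtain u where u: "reduced u" "bump \<pi> u = concat v" by (rule bump_surj)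
      define w where "w = split_by (map length v) u"
      have "sum_list (map length v) = length u"
        using bump_props[OF u(1), of \<pi>] u(2) by (simp add: length_concat)
      then have w: "concat w = u" "map length w = map length v" unfolding w_def using split_by_props by blast+
      have wv: "bump_fact \<pi> w = v" by (rule bump_fact_eqI) (use w u in auto)
      have "w \<in> factorizations n"
        using v w u bump_fact_sorted_iff[of w \<pi>] wv by (auto simp: factorizations_def dest: map_eq_imp_length_eq)
      then show "v \<in> bump_fact \<pi> ` factorizations n" using wv by blast
    qed
  qed
qed

lemma bump_fact_mem: "w \<in> factorizations n \<Longrightarrow> bump_fact \<pi> w \<in> factorizations n"
  using bump_fact_bij by (auto simp: bij_betw_def)

section \<open>Compatibility with the crystal operators\<close>

lemma factors_obtain:
  assumes "w \<in> factorizations n" "i \<in> {1..n - 1}"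
  obtains W1 a b W2 where "w = W1 @ [a, b] @ W2" "i = Suc (length W1)" "sorted_wrt (<) a" "sorted_wrt (<) b"
    "a @ b = cw (set a) (set b)" "supported (set a) (set b)"
    "reduced (concat W1 @ cw (set a) (set b) @ concat W2)"
proof -
  have len: "length w = n" "1 \<le> i" "i < n" using assms by (auto simp: factorizations_def)
  define W1 W2 a b where "W1 = take (i - 1) w" and "W2 = drop (Suc i) w" and "a = w ! (i - 1)" and "b = w ! i"
  have "w = W1 @ drop (i - 1) w" by (simp add: W1_def)
  also have "drop (i - 1) w = a # drop i w" unfolding a_def using len Cons_nth_drop_Suc[of "i - 1" w] by simp
  also have "drop i w = b # W2" unfolding b_def W2_def using len Cons_nth_drop_Suc[of i w] by simp
  finally have w: "w = W1 @ [a, b] @ W2" by simp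
  have i: "i = Suc (length W1)" using len by (simp add: W1_def)
  have s: "sorted_wrt (<) a" "sorted_wrt (<) b" using assms(1) w by (auto simp: factorizations_def)
  have cw: "a @ b = cw (set a) (set b)" by (simp add: cw_def sl_set s)
  have red: "reduced (concat W1 @ cw (set a) (set b) @ concat W2)"
    using assms(1) w unfolding cw[symmetric] by (simp add: factorizations_def)
  then have "supported (set a) (set b)" using reduced_windowD reduced_cw by (metis List.finite_set)
  then show ?thesis using that w i s cw red by blast
qed

lemma bump_fact_window:
  assumes "reduced (concat W1 @ (a @ b) @ concat W2)"
    "bump \<pi> (concat W1 @ (a @ b) @ concat W2) = L @ cw A B @ R" "length L = length (concat W1)"
    "card A = length a" "card B = length b"
  shows "bump_fact \<pi> (W1 @ [a, b] @ W2) = split_by (map length W1) L @ [sl A, sl B] @ split_by (map length W2) R"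
proof -
  have "length (L @ cw A B @ R) = length (concat W1 @ (a @ b) @ concat W2)"
    using bump_props[OF assms(1), of \<pi>] assms(2) by simp
  then have R: "length R = length (concat W2)" using assms(3-5) by (simp add: length_cw)
  have "concat (split_by (map length W1) L) = L \<and> map length (split_by (map length W1) L) = map length W1"
    by (rule split_by_props) (simp add: assms(3) length_concat)
  moreover have "concat (split_by (map length W2) R) = R \<and> map length (split_by (map length W2) R) = map length W2"
    by (rule split_by_props) (simp add: R length_concat)
  ultimately show ?thesis
    using assms by (intro bump_fact_eqI) (auto simp: cw_def)
qed

text \<open>The second assertion says that \<open>e\<close> undoes \<open>f\<close>; together with
  \<open>eop_Some\<close> it reduces statements about \<open>e\<close> to statements about
  \<open>f\<close>.\<close>

lemma fop_bump_fact:
  assumes w: "w \<in> factorizations n" "i \<in> {1..n - 1}"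
  shows "fop i (bump_fact \<pi> w) = map_option (bump_fact \<pi>) (fop i w)"
    and "fop i w = Some v \<Longrightarrow> v \<in> factorizations n \<and> eop i v = Some w"
proof -
  obtain W1 a b W2 where W: "w = W1 @ [a, b] @ W2" "i = Suc (length W1)" "sorted_wrt (<) a" "sorted_wrt (<) b"
    "a @ b = cw (set a) (set b)" "supported (set a) (set b)"
    "reduced (concat W1 @ cw (set a) (set b) @ concat W2)" using factors_obtain[OF w] by metis
  let ?A = "set a" and ?B = "set b"
  have la: "card ?A = length a" "card ?B = length b" using W(3,4) by (auto simp: strict_sorted_iff distinct_card)
  have red: "reduced (concat W1 @ (a @ b) @ concat W2)" using W(5,7) by simp
  have "fop i (bump_fact \<pi> w) = map_option (bump_fact \<pi>) (fop i w) \<and>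
    (fop i w = Some v \<longrightarrow> v \<in> factorizations n \<and> eop i v = Some w)"
  proof (cases "\<forall>t. ht ?A ?B t \<le> 0")
    case True
    have None: "fop i w = None" unfolding W(1) by (rule fop_factors(1)[OF W(3,4,2) True])
    have "top_words (card ?A) (cw ?A ?B) (cw ?A ?B)" using True W(6) unfolding top_words_def by blast
    then obtain L N N' R where b: "bump \<pi> (concat W1 @ cw ?A ?B @ concat W2) = L @ N @ R" "top_words (card ?A) N N'"
      "length L = length (concat W1)" "length N = length (cw ?A ?B)"
      using bump_related_windows[OF top_words_closed _ W(7)] by metis
    obtain A1 B1 where N: "N = cw A1 B1" "finite A1" "finite B1" "card A1 = card ?A" "\<forall>t. ht A1 B1 t \<le> 0"
      using b(2) unfolding top_words_def by blast
    have "card B1 = card ?B" using b(4) N by (simp add: length_cw)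
    then have "bump_fact \<pi> w = split_by (map length W1) L @ [sl A1, sl B1] @ split_by (map length W2) R"
      unfolding W(1) using bump_fact_window[OF red, of \<pi> L A1 B1 R] b N la W(5) by simp
    moreover have "length (split_by (map length W1) L) = length W1"
      using split_by_props[of "map length W1" L] b(3) by (metis length_concat length_map)
    ultimately have "fop i (bump_fact \<pi> w) = None"
      using fop_factors(1)[of "sl A1" "sl B1" i "split_by (map length W1) L" "split_by (map length W2) R"] N W(2) by simp
    then show ?thesis using None by simp
  next
    case False
    then obtain x y where l: "lower ?A ?B x y" using fop_factors(3)[OF W(3,4,2)] by blast
    let ?A' = "?A - {x}" and ?B' = "insert y ?B"
    have Some: "fop i w = Some (W1 @ [sl ?A', sl ?B'] @ W2)" unfolding W(1) by (rule fop_factors(2)[OF W(3,4,2) l])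
    have fin: "finite ?A" "finite ?B" by auto
    note block = lower_block[OF fin W(6) l]
    interpret lowering ?A ?B x y by unfold_locales (use W l in auto)
    have red': "reduced (concat W1 @ (sl ?A' @ sl ?B') @ concat W2)"
    proof -
      have "length (cw ?A ?B) = length (cw ?A' ?B')" using card' by (simp add: length_cw)
      then show ?thesis using reduced_window_cong[OF block(5)] W(7) by (simp add: cw_def)
    qed
    have mem: "W1 @ [sl ?A', sl ?B'] @ W2 \<in> factorizations n"
      using w(1) red' unfolding W(1) factorizations_def by auto
    have inverse: "eop i (W1 @ [sl ?A', sl ?B'] @ W2) = Some w"
    proof -
      have "raise (set (sl ?A')) (set (sl ?B')) x y" using lower_raise[OF fin W(6) l] by simp
      from eop_factors(1)[OF sorted_sl sorted_sl W(2) this]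
      have "eop i (W1 @ [sl ?A', sl ?B'] @ W2) = Some (W1 @ [sl (insert x ?A'), sl (?B' - {y})] @ W2)" by simp
      moreover have "insert x ?A' = ?A" "?B' - {y} = ?B" using basic(5,7) by auto
      ultimately show ?thesis using W by (simp add: sl_set)
    qed
    have "lowered_words (card ?A) (cw ?A ?B) (cw ?A' ?B')" by (rule lowered_wordsI[OF fin W(6) l refl])
    then obtain L N N' R where b: "bump \<pi> (concat W1 @ cw ?A ?B @ concat W2) = L @ N @ R"
      "bump \<pi> (concat W1 @ cw ?A' ?B' @ concat W2) = L @ N' @ R" "lowered_words (card ?A) N N'"
      "length L = length (concat W1)" "length N = length (cw ?A ?B)"
      using bump_related_windows[OF lowered_words_closed _ W(7)] by metis
    obtain A1 B1 x1 y1 where N: "N = cw A1 B1" "N' = cw (A1 - {x1}) (insert y1 B1)" "finite A1" "finite B1"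
      "card A1 = card ?A" "supported A1 B1" "lower A1 B1 x1 y1"
      using b(3) unfolding lowered_words_def by blast
    have cB: "card B1 = card ?B" using b(5) N by (simp add: length_cw)
    let ?V1 = "split_by (map length W1) L" and ?V2 = "split_by (map length W2) R"
    have fact: "bump_fact \<pi> w = ?V1 @ [sl A1, sl B1] @ ?V2"
      unfolding W(1) using bump_fact_window[OF red, of \<pi> L A1 B1 R] b N cB la W(5) by simp
    have "bump_fact \<pi> (W1 @ [sl ?A', sl ?B'] @ W2) = ?V1 @ [sl (A1 - {x1}), sl (insert y1 B1)] @ ?V2"
    proof (rule bump_fact_window[OF red'])
      show "bump \<pi> (concat W1 @ (sl ?A' @ sl ?B') @ concat W2) = L @ cw (A1 - {x1}) (insert y1 B1) @ R"
        using b(2) N(2) by (simp add: cw_def)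
      interpret low1: lowering A1 B1 x1 y1 by unfold_locales (use N in auto)
      show "card (A1 - {x1}) = length (sl ?A')" "card (insert y1 B1) = length (sl ?B')"
        using low1.card' card' N(5) cB by simp_all
    qed (rule b(4))
    moreover have "length ?V1 = length W1"
      using split_by_props[of "map length W1" L] b(4) by (metis length_concat length_map)
    then have "fop i (?V1 @ [sl A1, sl B1] @ ?V2) = Some (?V1 @ [sl (A1 - {x1}), sl (insert y1 B1)] @ ?V2)"
      using fop_factors(2)[of "sl A1" "sl B1" i ?V1 x1 y1 ?V2] N W(2) by simp
    ultimately have "fop i (bump_fact \<pi> w) = map_option (bump_fact \<pi>) (fop i w)"
      unfolding fact Some by simp
    then show ?thesis using Some mem inverse by auto
  qed
  then show "fop i (bump_fact \<pi> w) = map_option (bump_fact \<pi>) (fop i w)"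
    and "fop i w = Some v \<Longrightarrow> v \<in> factorizations n \<and> eop i v = Some w" by auto
qed

lemma eop_Some:
  assumes w: "w \<in> factorizations n" "i \<in> {1..n - 1}" and v: "eop i w = Some v"
  shows "v \<in> factorizations n \<and> fop i v = Some w"
proof -
  obtain W1 a b W2 where W: "w = W1 @ [a, b] @ W2" "i = Suc (length W1)" "sorted_wrt (<) a" "sorted_wrt (<) b"
    "a @ b = cw (set a) (set b)" "supported (set a) (set b)"
    "reduced (concat W1 @ cw (set a) (set b) @ concat W2)" using factors_obtain[OF w] by metis
  let ?A = "set a" and ?B = "set b"
  have fin: "finite ?A" "finite ?B" by auto
  obtain x y where r: "raise ?A ?B x y" using eop_factors(2)[OF W(3,4,2), of W2] v W(1) by auto
  let ?A' = "insert x ?A" and ?B' = "?B - {y}"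
  note rl = raise_lower[OF fin W(6) r]
  have v: "v = W1 @ [sl ?A', sl ?B'] @ W2" using eop_factors(1)[OF W(3,4,2) r, of W2] v W(1) by simp
  have "length (cw ?A' ?B') = length (cw ?A ?B)"
    using card_Suc_Diff1[OF fin(2) rl(1)] rl(2) by (simp add: length_cw)
  then have "reduced (concat W1 @ cw ?A' ?B' @ concat W2)" using reduced_window_cong[OF rl(5)] W(7) by simp
  then have mem: "v \<in> factorizations n"
    using w(1) unfolding W(1) v factorizations_def by (auto simp: cw_def)
  have "lower (set (sl ?A')) (set (sl ?B')) x y" using rl(4) by simp
  from fop_factors(2)[OF sorted_sl sorted_sl W(2) this, of W2]
  have "fop i v = Some (W1 @ [sl (?A' - {x}), sl (insert y ?B')] @ W2)" unfolding v by simp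
  moreover have "?A' - {x} = ?A" "insert y ?B' = ?B" using rl(1,2) by auto
  ultimately show ?thesis using W mem by (simp add: sl_set)
qed

lemma eop_bump_fact:
  assumes w: "w \<in> factorizations n" "i \<in> {1..n - 1}"
  shows "eop i (bump_fact \<pi> w) = map_option (bump_fact \<pi>) (eop i w)"
proof (cases "eop i w")
  case (Some c)
  have c: "c \<in> factorizations n" "fop i c = Some w" using eop_Some[OF w Some] by auto
  have "fop i (bump_fact \<pi> c) = Some (bump_fact \<pi> w)" using fop_bump_fact(1)[OF c(1) w(2)] c(2) by simp
  then show ?thesis using fop_bump_fact(2)[OF bump_fact_mem[OF c(1)] w(2)] Some by simp
next
  case None
  \<comment> \<open>If the bumped word could be raised, the result would be the bump of some
    \<open>c\<close>; lowering \<open>c\<close> gives a preimage of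
    \<open>bump_fact \<pi> w\<close>, hence \<open>w\<close> itself, so \<open>w\<close> could be
    raised to \<open>c\<close>.\<close>
  have "eop i (bump_fact \<pi> w) = None"
  proof (rule ccontr)
    assume "eop i (bump_fact \<pi> w) \<noteq> None"
    then obtain d where d: "eop i (bump_fact \<pi> w) = Some d" by blast
    have d2: "d \<in> factorizations n" "fop i d = Some (bump_fact \<pi> w)" using eop_Some[OF bump_fact_mem[OF w(1)] w(2) d] by auto
    obtain c where c: "c \<in> factorizations n" "d = bump_fact \<pi> c"
      using d2(1) bump_fact_bij[of \<pi> n] by (auto simp: bij_betw_def)
    obtain v where v: "fop i c = Some v" "bump_fact \<pi> v = bump_fact \<pi> w"
      using fop_bump_fact(1)[OF c(1) w(2), of \<pi>] d2(2) c(2) by auto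
    have v2: "v \<in> factorizations n" "eop i v = Some c" using fop_bump_fact(2)[OF c(1) w(2) v(1)] by auto
    have "v = w" using bump_fact_bij[of \<pi> n] v(2) v2(1) w(1) by (auto simp: bij_betw_def dest: inj_onD)
    then show False using v2 None by simp
  qed
  then show ?thesis using None by simp
qed

text \<open>Commutation is only known on \<open>S\<close>, so \<open>S\<close> has to be closed
  under \<open>g\<close>; all iterates then correspond, and with them the greatest length.\<close>

lemma str_len_cong:
  assumes "\<And>b. b \<in> S \<Longrightarrow> g (\<phi> b) = map_option \<phi> (g b)" "\<And>b c. b \<in> S \<Longrightarrow> g b = Some c \<Longrightarrow> c \<in> S" "b \<in> S"
  shows "str_len g (\<phi> b) = str_len g b"
proof -
  have "opt_iter g k (\<phi> b) = map_option \<phi> (opt_iter g k b) \<and> (\<forall>c. opt_iter g k b = Some c \<longrightarrow> c \<in> S)" for k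
  proof (induction k)
    case (Suc k)
    then show ?case using assms(1,2) by (cases "opt_iter g k b") auto
  qed (simp add: assms(3))
  then show ?thesis by (simp add: str_len_def)
qed

theorem theorem4p5:
  fixes n :: nat and \<pi> :: "int \<Rightarrow> int"
  assumes "1 \<le> n" and "\<pi> \<in> SZ"
  shows "crystal_iso n (\<Union>\<sigma>\<in>SZ. Rn n \<sigma>) wt eop fop (\<Union>\<sigma>\<in>SZ. Rn n \<sigma>) wt eop fop (bump_fact \<pi>)"
  unfolding crystal_iso_def Union_Rn
proof (intro conjI ballI)
  show "bij_betw (bump_fact \<pi>) (factorizations n) (factorizations n)" by (rule bump_fact_bij)
  show "wt (bump_fact \<pi> b) = wt b" if "b \<in> factorizations n" for b
    using that bump_fact_props[of b \<pi>] by (simp add: wt_def factorizations_def)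
  fix i b assume i: "i \<in> {1..n - 1}" and b: "b \<in> factorizations n"
  show "eop i (bump_fact \<pi> b) = map_option (bump_fact \<pi>) (eop i b)" by (rule eop_bump_fact[OF b i])
  show "fop i (bump_fact \<pi> b) = map_option (bump_fact \<pi>) (fop i b)" by (rule fop_bump_fact(1)[OF b i])
  show "str_len (eop i) (bump_fact \<pi> b) = str_len (eop i) b"
    using eop_bump_fact[OF _ i] eop_Some[OF _ i] b by (intro str_len_cong[where S = "factorizations n"]) auto
  show "str_len (fop i) (bump_fact \<pi> b) = str_len (fop i) b"
    using fop_bump_fact[OF _ i] b by (intro str_len_cong[where S = "factorizations n"]) auto
qed

end
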